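(* Let $N\in\mathbb{N}$ and let $a_j$, $j\in\mathbb{N}$, be trigonometric polynomials satisfying $$\deg(a_j)\le N,\qquad a_j(0)=1,\qquad \|a_j\|_\infty\le C<\infty,\qquad j\in\mathbb{N},$$ with $C$ independent of $j$. Let $\phi$ be the compactly supported distribution defined by $\widehat{\phi}(y)=\prod_{j=1}^\infty a_j(2^{-j}y)$, assume that the integer shifts of $\phi$ are linearly independent, and let $V_\phi$ be the shift-invariant space generated by $\phi$. If, for some $\lambda\in\mathbb{C}$ and $d\in\mathbb{N}_0$, $d\le N$, an analytic function of the form $e^{\lambda t}\sum_{k=0}^d p_k(t)\,\omega_k(t)$ belongs to $V_\phi$, where the $p_k$ are polynomials of degree $k$, the functions $\omega_k:\mathbb{R}\to\mathbb{C}$ are $1$-periodic and analytic, and $\omega_d\neq0$ (not identically zero), then the sequences $$\Bigl\{\widehat{\phi}^{(k)}\Bigl(-\frac{i\lambda}{2\pi}+\ell\Bigr)\ :\ \ell\in\mathbb{Z}\Bigr\},\qquad k=0,\ldots,d,$$ contain (all together) at most $N$ non-zero elements.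
   Context: A trigonometric polynomial of degree at most $N$ is a function $a_j(y)=\sum_{m=0}^N \mathrm{a}_{j,m}\,e^{-2\pi i m y}$ with $\mathrm{a}_{j,m}\in\mathbb{R}$, and $\|a_j\|_\infty=\sup_{y\in\mathbb{R}}|a_j(y)|$. The Fourier transform is $\widehat{\phi}(y)=\int_{\mathbb{R}}\phi(x)e^{-2\pi i xy}\,dx$, extended analytically to $y\in\mathbb{C}$, and $\widehat{\phi}^{(k)}$ is its $k$-th derivative. The shift-invariant space generated by $\phi$ is $V_\phi=\{\sum_{\ell\in\mathbb{Z}}c_\ell\,\phi(\cdot-\ell):\ (c_\ell)\in\ell(\mathbb{Z})\}$, where $\ell(\mathbb{Z})$ is the space of all complex sequences on $\mathbb{Z}$ (the sums are locally finite). An analytic function belongs to $V_\phi$ if it coincides with such a sum (as a distribution). The integer shifts of $\phi$ are linearly independent if $\sum_{\ell\in\mathbb{Z}}c_\ell\,\phi(\cdot-\ell)=0$ with $(c_\ell)\in\ell(\mathbb{Z})$ implies $c_\ell=0$ for all $\ell$. A function on $\mathbb{R}$ is analytic if it is infinitely differentiable on $\mathbb{R}$ and has a power series expansion around each point of $\mathbb{R}$. The total number of non-zero elements counts pairs $(k,\ell)$, $0\le k\le d$, $\ell\in\mathbb{Z}$. *)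

theory Defs
  imports "HOL-Analysis.Analysis" "HOL-Computational_Algebra.Polynomial"
begin

section \<open>Smooth and analytic functions on the real line\<close>

definition nderiv :: "nat \<Rightarrow> (real \<Rightarrow> complex) \<Rightarrow> real \<Rightarrow> complex" where
  "nderiv n f = ((\<lambda>g x. vector_derivative g (at x)) ^^ n) f"

definition smooth :: "(real \<Rightarrow> complex) \<Rightarrow> bool" where
  "smooth f \<longleftrightarrow> (\<forall>n x. nderiv n f differentiable (at x))"

definition real_analytic :: "(real \<Rightarrow> complex) \<Rightarrow> bool" where
  "real_analytic f \<longleftrightarrow> smooth f \<and>
     (\<forall>x0. \<exists>r>0. \<exists>c :: nat \<Rightarrow> complex. \<forall>x. \<bar>x - x0\<bar> < r \<longrightarrow>
        (\<lambda>n. c n * of_real (x - x0) ^ n) sums f x)"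


section \<open>Distributions on the real line\<close>

definition supp :: "(real \<Rightarrow> complex) \<Rightarrow> real set" where
  "supp f = closure {x. f x \<noteq> 0}"

definition test_functions :: "(real \<Rightarrow> complex) set" where
  "test_functions = {\<psi>. smooth \<psi> \<and> compact (supp \<psi>)}"

text \<open>A distribution is represented by a functional on all functions \<open>\<real> \<rightarrow> \<complex>\<close>;
  only its values on \<open>test_functions\<close> are meaningful, so two distributions are the same
  if they agree there.  Continuity is expressed by the usual seminorm estimates.\<close>

type_synonym functional = "(real \<Rightarrow> complex) \<Rightarrow> complex"

definition distribution :: "functional \<Rightarrow> bool" where
  "distribution T \<longleftrightarrow>
     (\<forall>\<psi>\<in>test_functions. \<forall>\<eta>\<in>test_functions. T (\<lambda>x. \<psi> x + \<eta> x) = T \<psi> + T \<eta>) \<and>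
     (\<forall>b. \<forall>\<psi>\<in>test_functions. T (\<lambda>x. b * \<psi> x) = b * T \<psi>) \<and>
     (\<forall>K. compact K \<longrightarrow> (\<exists>B M. \<forall>\<psi>\<in>test_functions. supp \<psi> \<subseteq> K \<longrightarrow>
        norm (T \<psi>) \<le> B * (\<Sum>k\<le>M. SUP x. norm (nderiv k \<psi> x))))"

definition supported_in :: "functional \<Rightarrow> real set \<Rightarrow> bool" where
  "supported_in T K \<longleftrightarrow> (\<forall>\<psi>\<in>test_functions. supp \<psi> \<inter> K = {} \<longrightarrow> T \<psi> = 0)"

definition compactly_supported_distribution :: "functional \<Rightarrow> bool" where
  "compactly_supported_distribution T \<longleftrightarrow>
     distribution T \<and> (\<exists>K. compact K \<and> supported_in T K)"

text \<open>The distribution given by a (locally integrable) function.\<close>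

definition dist_of_fun :: "(real \<Rightarrow> complex) \<Rightarrow> functional" where
  "dist_of_fun f = (\<lambda>\<psi>. LINT x|lborel. f x * \<psi> x)"

text \<open>The Fourier(-Laplace) transform of a compactly supported distribution \<open>T\<close>, that is, \<open>T\<close>
  applied to \<open>x \<mapsto> exp (-2 \<pi> i x z)\<close>.  As the exponential is not compactly supported, it is
  multiplied by a test function \<open>\<rho>\<close> equal to 1 near a compact set carrying \<open>T\<close>; the value
  does not depend on \<open>\<rho>\<close>.  On the complex plane this is the entire extension of the Fourier
  transform on the real line.\<close>

definition is_cutoff :: "functional \<Rightarrow> (real \<Rightarrow> complex) \<Rightarrow> bool" where
  "is_cutoff T \<rho> \<longleftrightarrow> \<rho> \<in> test_functions \<and>
     (\<exists>K U. compact K \<and> supported_in T K \<and> open U \<and> K \<subseteq> U \<and> (\<forall>x\<in>U. \<rho> x = 1))"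

definition fourier :: "functional \<Rightarrow> complex \<Rightarrow> complex" where
  "fourier T z = (THE v. \<forall>\<rho>. is_cutoff T \<rho> \<longrightarrow>
     T (\<lambda>x. \<rho> x * exp (- 2 * of_real pi * \<i> * of_real x * z)) = v)"


section \<open>Shift-invariant spaces\<close>

text \<open>\<open>T(\<cdot> - h)\<close>, by duality.\<close>

definition shift :: "real \<Rightarrow> functional \<Rightarrow> functional" where
  "shift h T = (\<lambda>\<psi>. T (\<lambda>x. \<psi> (x + h)))"

text \<open>\<open>\<Sum>\<^sub>l c\<^sub>l T(\<cdot> - l)\<close>.  For a compactly supported \<open>T\<close> and a test function, only
  finitely many terms are non-zero, so that no convergence is involved.\<close>

definition shift_sum :: "functional \<Rightarrow> (int \<Rightarrow> complex) \<Rightarrow> functional" where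
  "shift_sum T c = (\<lambda>\<psi>. \<Sum>\<^sub>\<infinity>l\<in>UNIV. c l * shift (of_int l) T \<psi>)"

definition shift_invariant_space :: "functional \<Rightarrow> functional set" where
  "shift_invariant_space T = {S. \<exists>c. \<forall>\<psi>\<in>test_functions. S \<psi> = shift_sum T c \<psi>}"

definition shifts_linearly_independent :: "functional \<Rightarrow> bool" where
  "shifts_linearly_independent T \<longleftrightarrow>
     (\<forall>c. (\<forall>\<psi>\<in>test_functions. shift_sum T c \<psi> = 0) \<longrightarrow> (\<forall>l. c l = 0))"


section \<open>Trigonometric polynomials\<close>

text \<open>One-sided trigonometric polynomials of degree at most \<open>N\<close> with real coefficients.\<close>

definition trig_poly :: "nat \<Rightarrow> (real \<Rightarrow> complex) \<Rightarrow> bool" where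
  "trig_poly N f \<longleftrightarrow> (\<exists>c :: nat \<Rightarrow> real. \<forall>y.
     f y = (\<Sum>m\<le>N. of_real (c m) * exp (- 2 * of_real pi * \<i> * of_nat m * of_real y)))"

end

theory Submission
  imports Defs "HOL-Complex_Analysis.Conformal_Mappings"
begin

text \<open>The proof counts dimensions at a fine dyadic scale.  Put \<open>h = 2 powr (- n)\<close>.  Splitting off the
first \<open>n\<close> factors of the product, which together form a trigonometric polynomial in \<open>h y\<close>,
exhibits \<open>\<phi>\<close> as a finite combination of the shifts \<open>\<phi>\<^sub>n(\<cdot> - r h)\<close> of a functional \<open>\<phi>\<^sub>n\<close> carried by
\<open>[0, N h]\<close>.  Hence every element of \<open>V\<^sub>\<phi>\<close>, shifted by any multiple of \<open>h\<close>, is a locally finite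
combination of the \<open>\<phi>\<^sub>n(\<cdot> - s h)\<close>, and only \<open>N\<close> of these meet the interval \<open>(0, h)\<close>.  The \<open>N + 1\<close> functions
\<open>f(\<cdot> + k h)\<close>, \<open>0 \<le> k \<le> N\<close>, therefore satisfy a non-trivial linear relation
\<open>\<Sum>\<^sub>k \<alpha>\<^sub>k f(\<cdot> + k h) = 0\<close> on \<open>(0, h)\<close>, and by analyticity on the whole line: this is
\<open>shift_relation\<close>.

Write \<open>f = \<Sum>\<^sub>l c\<^sub>l \<phi>(\<cdot> - l)\<close>.  Up to the factor \<open>exp (\<lambda> t)\<close>, the function \<open>f\<close> is a polynomial of degree \<open>d\<close> in
\<open>t\<close> with periodic coefficients, so its difference of order \<open>d + 1\<close> vanishes and that of order \<open>d\<close>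
does not.  Linear independence carries this over to the sequence \<open>exp (- \<lambda> l) c\<^sub>l\<close>
(\<open>coefficients_exponential_polynomial\<close>), and taking further differences shows that every
sequence \<open>exp (\<lambda> l) q(l)\<close> with \<open>deg q \<le> d\<close> satisfies \<open>\<Sum>\<^sub>l exp (\<lambda> l) q(l) \<Phi>(\<cdot> - l) = 0\<close> for
\<open>\<Phi> = \<Sum>\<^sub>k \<alpha>\<^sub>k \<phi>(\<cdot> + k h)\<close> (\<open>annihilated_polynomial_sequences\<close>).  By Poisson summation the Fourier
transform of \<open>\<Phi>\<close> then vanishes to order \<open>d + 1\<close> at each \<open>z\<^sub>l = l - \<i> \<lambda> / (2 \<pi>)\<close>
(\<open>poisson_moments\<close>).  Now this transform is \<open>A(exp (2 \<pi> \<i> h z))\<close> times that of \<open>\<phi>\<close>, where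
\<open>A(x) = \<Sum>\<^sub>k \<alpha>\<^sub>k x\<^sup>k\<close>.  If \<open>m \<le> d\<close> is the least order of a derivative of the transform of \<open>\<phi>\<close> that
does not vanish at \<open>z\<^sub>l\<close>, then \<open>A\<close> has at \<open>exp (2 \<pi> \<i> h z\<^sub>l)\<close> a zero of order at least
\<open>d + 1 - m\<close>, which bounds the number of derivatives of order at most \<open>d\<close> that are non-zero at
\<open>z\<^sub>l\<close> (\<open>order_ge_card_moments\<close>).  For \<open>n\<close> large, any given finite set of indices \<open>l\<close> yields
different points, and the non-zero polynomial \<open>A\<close> has at most \<open>N\<close> zeros, counted with multiplicity.

It remains to pass from the infinite product on the real line to \<open>\<phi>\<close> itself.  A test function is
expanded into its Fourier series on a long interval.  The coefficients decay rapidly, whereas the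
partial products grow at most polynomially, because the factors are bounded by \<open>C\<close> and are
Lipschitz at the origin uniformly in \<open>j\<close> (\<open>mask_prod_bound\<close>).  Dominated convergence shows
that the discrete measures with these transforms converge to \<open>\<phi>\<close> on test functions
(\<open>cascade_tendsto_distribution\<close>), and in the same way the measures built from the factors beyond the
first \<open>n\<close> converge; their limit is \<open>\<phi>\<^sub>n\<close>, which inherits its support from them.\<close>

section \<open>Smooth functions\<close>

lemma nderiv_0 [simp]: "nderiv 0 f = f"
  by (simp add: nderiv_def)

lemma nderiv_Suc: "nderiv (Suc n) f = (\<lambda>x. vector_derivative (nderiv n f) (at x))"
  by (simp add: nderiv_def)

lemma smooth_has_vector_derivative:
  assumes "smooth f"
  shows "(nderiv n f has_vector_derivative nderiv (Suc n) f x) (at x)"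
  using assms by (simp add: smooth_def nderiv_Suc vector_derivative_works)

text \<open>Iterated derivatives are handled through chains: a sequence of functions starting with \<open>f\<close>, each
the derivative of its predecessor everywhere, must be the sequence of iterated derivatives of \<open>f\<close>.\<close>

lemma nderiv_eq_chain:
  assumes "F 0 = f" and F: "\<And>n x. (F n has_vector_derivative F (Suc n) x) (at x)"
  shows "nderiv n f = F n"
proof (induction n)
  case (Suc n)
  have "vector_derivative (F n) (at x) = F (Suc n) x" for x
    using F by (rule vector_derivative_at)
  with Suc show ?case by (simp add: nderiv_Suc)
qed (use assms in simp)

lemma smooth_chain:
  assumes "F 0 = f" and F: "\<And>n x. (F n has_vector_derivative F (Suc n) x) (at x)"
  shows "smooth f"
  unfolding smooth_def nderiv_eq_chain[OF assms]
  using F by (metis differentiableI_vector)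

text \<open>This serves for the family \<open>flat\<close> below, whose members have higher derivatives without a convenient
closed form.\<close>

lemma smooth_coinduct:
  assumes "f \<in> S"
    and step: "\<And>g. g \<in> S \<Longrightarrow> \<exists>g'\<in>S. \<forall>x. (g has_vector_derivative g' x) (at x)"
  shows "smooth f"
proof -
  obtain D where D: "\<And>g. g \<in> S \<Longrightarrow> D g \<in> S \<and> (\<forall>x. (g has_vector_derivative D g x) (at x))"
    using step by metis
  have S: "(D ^^ n) f \<in> S" for n
    by (induction n) (use assms D in auto)
  show ?thesis
    by (rule smooth_chain[of "\<lambda>n. (D ^^ n) f"]) (use D S in auto)
qed

lemma smooth_if_derivative_smooth:
  assumes "smooth g" and "\<And>x. (f has_vector_derivative g x) (at x)"
  shows "smooth f"
proof (rule smooth_chain[of "\<lambda>n. case n of 0 \<Rightarrow> f | Suc m \<Rightarrow> nderiv m g"])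
  fix n x
  show "((case n of 0 \<Rightarrow> f | Suc m \<Rightarrow> nderiv m g) has_vector_derivative
      (case Suc n of 0 \<Rightarrow> f | Suc m \<Rightarrow> nderiv m g) x) (at x)"
    using assms smooth_has_vector_derivative by (cases n) (auto simp: nderiv_0)
qed auto

lemma smooth_nderiv:
  assumes "smooth f"
  shows "smooth (nderiv k f)"
  by (rule smooth_chain[of "\<lambda>n. nderiv (n + k) f"])
    (use smooth_has_vector_derivative[OF assms] in auto)

lemma continuous_on_nderiv: "smooth f \<Longrightarrow> continuous_on A (nderiv n f)"
  by (meson continuous_on_eq_continuous_within differentiable_imp_continuous_within
      differentiable_at_withinI smooth_def)

lemma continuous_on_smooth: "smooth f \<Longrightarrow> continuous_on A f"
  using continuous_on_nderiv[of f A 0] by simp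

lemma
  assumes "smooth f" "smooth g"
  shows smooth_add: "smooth (\<lambda>x. f x + g x)"
    and nderiv_add: "nderiv n (\<lambda>x. f x + g x) = (\<lambda>x. nderiv n f x + nderiv n g x)"
proof -
  have *: "((\<lambda>x. nderiv n f x + nderiv n g x) has_vector_derivative
      nderiv (Suc n) f x + nderiv (Suc n) g x) (at x)" for n x
    by (intro has_vector_derivative_add smooth_has_vector_derivative assms)
  show "smooth (\<lambda>x. f x + g x)"
    by (rule smooth_chain[where F = "\<lambda>n x. nderiv n f x + nderiv n g x"]) (use * in auto)
  show "nderiv n (\<lambda>x. f x + g x) = (\<lambda>x. nderiv n f x + nderiv n g x)"
    by (rule nderiv_eq_chain[where F = "\<lambda>n x. nderiv n f x + nderiv n g x"]) (use * in auto)
qed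

lemma
  assumes "smooth f"
  shows smooth_cmult: "smooth (\<lambda>x. b * f x)"
    and nderiv_cmult: "nderiv n (\<lambda>x. b * f x) = (\<lambda>x. b * nderiv n f x)"
proof -
  have *: "((\<lambda>x. b * nderiv n f x) has_vector_derivative b * nderiv (Suc n) f x) (at x)" for n x
    by (intro has_vector_derivative_mult_right smooth_has_vector_derivative assms)
  show "smooth (\<lambda>x. b * f x)"
    by (rule smooth_chain[where F = "\<lambda>n x. b * nderiv n f x"]) (use * in auto)
  show "nderiv n (\<lambda>x. b * f x) = (\<lambda>x. b * nderiv n f x)"
    by (rule nderiv_eq_chain[where F = "\<lambda>n x. b * nderiv n f x"]) (use * in auto)
qed

lemma smooth_const [simp]: "smooth (\<lambda>x. b)"
  by (rule smooth_chain[of "\<lambda>n x. if n = 0 then b else 0"]) auto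

lemma
  assumes "smooth f" "smooth g"
  shows smooth_diff: "smooth (\<lambda>x. f x - g x)"
    and nderiv_diff: "nderiv n (\<lambda>x. f x - g x) = (\<lambda>x. nderiv n f x - nderiv n g x)"
proof -
  have eq: "(\<lambda>x. f x - g x) = (\<lambda>x. f x + (-1) * g x)"
    by simp
  show "smooth (\<lambda>x. f x - g x)"
    unfolding eq by (intro smooth_add smooth_cmult assms)
  show "nderiv n (\<lambda>x. f x - g x) = (\<lambda>x. nderiv n f x - nderiv n g x)"
    unfolding eq nderiv_add[OF assms(1) smooth_cmult[OF assms(2)]] nderiv_cmult[OF assms(2)] by simp
qed

lemma
  assumes "\<And>i. i \<in> I \<Longrightarrow> smooth (f i)"
  shows smooth_sum: "smooth (\<lambda>x. \<Sum>i\<in>I. f i x)"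
    and nderiv_sum: "nderiv n (\<lambda>x. \<Sum>i\<in>I. f i x) = (\<lambda>x. \<Sum>i\<in>I. nderiv n (f i) x)"
proof -
  have *: "((\<lambda>x. \<Sum>i\<in>I. nderiv n (f i) x) has_vector_derivative
      (\<Sum>i\<in>I. nderiv (Suc n) (f i) x)) (at x)" for n x
    by (intro has_vector_derivative_sum smooth_has_vector_derivative assms)
  show "smooth (\<lambda>x. \<Sum>i\<in>I. f i x)"
    by (rule smooth_chain[where F = "\<lambda>n x. \<Sum>i\<in>I. nderiv n (f i) x"]) (use * in auto)
  show "nderiv n (\<lambda>x. \<Sum>i\<in>I. f i x) = (\<lambda>x. \<Sum>i\<in>I. nderiv n (f i) x)"
    by (rule nderiv_eq_chain[where F = "\<lambda>n x. \<Sum>i\<in>I. nderiv n (f i) x"]) (use * in auto)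
qed

lemma
  assumes "smooth f"
  shows smooth_affine: "smooth (\<lambda>x. f (r * x + s))"
    and nderiv_affine: "nderiv n (\<lambda>x. f (r * x + s)) = (\<lambda>x. of_real r ^ n * nderiv n f (r * x + s))"
proof -
  have "((\<lambda>x. of_real r ^ n * nderiv n f (r * x + s)) has_vector_derivative
      of_real r ^ Suc n * nderiv (Suc n) f (r * x + s)) (at x)" for n x
  proof -
    have "((\<lambda>x. nderiv n f (r * x + s)) has_vector_derivative r *\<^sub>R nderiv (Suc n) f (r * x + s)) (at x)"
    proof -
      have "((\<lambda>x. r * x + s) has_vector_derivative r) (at x)"
        unfolding has_real_derivative_iff_has_vector_derivative[symmetric]
        by (auto intro!: derivative_eq_intros)
      from vector_diff_chain_at[OF this smooth_has_vector_derivative[OF assms]]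
      show ?thesis by (simp add: o_def)
    qed
    from has_vector_derivative_mult_right[OF this, of "of_real r ^ n"]
    show ?thesis by (simp add: scaleR_conv_of_real mult_ac)
  qed
  note * = this
  show "smooth (\<lambda>x. f (r * x + s))"
    by (rule smooth_chain[where F = "\<lambda>n x. of_real r ^ n * nderiv n f (r * x + s)", OF _ *]) simp
  show "nderiv n (\<lambda>x. f (r * x + s)) = (\<lambda>x. of_real r ^ n * nderiv n f (r * x + s))"
    by (rule nderiv_eq_chain[where F = "\<lambda>n x. of_real r ^ n * nderiv n f (r * x + s)", OF _ *]) simp
qed

lemma smooth_shift: "smooth f \<Longrightarrow> smooth (\<lambda>x. f (x + s))"
  using smooth_affine[of f 1 s] by simp

lemma
  assumes "smooth f" "smooth g"
  shows smooth_mult: "smooth (\<lambda>x. f x * g x)"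
    and nderiv_mult: "nderiv n (\<lambda>x. f x * g x) =
      (\<lambda>x. \<Sum>i\<le>n. of_nat (n choose i) * (nderiv i f x * nderiv (n - i) g x))"
proof -
  define F where "F n x = (\<Sum>i\<le>n. of_nat (n choose i) * (nderiv i f x * nderiv (n - i) g x))" for n x
  have "(F n has_vector_derivative F (Suc n) x) (at x)" for n x
  proof -
    have "(F n has_vector_derivative (\<Sum>i\<le>n. of_nat (n choose i) *
        (nderiv i f x * nderiv (Suc (n - i)) g x + nderiv (Suc i) f x * nderiv (n - i) g x))) (at x)"
      unfolding F_def
      by (intro has_vector_derivative_sum has_vector_derivative_mult_right
          has_vector_derivative_mult smooth_has_vector_derivative assms)
    also have "(\<Sum>i\<le>n. of_nat (n choose i) *
        (nderiv i f x * nderiv (Suc (n - i)) g x + nderiv (Suc i) f x * nderiv (n - i) g x)) =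
        (\<Sum>i\<le>n. of_nat (n choose i) * (nderiv i f x * nderiv (Suc n - i) g x)) +
        (\<Sum>i\<le>n. of_nat (n choose i) * (nderiv (Suc i) f x * nderiv (n - i) g x))"
      by (simp add: sum.distrib distrib_left Suc_diff_le)
    also have "(\<Sum>i\<le>n. of_nat (n choose i) * (nderiv i f x * nderiv (Suc n - i) g x)) =
        (\<Sum>i\<le>Suc n. of_nat (n choose i) * (nderiv i f x * nderiv (Suc n - i) g x))"
      by (simp add: binomial_eq_0)
    also have "\<dots> = f x * nderiv (Suc n) g x +
        (\<Sum>i\<le>n. of_nat (n choose Suc i) * (nderiv (Suc i) f x * nderiv (n - i) g x))"
      by (subst sum.atMost_Suc_shift) simp
    also have "\<dots> + (\<Sum>i\<le>n. of_nat (n choose i) * (nderiv (Suc i) f x * nderiv (n - i) g x)) = F (Suc n) x"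
      unfolding F_def by (subst sum.atMost_Suc_shift) (simp add: sum.distrib distrib_right)
    finally show ?thesis .
  qed
  note * = this
  have F0: "F 0 = (\<lambda>x. f x * g x)"
    by (auto simp: F_def)
  show "smooth (\<lambda>x. f x * g x)"
    by (rule smooth_chain[where F = F, OF F0 *])
  show "nderiv n (\<lambda>x. f x * g x) =
      (\<lambda>x. \<Sum>i\<le>n. of_nat (n choose i) * (nderiv i f x * nderiv (n - i) g x))"
    unfolding nderiv_eq_chain[where F = F, OF F0 *] by (auto simp: F_def)
qed

lemma
  shows smooth_exp: "smooth (\<lambda>x. exp (w * of_real x))"
    and nderiv_exp: "nderiv n (\<lambda>x. exp (w * of_real x)) = (\<lambda>x. w ^ n * exp (w * of_real x))"
proof -
  have "((\<lambda>x. w ^ n * exp (w * of_real x)) has_vector_derivative w ^ Suc n * exp (w * of_real x)) (at x)"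
    for n and x :: real
    by (rule has_vector_derivative_real_field) (auto intro!: derivative_eq_intros)
  note * = this
  show "smooth (\<lambda>x. exp (w * of_real x))"
    by (rule smooth_chain[where F = "\<lambda>n x. w ^ n * exp (w * of_real x)", OF _ *]) simp
  show "nderiv n (\<lambda>x. exp (w * of_real x)) = (\<lambda>x. w ^ n * exp (w * of_real x))"
    by (rule nderiv_eq_chain[where F = "\<lambda>n x. w ^ n * exp (w * of_real x)", OF _ *]) simp
qed

lemma smooth_of_real: "smooth of_real"
proof (rule smooth_if_derivative_smooth[OF smooth_const[of 1]])
  fix x :: real
  show "(of_real has_vector_derivative (1 :: complex)) (at x)"
    using has_vector_derivative_real_field[of "\<lambda>z. z" 1 x UNIV] by simp
qed

lemma smooth_power: "smooth f \<Longrightarrow> smooth (\<lambda>x. f x ^ n)"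
  by (induction n) (auto intro!: smooth_mult)

lemma nderiv_eq_0_open:
  assumes "open U" "\<And>x. x \<in> U \<Longrightarrow> f x = 0" "x \<in> U"
  shows "nderiv n f x = 0"
  using assms(3)
proof (induction n arbitrary: x)
  case (Suc n)
  have "nderiv n f y = 0" if "y \<in> U" for y
    using Suc.IH that .
  then have "(nderiv n f has_vector_derivative 0) (at x)"
    by (intro has_vector_derivative_transform_within_open[OF has_vector_derivative_const[of 0] assms(1) Suc.prems])
      (metis)
  then show ?case by (simp add: nderiv_Suc vector_derivative_at)
qed (use assms in auto)

section \<open>Test functions\<close>

lemma supp_ge: "f x \<noteq> 0 \<Longrightarrow> x \<in> supp f"
  unfolding supp_def by (rule subsetD[OF closure_subset]) simp

lemma supp_subset_closed: "closed K \<Longrightarrow> (\<And>x. x \<notin> K \<Longrightarrow> f x = 0) \<Longrightarrow> supp f \<subseteq> K"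
  unfolding supp_def by (rule closure_minimal) blast+

lemma supp_disjoint_open:
  assumes "open U" "\<And>x. x \<in> U \<Longrightarrow> f x = 0"
  shows "supp f \<inter> U = {}"
proof -
  have "supp f \<subseteq> - U"
    by (rule supp_subset_closed) (use assms in \<open>simp_all add: closed_Compl\<close>)
  then show ?thesis by blast
qed

lemma test_functionsI:
  assumes "smooth f" "\<And>x. x \<notin> {a..b} \<Longrightarrow> f x = 0"
  shows "f \<in> test_functions"
proof -
  have "supp f \<subseteq> {a..b}"
    using assms by (intro supp_subset_closed) auto
  then show ?thesis
    using assms bounded_subset[OF bounded_closed_interval, of "supp f" a b]
    by (simp add: test_functions_def compact_eq_bounded_closed supp_def)
qed

lemma test_functionsE:
  assumes "f \<in> test_functions"
  obtains R where "R > 0" "smooth f" "\<And>x. R \<le> \<bar>x\<bar> \<Longrightarrow> f x = 0"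
proof -
  have "bounded (supp f)"
    using assms by (auto simp: test_functions_def compact_imp_bounded)
  then obtain B where B: "\<And>x. x \<in> supp f \<Longrightarrow> \<bar>x\<bar> \<le> B" 
    unfolding bounded_iff by auto
  have "f x = 0" if "\<bar>B\<bar> + 1 \<le> \<bar>x\<bar>" for x
    using B[of x] supp_ge[of f x] that by linarith
  moreover have "smooth f"
    using assms by (simp add: test_functions_def)
  ultimately show ?thesis
    using that[of "\<bar>B\<bar> + 1"] by force
qed

lemma test_smooth: "f \<in> test_functions \<Longrightarrow> smooth f"
  by (simp add: test_functions_def)

lemma test_if_vanishes:
  assumes "smooth f" "\<And>x. R \<le> \<bar>x\<bar> \<Longrightarrow> f x = 0"
  shows "f \<in> test_functions"
  
proof (rule test_functionsI[of f "-R" R])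
  fix x :: real assume "x \<notin> {-R..R}"
  then have "R \<le> \<bar>x\<bar>" by auto
  then show "f x = 0" by (rule assms)
qed fact

lemma test_mult: 
  assumes "f \<in> test_functions" "smooth g" 
  shows "(\<lambda>x. f x * g x) \<in> test_functions"
proof -
  obtain R where R: "R > 0" "smooth f" "\<And>x. R \<le> \<bar>x\<bar> \<Longrightarrow> f x = 0"
    using assms(1) by (rule test_functionsE) blast
  show ?thesis
    by (rule test_if_vanishes[where R = R]) (use R assms in \<open>auto intro: smooth_mult\<close>)
qed

lemma test_add: 
  assumes "f \<in> test_functions" "g \<in> test_functions" 
  shows "(\<lambda>x. f x + g x) \<in> test_functions"
proof -
  obtain R where R: "R > 0" "smooth f" "\<And>x. R \<le> \<bar>x\<bar> \<Longrightarrow> f x = 0"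
    using assms(1) by (rule test_functionsE) blast
  obtain R' where R': "R' > 0" "smooth g" "\<And>x. R' \<le> \<bar>x\<bar> \<Longrightarrow> g x = 0"
    using assms(2) by (rule test_functionsE) blast
  show ?thesis
    by (rule test_if_vanishes[where R = "max R R'"]) (use R R' in \<open>auto intro: smooth_add\<close>)
qed

lemma test_cmult: "f \<in> test_functions \<Longrightarrow> (\<lambda>x. b * f x) \<in> test_functions"
  using test_mult[of f "\<lambda>_. b"] by (simp add: mult.commute)

lemma test_diff:
  assumes "f \<in> test_functions" "g \<in> test_functions"
  shows "(\<lambda>x. f x - g x) \<in> test_functions"
proof -
  have "(\<lambda>x. f x + (-1) * g x) \<in> test_functions"
    by (rule test_add[OF assms(1) test_cmult[OF assms(2)]])
  then show ?thesis by simp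
qed

lemma test_sum:
  assumes "finite I" "\<And>i. i \<in> I \<Longrightarrow> f i \<in> test_functions"
  shows "(\<lambda>x. \<Sum>i\<in>I. f i x) \<in> test_functions"
  using assms
proof (induction I)
  case empty
  then show ?case using test_if_vanishes[of "\<lambda>_. 0" 0] by simp
qed (auto intro: test_add)

lemma test_shift: 
  assumes "f \<in> test_functions" 
  shows "(\<lambda>x. f (x + s)) \<in> test_functions"
proof -
  obtain R where R: "R > 0" "smooth f" "\<And>x. R \<le> \<bar>x\<bar> \<Longrightarrow> f x = 0"
    using assms(1) by (rule test_functionsE) blast
  show ?thesis
    by (rule test_if_vanishes[where R = "R + \<bar>s\<bar>"]) (use R in \<open>auto intro: smooth_shift\<close>)
qed

lemma nderiv_test: 
  assumes "f \<in> test_functions" 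
  shows "nderiv k f \<in> test_functions"
proof -
  obtain R where R: "R > 0" "smooth f" "\<And>x. R \<le> \<bar>x\<bar> \<Longrightarrow> f x = 0"
    using assms(1) by (rule test_functionsE) blast
  show ?thesis
  proof (rule test_if_vanishes[where R = "R + 1"])
    fix x assume "R + 1 \<le> \<bar>x\<bar>"
    then show "nderiv k f x = 0"
      by (intro nderiv_eq_0_open[of "{x. R < \<bar>x\<bar>}"])
        (use R in \<open>auto intro!: open_Collect_less continuous_intros\<close>)
  qed (use R smooth_nderiv in auto)
qed

lemma test_bounded:
  assumes "f \<in> test_functions"
  obtains B where "B > 0" "\<And>x. norm (f x) \<le> B"
proof -
  obtain R where R: "R > 0" "smooth f" "\<And>x. R \<le> \<bar>x\<bar> \<Longrightarrow> f x = 0"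
    using assms(1) by (rule test_functionsE) blast
  have "compact (f ` {-\<bar>R\<bar>..\<bar>R\<bar>})"
    using R by (intro compact_continuous_image continuous_on_smooth) auto
  then obtain B where B: "\<And>x. x \<in> {-\<bar>R\<bar>..\<bar>R\<bar>} \<Longrightarrow> norm (f x) \<le> B"
    using compact_imp_bounded[of "f ` {-\<bar>R\<bar>..\<bar>R\<bar>}"] unfolding bounded_iff by blast
  show ?thesis
  proof (rule that[of "max 1 B"])
    fix x
    show "norm (f x) \<le> max 1 B"
      using B[of x] R(3)[of x] by (cases "x \<in> {-\<bar>R\<bar>..\<bar>R\<bar>}") (auto simp: abs_le_iff)
  qed simp
qed

section \<open>Bump functions and a smooth step\<close>

text \<open>For \<open>p = 1\<close> this is the classical smooth function \<open>exp (- 1 / x)\<close> that is flat at the origin; the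
polynomial factor in \<open>1 / x\<close> makes the family closed under differentiation.\<close>

definition flat :: "real poly \<Rightarrow> real \<Rightarrow> complex" where
  "flat p x = (if x > 0 then of_real (poly p (1 / x) * exp (- (1 / x))) else 0)"

lemma poly_times_exp_tendsto_0: "((\<lambda>u. poly p u * exp (- u)) \<longlongrightarrow> (0 :: real)) at_top"
proof -
  have "((\<lambda>u. \<Sum>i\<le>degree p. coeff p i * (u ^ i / exp u)) \<longlongrightarrow> (\<Sum>i\<le>degree p. coeff p i * 0)) at_top"
    by (intro tendsto_sum tendsto_mult tendsto_const tendsto_power_div_exp_0)
  then show ?thesis
    by (simp add: poly_altdef sum_distrib_right exp_minus divide_inverse mult.assoc)
qed

lemma flat_tendsto_0: "(flat p \<longlongrightarrow> 0) (at 0)"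
proof -
  have "((\<lambda>x :: real. poly p (inverse x) * exp (- inverse x)) \<longlongrightarrow> 0) (at_right 0)"
    by (rule filterlim_compose[OF poly_times_exp_tendsto_0 filterlim_inverse_at_top_right])
  then have "((\<lambda>x. complex_of_real (poly p (inverse x) * exp (- inverse x))) \<longlongrightarrow> 0) (at_right 0)"
    using tendsto_of_real by fastforce
  moreover have "\<forall>\<^sub>F x in at_right 0. complex_of_real (poly p (inverse x) * exp (- inverse x)) = flat p x"
    unfolding eventually_at_filter by (auto simp: flat_def divide_inverse)
  ultimately have "(flat p \<longlongrightarrow> 0) (at_right 0)"
    by (rule Lim_transform_eventually)
  moreover have "(flat p \<longlongrightarrow> 0) (at_left 0)"
    by (rule Lim_transform_eventually[of "\<lambda>_. 0"])
      (auto simp: eventually_at_filter flat_def)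
  ultimately show ?thesis
    by (simp add: filterlim_at_split)
qed

lemma flat_has_vector_derivative:
  "(flat p has_vector_derivative flat ([:0, 0, 1:] * (p - pderiv p)) x) (at x)"
proof (cases x "0 :: real" rule: linorder_cases)
  case less
  show ?thesis
    by (rule has_vector_derivative_transform_within_open[of "\<lambda>_. 0" _ _ "{..<0}"])
      (use less in \<open>auto simp: flat_def\<close>)
next
  case greater
  have "((\<lambda>x. poly p (1 / x) * exp (- (1 / x))) has_real_derivative
      poly ([:0, 0, 1:] * (p - pderiv p)) (1 / x) * exp (- (1 / x))) (at x)"
    using greater
    by (auto intro!: derivative_eq_intros DERIV_chain2[OF poly_DERIV] simp: field_simps power2_eq_square)
  then have "((\<lambda>x. complex_of_real (poly p (1 / x) * exp (- (1 / x)))) has_vector_derivative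
      of_real (poly ([:0, 0, 1:] * (p - pderiv p)) (1 / x) * exp (- (1 / x)))) (at x)"
    by (rule has_vector_derivative_of_real)
  then have "(flat p has_vector_derivative
      of_real (poly ([:0, 0, 1:] * (p - pderiv p)) (1 / x) * exp (- (1 / x)))) (at x)"
    by (rule has_vector_derivative_transform_within_open[of _ _ _ "{0<..}"])
      (use greater in \<open>auto simp: flat_def\<close>)
  then show ?thesis
    using greater by (simp only: flat_def if_True)
next
  case equal
  have "((\<lambda>h. (flat p (0 + h) - flat p 0) /\<^sub>R h) \<longlongrightarrow> 0) (at 0)"
  proof (rule Lim_transform_eventually)
    show "(flat ([:0, 1:] * p) \<longlongrightarrow> 0) (at 0)"
      by (rule flat_tendsto_0)
    show "\<forall>\<^sub>F h in at 0. flat ([:0, 1:] * p) h = (flat p (0 + h) - flat p 0) /\<^sub>R h"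
      by (auto simp: eventually_at_filter flat_def scaleR_conv_of_real divide_inverse)
  qed
  then have "((\<lambda>h. norm ((flat p (0 + h) - flat p 0) /\<^sub>R h)) \<longlongrightarrow> 0) (at 0)"
    by (rule tendsto_norm_zero)
  then have "((\<lambda>h. norm (flat p (0 + h) - flat p 0 - h *\<^sub>R 0) / norm h) \<longlongrightarrow> 0) (at 0)"
    by (simp add: divide_inverse mult.commute)
  then have "(flat p has_vector_derivative 0) (at 0)"
    by (simp add: has_vector_derivative_def has_derivative_at)
  with equal show ?thesis by (simp add: flat_def)
qed

lemma smooth_flat: "smooth (flat p)"
proof (rule smooth_coinduct[of _ "range flat"])
  fix g assume "g \<in> range flat"
  then show "\<exists>g'\<in>range flat. \<forall>x. (g has_vector_derivative g' x) (at x)"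
    using flat_has_vector_derivative by blast
qed simp

text \<open>A smooth function that is positive exactly on \<open>(0, 1)\<close>.\<close>

definition bump :: "real \<Rightarrow> complex" where
  "bump x = flat 1 x * flat 1 (1 - x)"

lemma smooth_bump: "smooth bump"
  unfolding bump_def[abs_def]
  using smooth_mult[OF smooth_flat[of 1] smooth_affine[OF smooth_flat, of 1 "-1" 1]]
  by simp

definition bump_real :: "real \<Rightarrow> real" where
  "bump_real x = Re (bump x)"

lemma bump_eq: "bump x = of_real (bump_real x)"
  by (simp add: bump_real_def bump_def flat_def)

lemma bump_real_pos_iff: "bump_real x > 0 \<longleftrightarrow> 0 < x \<and> x < 1"
  by (simp add: bump_real_def bump_def flat_def)

lemma bump_real_nonneg: "bump_real x \<ge> 0"
  by (simp add: bump_real_def bump_def flat_def)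

lemma bump_eq_0: "x \<le> 0 \<or> x \<ge> 1 \<Longrightarrow> bump x = 0"
  by (auto simp: bump_def flat_def)

text \<open>The step is the normalised primitive of the bump.  Its mass is non-zero because the bump is
continuous, non-negative and not identically zero.\<close>

lemma smooth_step_exists: "\<exists>H. smooth H \<and> (\<forall>x\<le>0. H x = 0) \<and> (\<forall>x\<ge>1. H x = 1)"
proof -
  have cont: "continuous_on A bump" for A
    by (rule continuous_on_smooth[OF smooth_bump])
  define G where "G x = integral {-1..x} bump" for x
  have der: "(G has_vector_derivative bump x) (at x)" if "x > -1" for x
  proof -
    have "(G has_vector_derivative bump x) (at x within {-1..x+1})"
      unfolding G_def by (rule integral_has_vector_derivative) (use that cont in auto)
    then show ?thesis
      using that by (simp add: at_within_Icc_at)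
  qed
  have G0: "G x = 0" if "x \<le> 0" for x
    unfolding G_def using that by (subst integral_cong[of _ _ "\<lambda>_. 0"]) (auto simp: bump_eq_0)
  have G1: "G x = G 1" if "x \<ge> 1" for x
  proof -
    have "integral {-1..1} bump + integral {1..x} bump = integral {-1..x} bump"
      by (rule Henstock_Kurzweil_Integration.integral_combine)
        (use that cont in \<open>auto intro: integrable_continuous_interval\<close>)
    moreover have "integral {1..x} bump = 0"
      by (subst integral_cong[of _ _ "\<lambda>_. 0"]) (auto simp: bump_eq_0)
    ultimately show ?thesis by (simp add: G_def)
  qed
  have der': "(G has_vector_derivative bump x) (at x)" for x
  proof (cases "x > -1")
    case False
    have "(G has_vector_derivative 0) (at x)"
      by (rule has_vector_derivative_transform_within_open[of "\<lambda>_. 0" _ _ "{..<0}"])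
        (use False G0 in auto)
    then show ?thesis using False by (simp add: bump_eq_0)
  qed (rule der)
  have "G 1 \<noteq> 0"
  proof
    assume "G 1 = 0"
    have "(bump has_integral 0) {-1..1}"
      using \<open>G 1 = 0\<close> cont integrable_integral[OF integrable_continuous_interval[OF cont], of "-1" 1]
      by (simp add: G_def)
    from has_integral_linear[OF this bounded_linear_Re]
    have int: "(bump_real has_integral 0) (cbox (-1) 1)"
      by (simp add: o_def bump_real_def[abs_def])
    have "continuous_on (cbox (-1) 1) bump_real"
      unfolding bump_real_def[abs_def] by (intro continuous_intros cont)
    from has_integral_0_cbox_imp_0[OF this _ int, of "1/2"] have "bump_real (1/2) = 0"
      by (simp add: bump_real_nonneg)
    then show False
      using bump_real_pos_iff[of "1/2"] by simp
  qed
  show ?thesis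
  proof (intro exI[of _ "\<lambda>x. inverse (G 1) * G x"] conjI allI impI)
    show "smooth (\<lambda>x. inverse (G 1) * G x)"
      by (intro smooth_cmult smooth_if_derivative_smooth[OF smooth_bump] der')
    show "inverse (G 1) * G x = 0" if "x \<le> 0" for x
      using G0[OF that] by simp
    show "inverse (G 1) * G x = 1" if "x \<ge> 1" for x
      unfolding G1[OF that] using \<open>G 1 \<noteq> 0\<close> by simp
  qed
qed

definition step :: "real \<Rightarrow> complex" where
  "step = (SOME H. smooth H \<and> (\<forall>x\<le>0. H x = 0) \<and> (\<forall>x\<ge>1. H x = 1))"

lemma
  shows smooth_step: "smooth step"
    and step_eq_0: "x \<le> 0 \<Longrightarrow> step x = 0"
    and step_eq_1: "x \<ge> 1 \<Longrightarrow> step x = 1"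
  using someI_ex[OF smooth_step_exists] unfolding step_def by auto

text \<open>A difference of two steps, equal to 1 on \<open>[- R, R]\<close>.  With this form of the cutoff the partition
of unity below reduces to a telescoping sum.\<close>

definition cutoff :: "real \<Rightarrow> real \<Rightarrow> complex" where
  "cutoff R x = step (x + (R + 1)) - step (x + (- R))"

lemma cutoff_eq_1: "\<bar>x\<bar> \<le> R \<Longrightarrow> cutoff R x = 1"
  by (simp add: cutoff_def step_eq_0 step_eq_1)

lemma cutoff_eq_0: "R \<ge> 0 \<Longrightarrow> \<bar>x\<bar> \<ge> R + 1 \<Longrightarrow> cutoff R x = 0"
  by (cases "x \<ge> 0") (auto simp: cutoff_def step_eq_0 step_eq_1)

lemma smooth_cutoff: "smooth (cutoff R)"
  unfolding cutoff_def[abs_def] by (intro smooth_diff smooth_shift smooth_step)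

lemma cutoff_test: "R \<ge> 0 \<Longrightarrow> cutoff R \<in> test_functions"
  by (rule test_if_vanishes[OF smooth_cutoff cutoff_eq_0])

definition tile :: "real \<Rightarrow> complex" where
  "tile x = step (x + 1) - step x"

lemma tile_test: "tile \<in> test_functions"
  using cutoff_test[of 0] by (simp add: tile_def[abs_def] cutoff_def[abs_def])

text \<open>The sum telescopes.  On any bounded set the integer shifts of the tile thus add up to 1.\<close>

lemma sum_tile: "(\<Sum>l\<in>{- int m..int m}. tile (x + of_int l)) = cutoff (real m) x"
proof (induction m)
  case (Suc m)
  have "{- int (Suc m)..int (Suc m)} = insert (- int (Suc m)) (insert (int (Suc m)) {- int m..int m})"
    by auto
  with Suc show ?case
    by (simp add: tile_def cutoff_def algebra_simps)
qed (simp add: tile_def cutoff_def)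

section \<open>Test functions detect continuous functions\<close>

lemma integrable_continuous_times_test:
  assumes "continuous_on UNIV g" "\<psi> \<in> test_functions"
  shows "integrable lborel (\<lambda>x. g x * \<psi> x)"
proof -
  obtain R where R: "R > 0" "smooth \<psi>" "\<And>x. R \<le> \<bar>x\<bar> \<Longrightarrow> \<psi> x = 0"
    using assms(2) by (rule test_functionsE) blast
  have "integrable lborel (\<lambda>x. indicator {-R..R} x *\<^sub>R (g x * \<psi> x))"
    by (intro borel_integrable_compact continuous_on_mult continuous_on_subset[OF assms(1)]
        continuous_on_smooth R(2)) auto
  also have "(\<lambda>x. indicator {-R..R} x *\<^sub>R (g x * \<psi> x)) = (\<lambda>x. g x * \<psi> x)"
    using R(3) by (auto simp: fun_eq_iff indicator_def abs_le_iff not_le)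
  finally show ?thesis .
qed

text \<open>If \<open>g\<close> did not vanish at \<open>x0\<close>, then \<open>cnj (g x0) * g x\<close> would have positive real part near
\<open>x0\<close>, and a bump concentrated there would have a non-zero integral against \<open>g\<close>.\<close>

lemma continuous_eq_0_if_test_integrals_0:
  assumes cont: "continuous_on UNIV g"
    and zero: "\<And>\<psi>. \<psi> \<in> test_functions \<Longrightarrow> (\<And>x. x \<notin> {a<..<b} \<Longrightarrow> \<psi> x = 0) \<Longrightarrow>
      (LINT x|lborel. g x * \<psi> x) = 0"
    and x0: "a < x0" "x0 < b"
  shows "g x0 = 0"
proof (rule ccontr)
  assume nz: "g x0 \<noteq> 0"
  define k where "k x = Re (cnj (g x0) * g x)" for x
  have k_cont: "continuous_on UNIV k"
    unfolding k_def by (intro continuous_intros cont)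
  have "cnj (g x0) * g x0 = of_real ((cmod (g x0))\<^sup>2)"
    by (metis complex_norm_square mult.commute)
  then have "k x0 > 0"
    using nz by (simp add: k_def)
  have "open (k -` {0<..} \<inter> {a<..<b})"
    using k_cont by (intro open_Int open_vimage) auto
  moreover have "x0 \<in> k -` {0<..} \<inter> {a<..<b}"
    using x0 \<open>k x0 > 0\<close> by simp
  ultimately obtain e where "e > 0" "\<And>x. dist x x0 < e \<Longrightarrow> x \<in> k -` {0<..} \<inter> {a<..<b}"
    unfolding open_dist by blast
  then have e: "e > 0" "\<And>x. \<bar>x - x0\<bar> < e \<Longrightarrow> k x > 0 \<and> a < x \<and> x < b"
    by (auto simp: dist_real_def)
  define \<psi> where "\<psi> x = bump (1 / (2 * e) * x + (1 / 2 - x0 / (2 * e)))" for x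
  have arg: "1 / (2 * e) * x + (1 / 2 - x0 / (2 * e)) = 1 / 2 + (x - x0) / (2 * e)" for x
    using e(1) by (simp add: field_simps)
  have \<psi>_0: "\<psi> x = 0" if "e \<le> \<bar>x - x0\<bar>" for x
    unfolding \<psi>_def arg using e(1) that by (intro bump_eq_0) (auto simp: field_simps abs_if split: if_splits)
  have sm: "smooth \<psi>"
    unfolding \<psi>_def[abs_def] by (rule smooth_affine[OF smooth_bump])
  have test: "\<psi> \<in> test_functions"
    by (rule test_functionsI[OF sm, of "x0 - e" "x0 + e"]) (use \<psi>_0 in \<open>auto simp: abs_if\<close>)
  have "(LINT x|lborel. g x * \<psi> x) = 0"
    using e(2) \<psi>_0 by (intro zero test) (metis greaterThanLessThan_iff not_less)
  have int: "integrable lborel (\<lambda>x. cnj (g x0) * (g x * \<psi> x))"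
    by (intro integrable_mult_right integrable_continuous_times_test cont test)
  have "(LINT x|lborel. cnj (g x0) * (g x * \<psi> x)) = 0"
    using \<open>(LINT x|lborel. g x * \<psi> x) = 0\<close> by simp
  then have int0: "(LINT x|lborel. Re (cnj (g x0) * (g x * \<psi> x))) = 0"
    unfolding integral_Re[OF int] by (simp only: zero_complex.simps)
  define m where "m x = Re (cnj (g x0) * (g x * \<psi> x))" for x
  have m_eq: "m x = k x * bump_real (1 / 2 + (x - x0) / (2 * e))" for x
  proof -
    have "cnj (g x0) * (g x * \<psi> x) = (cnj (g x0) * g x) * of_real (bump_real (1 / 2 + (x - x0) / (2 * e)))"
      unfolding \<psi>_def arg bump_eq by (rule mult.assoc[symmetric])
    then show ?thesis
      by (simp only: m_def k_def times_complex.sel Re_complex_of_real Im_complex_of_real mult_zero_right diff_zero)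
  qed
  have "(m has_integral (LINT x|lborel. m x)) UNIV"
    unfolding m_def by (rule has_integral_integral_lborel) (rule integrable_Re[OF int])
  then have m_int: "(m has_integral 0) UNIV"
    using int0 by (simp add: m_def)
  have "(\<lambda>x. if x \<in> {x0 - e..x0 + e} then m x else 0) = m"
    using \<psi>_0 by (auto simp: m_def abs_if fun_eq_iff)
  then have "(m has_integral 0) (cbox (x0 - e) (x0 + e))"
    using m_int has_integral_restrict_UNIV[of "{x0 - e..x0 + e}" m 0] by simp
  note m_int' = this
  have m_cont: "continuous_on (cbox (x0 - e) (x0 + e)) m"
    unfolding m_def
    by (intro continuous_intros continuous_on_smooth[OF sm] continuous_on_subset[OF cont]) auto
  have m_nonneg: "0 \<le> m x" if "x \<in> box (x0 - e) (x0 + e)" for x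
    unfolding m_eq using e(2)[of x] that by (auto intro!: mult_nonneg_nonneg bump_real_nonneg simp: abs_if less_imp_le)
  have "m x0 = 0"
    by (rule has_integral_0_cbox_imp_0[OF m_cont m_nonneg m_int']) (use e(1) in simp_all)
  moreover have "m x0 > 0"
    unfolding m_eq using \<open>k x0 > 0\<close> by (simp add: bump_real_pos_iff)
  ultimately show False by simp
qed

section \<open>Local power series and the identity theorem\<close>

text \<open>The part of analyticity that passes to shifts and linear combinations without reference to
derivatives, and that carries the identity theorem.\<close>

definition local_power_series :: "(real \<Rightarrow> complex) \<Rightarrow> bool" where
  "local_power_series f \<longleftrightarrow> (\<forall>x0. \<exists>r>0. \<exists>c :: nat \<Rightarrow> complex. \<forall>x. \<bar>x - x0\<bar> < r \<longrightarrow>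
     (\<lambda>n. c n * of_real (x - x0) ^ n) sums f x)"

lemma real_analytic_local_power_series: "real_analytic f \<Longrightarrow> local_power_series f"
  by (simp add: real_analytic_def local_power_series_def)

lemma local_power_series_add:
  assumes "local_power_series f" "local_power_series g"
  shows "local_power_series (\<lambda>x. f x + g x)"
  unfolding local_power_series_def
proof
  fix x0
  obtain r c where 1: "r > 0" "\<And>x. \<bar>x - x0\<bar> < r \<Longrightarrow> (\<lambda>n. c n * of_real (x - x0) ^ n) sums f x"
    using assms(1) unfolding local_power_series_def by metis
  obtain r' c' where 2: "r' > 0" "\<And>x. \<bar>x - x0\<bar> < r' \<Longrightarrow> (\<lambda>n. c' n * of_real (x - x0) ^ n) sums g x"
    using assms(2) unfolding local_power_series_def by metis
  have "(\<lambda>n. (c n + c' n) * of_real (x - x0) ^ n) sums (f x + g x)" if "\<bar>x - x0\<bar> < min r r'" for x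
    using sums_add[OF 1(2) 2(2)] that by (simp add: distrib_right)
  then show "\<exists>r>0. \<exists>c :: nat \<Rightarrow> complex. \<forall>x. \<bar>x - x0\<bar> < r \<longrightarrow>
      (\<lambda>n. c n * of_real (x - x0) ^ n) sums (f x + g x)"
    using 1(1) 2(1) by (intro exI[of _ "min r r'"] conjI exI[of _ "\<lambda>n. c n + c' n"]) auto
qed

lemma local_power_series_cmult:
  assumes "local_power_series f"
  shows "local_power_series (\<lambda>x. b * f x)"
  unfolding local_power_series_def
proof
  fix x0
  obtain r c where 1: "r > 0" "\<And>x. \<bar>x - x0\<bar> < r \<Longrightarrow> (\<lambda>n. c n * of_real (x - x0) ^ n) sums f x"
    using assms(1) unfolding local_power_series_def by metis
  have "(\<lambda>n. (b * c n) * of_real (x - x0) ^ n) sums (b * f x)" if "\<bar>x - x0\<bar> < r" for x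
    using sums_mult[OF 1(2)] that by (simp add: mult.assoc)
  then show "\<exists>r>0. \<exists>c :: nat \<Rightarrow> complex. \<forall>x. \<bar>x - x0\<bar> < r \<longrightarrow>
      (\<lambda>n. c n * of_real (x - x0) ^ n) sums (b * f x)"
    using 1(1) by (intro exI[of _ r] conjI exI[of _ "\<lambda>n. b * c n"]) auto
qed

lemma local_power_series_shift:
  assumes "local_power_series f"
  shows "local_power_series (\<lambda>x. f (x + s))"
  unfolding local_power_series_def
proof
  fix x0
  obtain r c where 1: "r > 0" "\<And>x. \<bar>x - (x0 + s)\<bar> < r \<Longrightarrow> (\<lambda>n. c n * of_real (x - (x0 + s)) ^ n) sums f x"
    using assms(1) unfolding local_power_series_def by metis
  have "(\<lambda>n. c n * of_real (x - x0) ^ n) sums f (x + s)" if "\<bar>x - x0\<bar> < r" for x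
    using 1(2)[of "x + s"] that by simp
  then show "\<exists>r>0. \<exists>c :: nat \<Rightarrow> complex. \<forall>x. \<bar>x - x0\<bar> < r \<longrightarrow>
      (\<lambda>n. c n * of_real (x - x0) ^ n) sums f (x + s)"
    using 1(1) by blast
qed

lemma local_power_series_sum:
  assumes "finite I" "\<And>i. i \<in> I \<Longrightarrow> local_power_series (f i)"
  shows "local_power_series (\<lambda>x. \<Sum>i\<in>I. f i x)"
  using assms
proof (induction I)
  case empty
  show ?case
    by (auto simp: local_power_series_def intro!: exI[of _ 1] exI[of _ "\<lambda>_. 0"])
next
  case (insert i I)
  then show ?case
    using local_power_series_add[of "f i" "\<lambda>x. \<Sum>i\<in>I. f i x"] by simp
qed

text \<open>On its disc of convergence the complex power series is holomorphic, so that zeros accumulating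
at the centre force it to vanish identically.\<close>

lemma local_power_series_zero_near:
  fixes c :: "nat \<Rightarrow> complex" and f :: "real \<Rightarrow> complex"
  assumes sums: "\<And>x. \<bar>x - x0\<bar> < r \<Longrightarrow> (\<lambda>n. c n * of_real (x - x0) ^ n) sums f x"
    and acc: "\<And>e. e > 0 \<Longrightarrow> \<exists>x. x \<noteq> x0 \<and> \<bar>x - x0\<bar> < e \<and> f x = 0"
    and "r > 0" "\<bar>x - x0\<bar> < r"
  shows "f x = 0"
proof -
  define F where "F w = (\<Sum>n. c n * (w - 0) ^ n)" for w :: complex
  have F_sums: "(\<lambda>n. c n * (w - 0) ^ n) sums F w" if "w \<in> ball 0 r" for w
  proof -
    define y where "y = (norm w + r) / 2"
    have y: "norm w < y" "y < r" "y > 0"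
      using that \<open>r > 0\<close> norm_ge_zero[of w] unfolding y_def mem_ball dist_0_norm
      by (simp_all add: field_simps del: norm_ge_zero)
    have "summable (\<lambda>n. c n * of_real y ^ n)"
      using sums[of "x0 + y"] y by (auto simp: sums_iff)
    then have "summable (\<lambda>n. c n * w ^ n)"
      by (rule powser_inside) (use y in simp)
    then show ?thesis by (simp add: F_def summable_sums)
  qed
  have F_eq: "F (of_real (y - x0)) = f y" if "\<bar>y - x0\<bar> < r" for y
  proof (rule sums_unique2)
    show "(\<lambda>n. c n * of_real (y - x0) ^ n) sums F (of_real (y - x0))"
      using F_sums[of "of_real (y - x0)"] that by (simp del: of_real_diff)
  qed (rule sums[OF that])
  have "F (of_real (x - x0)) = 0"
  proof (rule analytic_continuation[of F "ball 0 r" "{of_real (y - x0) | y. \<bar>y - x0\<bar> < r \<and> f y = 0}" 0])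
    show "F holomorphic_on ball 0 r"
      by (rule power_series_holomorphic[of 0 r c]) (use F_sums in auto)
    show "0 islimpt {complex_of_real (y - x0) |y. \<bar>y - x0\<bar> < r \<and> f y = 0}"
      unfolding islimpt_approachable
    proof (intro allI impI)
      fix e :: real assume "e > 0"
      then obtain y where y: "y \<noteq> x0" "\<bar>y - x0\<bar> < min e r" "f y = 0"
        using acc[of "min e r"] \<open>r > 0\<close> by auto
      then show "\<exists>x'\<in>{complex_of_real (y - x0) |y. \<bar>y - x0\<bar> < r \<and> f y = 0}. x' \<noteq> 0 \<and> dist x' 0 < e"
        by (intro bexI[of _ "of_real (y - x0)"]) (auto simp del: of_real_diff)
    qed
  qed (use assms F_eq in \<open>auto simp del: of_real_diff\<close>)
  with F_eq assms show ?thesis by metis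
qed

text \<open>The points near which \<open>f\<close> vanishes form an open set; it is closed because the power series at a
limit point has zeros accumulating at its centre.\<close>

lemma local_power_series_identity:
  assumes f: "local_power_series f" and "a < b" and zero: "\<And>x. a < x \<Longrightarrow> x < b \<Longrightarrow> f x = 0"
  shows "f x = 0"
proof -
  define Z where "Z = {x. \<exists>e>0. \<forall>y. \<bar>y - x\<bar> < e \<longrightarrow> f y = 0}"
  have "open Z"
    unfolding open_dist
  proof
    fix x assume "x \<in> Z"
    then obtain e where e: "e > 0" "\<And>y. \<bar>y - x\<bar> < e \<Longrightarrow> f y = 0"
      by (auto simp: Z_def)
    have "y \<in> Z" if "dist y x < e / 2" for y
    proof -
      have "f z = 0" if "\<bar>z - y\<bar> < e / 2" for z
        by (rule e(2)) (use \<open>dist y x < e / 2\<close> that in \<open>unfold dist_real_def, linarith\<close>)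
      then show ?thesis
        using e(1) half_gt_zero unfolding Z_def mem_Collect_eq by blast
    qed
    then show "\<exists>e>0. \<forall>y. dist y x < e \<longrightarrow> y \<in> Z"
      using e(1) half_gt_zero by blast
  qed
  moreover have "closed Z"
    unfolding closure_subset_eq[symmetric]
  proof
    fix x0 assume x0: "x0 \<in> closure Z"
    obtain r c where r: "r > 0" "\<And>x. \<bar>x - x0\<bar> < r \<Longrightarrow> (\<lambda>n. c n * of_real (x - x0) ^ n) sums f x"
      using f unfolding local_power_series_def by metis
    have "\<exists>x. x \<noteq> x0 \<and> \<bar>x - x0\<bar> < e \<and> f x = 0" if "e > 0" for e
    proof -
      obtain y where y: "y \<in> Z" "\<bar>y - x0\<bar> < e / 2"
        using x0 \<open>e > 0\<close> unfolding closure_approachable dist_real_def by (meson half_gt_zero)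
      then obtain d where d: "d > 0" "\<And>z. \<bar>z - y\<bar> < d \<Longrightarrow> f z = 0"
        by (auto simp: Z_def)
      define s where "s = min (d / 2) (e / 4)"
      have s: "s > 0" "s < d" "s < e / 2"
        using d(1) \<open>e > 0\<close> by (auto simp: s_def)
      show ?thesis
      proof (cases "y = x0")
        case True
        then show ?thesis using s d(2)[of "y + s"] by (intro exI[of _ "y + s"]) auto
      next
        case False
        moreover have "\<bar>y - x0\<bar> < e" using y(2) \<open>e > 0\<close> by linarith
        moreover have "f y = 0" using d by simp
        ultimately show ?thesis by blast
      qed
    qed
    from local_power_series_zero_near[OF r(2) this r(1)] have "f x = 0" if "\<bar>x - x0\<bar> < r" for x
      using that by blast
    then show "x0 \<in> Z"
      using r(1) by (auto simp: Z_def)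
  qed
  moreover have "(a + b) / 2 \<in> Z"
    unfolding Z_def mem_Collect_eq
    by (rule exI[of _ "(b - a) / 2"]) (use \<open>a < b\<close> in \<open>auto intro!: zero simp: abs_if field_simps split: if_splits\<close>)
  ultimately have "Z = UNIV"
    using clopen[of Z] by auto
  then have "x \<in> Z" by simp
  then show ?thesis
    unfolding Z_def mem_Collect_eq by (metis abs_zero diff_self)
qed

section \<open>Compactly supported distributions and their Fourier transforms\<close>

lemma distribution_add:
  "distribution T \<Longrightarrow> \<psi> \<in> test_functions \<Longrightarrow> \<eta> \<in> test_functions \<Longrightarrow> T (\<lambda>x. \<psi> x + \<eta> x) = T \<psi> + T \<eta>"
  by (simp add: distribution_def)

lemma distribution_cmult:
  "distribution T \<Longrightarrow> \<psi> \<in> test_functions \<Longrightarrow> T (\<lambda>x. b * \<psi> x) = b * T \<psi>"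
  by (simp add: distribution_def)

lemma distribution_diff:
  assumes "distribution T" "\<psi> \<in> test_functions" "\<eta> \<in> test_functions"
  shows "T (\<lambda>x. \<psi> x - \<eta> x) = T \<psi> - T \<eta>"
proof -
  have "T (\<lambda>x. \<psi> x + (-1) * \<eta> x) = T \<psi> - T \<eta>"
    unfolding distribution_add[OF assms(1,2) test_cmult[OF assms(3)]] distribution_cmult[OF assms(1,3)]
    by simp
  then show ?thesis by simp
qed

lemma distribution_sum:
  assumes "distribution T" "finite I" "\<And>i. i \<in> I \<Longrightarrow> f i \<in> test_functions"
  shows "T (\<lambda>x. \<Sum>i\<in>I. f i x) = (\<Sum>i\<in>I. T (f i))"
  using assms(2,3)
proof (induction I)
  case empty
  have "T (\<lambda>x. 0 * tile x) = 0"
    using distribution_cmult[OF assms(1) tile_test, of 0] by simp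
  then show ?case by simp
next
  case (insert i I)
  then have "T (\<lambda>x. f i x + (\<Sum>i\<in>I. f i x)) = T (f i) + (\<Sum>i\<in>I. T (f i))"
    by (subst distribution_add[OF assms(1)]) (auto intro: test_sum)
  then show ?case using insert.hyps by simp
qed

text \<open>The support of \<open>T\<close> is a compact subset of the open interval \<open>(- R, R)\<close>; hence two test
functions that agree on this interval have the same value under \<open>T\<close>.\<close>

definition carried_in :: "functional \<Rightarrow> real \<Rightarrow> bool" where
  "carried_in T R \<longleftrightarrow> distribution T \<and> R > 0 \<and> (\<exists>K. compact K \<and> supported_in T K \<and> K \<subseteq> {-R<..<R})"

lemma carried_in_distribution: "carried_in T R \<Longrightarrow> distribution T"
  and carried_in_pos: "carried_in T R \<Longrightarrow> R > 0"
  by (simp_all add: carried_in_def)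

lemma carried_in_ex:
  assumes "compactly_supported_distribution T"
  obtains R where "carried_in T R"
proof -
  obtain K where K: "compact K" "supported_in T K" and T: "distribution T"
    using assms by (auto simp: compactly_supported_distribution_def)
  then obtain B where B: "\<And>x. x \<in> K \<Longrightarrow> \<bar>x\<bar> \<le> B"
    using compact_imp_bounded[of K] by (auto simp: bounded_iff)
  have "x \<in> {- (\<bar>B\<bar> + 1)<..<\<bar>B\<bar> + 1}" if "x \<in> K" for x
    using B[OF that] by (auto simp: abs_le_iff)
  with K T show ?thesis
    by (intro that[of "\<bar>B\<bar> + 1"]) (auto simp: carried_in_def)
qed

lemma supported_in_local:
  assumes T: "distribution T" "supported_in T K" and "open U" "K \<subseteq> U"
    and test: "\<psi> \<in> test_functions" "\<eta> \<in> test_functions" and eq: "\<And>x. x \<in> U \<Longrightarrow> \<psi> x = \<eta> x"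
  shows "T \<psi> = T \<eta>"
proof -
  have "supp (\<lambda>x. \<psi> x - \<eta> x) \<inter> U = {}"
    by (rule supp_disjoint_open) (use assms in simp_all)
  then have "T (\<lambda>x. \<psi> x - \<eta> x) = 0"
    using T(2) test_diff[OF test] \<open>K \<subseteq> U\<close> unfolding supported_in_def by blast
  then show ?thesis
    using distribution_diff[OF T(1) test] by simp
qed

lemma carried_in_local:
  assumes "carried_in T R" "\<psi> \<in> test_functions" "\<eta> \<in> test_functions"
    and "\<And>x. \<bar>x\<bar> < R \<Longrightarrow> \<psi> x = \<eta> x"
  shows "T \<psi> = T \<eta>"
proof -
  obtain K where K: "supported_in T K" "K \<subseteq> {-R<..<R}" "distribution T"
    using assms(1) by (auto simp: carried_in_def)
  show ?thesis
    by (rule supported_in_local[OF K(3,1) _ K(2)]) (use assms in \<open>auto simp: abs_less_iff\<close>)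
qed

lemma carried_in_zero:
  assumes "carried_in T R" "\<psi> \<in> test_functions" "\<And>x. \<bar>x\<bar> < R \<Longrightarrow> \<psi> x = 0"
  shows "T \<psi> = 0"
proof -
  have "T \<psi> = T (\<lambda>x. 0 * tile x)"
    by (rule carried_in_local[OF assms(1,2) test_cmult[OF tile_test]]) (use assms(3) in simp)
  also have "\<dots> = 0"
    using distribution_cmult[of T tile 0] assms(1) tile_test by (simp add: carried_in_def)
  finally show ?thesis .
qed

lemma cutoff_is_cutoff: "carried_in T R \<Longrightarrow> is_cutoff T (cutoff R)"
proof -
  assume T: "carried_in T R"
  then obtain K where "compact K" "supported_in T K" "K \<subseteq> {-R<..<R}"
    by (auto simp: carried_in_def)
  moreover have "\<forall>x\<in>{-R<..<R}. cutoff R x = 1"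
    by (auto intro!: cutoff_eq_1 simp: abs_le_iff)
  moreover have "cutoff R \<in> test_functions"
    using carried_in_pos[OF T] by (intro cutoff_test) simp
  ultimately show ?thesis
    unfolding is_cutoff_def by (metis open_greaterThanLessThan)
qed

definition wave :: "complex \<Rightarrow> real \<Rightarrow> complex" where
  "wave z x = exp (- 2 * of_real pi * \<i> * of_real x * z)"

lemma wave_eq: "wave z = (\<lambda>x. exp ((- 2 * of_real pi * \<i> * z) * of_real x))"
  by (simp add: wave_def fun_eq_iff mult_ac)

lemma smooth_wave: "smooth (wave z)"
  unfolding wave_eq by (rule smooth_exp)

lemma nderiv_wave: "nderiv n (wave z) = (\<lambda>x. (- 2 * of_real pi * \<i> * z) ^ n * wave z x)"
  unfolding wave_eq by (rule nderiv_exp)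

lemma wave_add: "wave z (x + y) = wave z x * wave z y"
  by (simp add: wave_def algebra_simps exp_add exp_diff exp_minus divide_inverse)

text \<open>Two cutoffs \<open>\<rho>\<close> and \<open>\<sigma>\<close> for possibly different sets carrying \<open>T\<close> give the same value, because
each can be multiplied into the other: \<open>\<rho>\<close>, \<open>\<rho> \<sigma>\<close> and \<open>\<sigma>\<close> lead to the same result.  This avoids
intersecting the two sets.\<close>

lemma fourier_eq_cutoff:
  assumes T: "distribution T" "is_cutoff T \<rho>"
  shows "fourier T z = T (\<lambda>x. \<rho> x * wave z x)"
proof -
  have *: "T (\<lambda>x. \<rho> x * wave z x) = T (\<lambda>x. \<rho> x * wave z x * \<sigma> x)"
    if \<rho>: "\<rho> \<in> test_functions" and \<sigma>: "is_cutoff T \<sigma>" for \<rho> \<sigma>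
  proof -
    obtain K U where K: "\<sigma> \<in> test_functions" "supported_in T K" "open U" "K \<subseteq> U" "\<And>x. x \<in> U \<Longrightarrow> \<sigma> x = 1"
      using \<sigma> by (auto simp: is_cutoff_def)
    show ?thesis
      by (rule supported_in_local[OF T(1) K(2-4)])
        (use K(1,5) \<rho> in \<open>auto intro!: test_mult smooth_wave test_smooth\<close>)
  qed
  have "T (\<lambda>x. \<sigma> x * wave z x) = T (\<lambda>x. \<rho> x * wave z x)" if "is_cutoff T \<sigma>" for \<sigma>
  proof -
    have "\<rho> \<in> test_functions" "\<sigma> \<in> test_functions"
      using that T by (auto simp: is_cutoff_def)
    then show ?thesis
      using *[of \<sigma> \<rho>] *[of \<rho> \<sigma>] that T by (simp add: mult_ac)
  qed
  then show ?thesis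
    unfolding fourier_def wave_def[symmetric] using T(2) by (intro the_equality) (metis, metis)
qed

lemma fourier_eq:
  assumes "carried_in T R"
  shows "fourier T z = T (\<lambda>x. cutoff R x * wave z x)"
  using fourier_eq_cutoff[OF carried_in_distribution cutoff_is_cutoff] assms by blast

text \<open>The form of continuity used below: by the Leibniz rule, locally uniform convergence to zero of all
derivatives of \<open>G m\<close> suffices once a fixed test function is multiplied in.\<close>

lemma distribution_tendsto_0:
  assumes T: "distribution T" and \<theta>: "\<theta> \<in> test_functions" and G: "\<And>m. smooth (G m)"
    and lim: "\<And>k. uniform_limit (supp \<theta>) (\<lambda>m. nderiv k (G m)) (\<lambda>_. 0) sequentially"
  shows "(\<lambda>m :: nat. T (\<lambda>x. \<theta> x * G m x)) \<longlonglongrightarrow> 0"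
proof -
  obtain B M where BM: "\<And>\<psi>. \<psi> \<in> test_functions \<Longrightarrow> supp \<psi> \<subseteq> supp \<theta> \<Longrightarrow>
      norm (T \<psi>) \<le> B * (\<Sum>k\<le>M. SUP x. norm (nderiv k \<psi> x))"
  proof -
    have "compact (supp \<theta>)"
      using \<theta> by (simp add: test_functions_def)
    then have "\<exists>B M. \<forall>\<psi>\<in>test_functions. supp \<psi> \<subseteq> supp \<theta> \<longrightarrow>
        norm (T \<psi>) \<le> B * (\<Sum>k\<le>M. SUP x. norm (nderiv k \<psi> x))"
      using T unfolding distribution_def by simp
    then show ?thesis
      using that by meson
  qed
  define S where "S k m = (SUP x. norm (nderiv k (\<lambda>x. \<theta> x * G m x) x))" for k m
  have test: "(\<lambda>x. \<theta> x * G m x) \<in> test_functions" for m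
    by (rule test_mult[OF \<theta> G])
  have S0: "S k \<longlonglongrightarrow> 0" for k
  proof -
    have "\<forall>i. \<exists>A>0. \<forall>x. norm (nderiv i \<theta> x) \<le> A"
      using test_bounded[OF nderiv_test[OF \<theta>]] by metis
    then obtain A where A: "\<And>i. A i > 0" "\<And>i x. norm (nderiv i \<theta> x) \<le> A i"
      by metis
    show ?thesis
    proof (rule tendstoI)
      fix e :: real assume "e > 0"
      define D where "D = (\<Sum>i\<le>k. of_nat (k choose i) * A i)"
      have "D \<ge> 0"
        unfolding D_def by (intro sum_nonneg mult_nonneg_nonneg) (use A in \<open>auto intro: less_imp_le\<close>)
      define d where "d = e / (2 * (D + 1))"
      have d: "d > 0" "D * d < e"
        using \<open>e > 0\<close> \<open>D \<ge> 0\<close> mult_nonneg_nonneg[of D e]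
        by (auto simp: d_def field_simps add_nonneg_pos)
      have "\<forall>\<^sub>F m in sequentially. \<forall>j\<in>{..k}. \<forall>x\<in>supp \<theta>. dist (nderiv j (G m) x) 0 < d"
        using lim d(1) by (intro eventually_ball_finite) (auto simp: uniform_limit_iff)
      then show "\<forall>\<^sub>F m in sequentially. dist (S k m) 0 < e"
      proof eventually_elim
        case (elim m)
        have bound: "norm (nderiv k (\<lambda>x. \<theta> x * G m x) x) \<le> D * d" for x
        proof (cases "x \<in> supp \<theta>")
          case True
          have "norm (nderiv k (\<lambda>x. \<theta> x * G m x) x) \<le>
              (\<Sum>i\<le>k. norm (of_nat (k choose i) * (nderiv i \<theta> x * nderiv (k - i) (G m) x)))"
            unfolding nderiv_mult[OF test_smooth[OF \<theta>] G] by (rule norm_sum)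
          also have "\<dots> \<le> (\<Sum>i\<le>k. of_nat (k choose i) * (A i * d))"
            unfolding norm_mult norm_of_nat
            by (intro sum_mono mult_left_mono mult_mono A)
              (use elim True A(1) in \<open>auto intro: less_imp_le\<close>)
          also have "\<dots> = D * d"
            by (simp add: D_def sum_distrib_right mult.assoc)
          finally show ?thesis .
        next
          case False
          have "nderiv k (\<lambda>x. \<theta> x * G m x) x = 0"
            by (rule nderiv_eq_0_open[of "- supp \<theta>"])
              (use False supp_ge[of \<theta>] in \<open>auto simp: supp_def closed_def[symmetric]\<close>)
          then show ?thesis using d(1) \<open>D \<ge> 0\<close> by simp
        qed
        have "bdd_above (range (\<lambda>x. norm (nderiv k (\<lambda>x. \<theta> x * G m x) x)))"
          using bound by (auto simp: bdd_above_def)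
        then have "S k m \<ge> 0"
          unfolding S_def by (rule cSUP_upper2[of _ _ 0]) auto
        moreover have "S k m \<le> D * d"
          unfolding S_def by (rule cSUP_least) (use bound in auto)
        ultimately show ?case using d(2) by simp
      qed
    qed
  qed
  have "(\<lambda>m. B * (\<Sum>k\<le>M. S k m)) \<longlonglongrightarrow> B * (\<Sum>k\<le>M. 0)"
    by (intro tendsto_intros S0)
  then have lim0: "(\<lambda>m. B * (\<Sum>k\<le>M. S k m)) \<longlonglongrightarrow> 0"
    by simp
  show ?thesis
  proof (rule Lim_null_comparison[OF _ lim0], rule always_eventually, rule allI)
    fix m
    have "supp (\<lambda>x. \<theta> x * G m x) \<subseteq> supp \<theta>"
      unfolding supp_def by (intro closure_mono) auto
    from BM[OF test this] show "norm (T (\<lambda>x. \<theta> x * G m x)) \<le> B * (\<Sum>k\<le>M. S k m)"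
      by (simp add: S_def)
  qed
qed

text \<open>Every derivative of a remainder of the exponential series is again such a remainder, of a series
truncated earlier.\<close>

lemma nderiv_exp_tail:
  fixes v :: complex
  defines "G \<equiv> \<lambda>k M (x :: real). v ^ k * (exp (v * of_real x) - (\<Sum>n<M - k. (v * of_real x) ^ n / fact n))"
  shows "smooth (G 0 M)" and "nderiv k (G 0 M) = G k M"
proof -
  have der: "((\<lambda>x. \<Sum>n<j. (v * of_real x) ^ n / fact n) has_vector_derivative
      v * (\<Sum>n<j - 1. (v * of_real x) ^ n / fact n)) (at x)" for j and x :: real
  proof (induction j)
    case (Suc j)
    have "((\<lambda>x. (v * of_real x) ^ j / fact j) has_vector_derivative
        (if j = 0 then 0 else v * ((v * of_real x) ^ (j - 1) / fact (j - 1)))) (at x)"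
    proof (cases j)
      case (Suc i)
      have "((\<lambda>w. (v * w) ^ Suc i / fact (Suc i)) has_field_derivative
          (of_nat (Suc i) * (v * of_real x) ^ i * v) / fact (Suc i)) (at (of_real x))"
        by (auto intro!: derivative_eq_intros simp del: of_nat_Suc power_Suc)
      also have "(of_nat (Suc i) * (v * of_real x) ^ i * v) / fact (Suc i) = v * ((v * of_real x) ^ i / fact i)"
        unfolding fact_Suc of_nat_mult by (simp del: of_nat_Suc)
      finally show ?thesis
        unfolding Suc using has_vector_derivative_real_field by simp
    qed simp
    from has_vector_derivative_add[OF Suc this] show ?case
      by (cases j) (simp_all add: algebra_simps)
  qed simp
  have "(G k M has_vector_derivative G (Suc k) M x) (at x)" for k x
  proof -
    have "((\<lambda>x. exp (v * of_real x)) has_vector_derivative v * exp (v * of_real x)) (at x)"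
      by (rule has_vector_derivative_real_field) (auto intro!: derivative_eq_intros)
    from has_vector_derivative_mult_right[OF has_vector_derivative_diff[OF this der[of "M - k"]], of "v ^ k"]
    show ?thesis
      by (simp add: G_def algebra_simps)
  qed
  note * = this
  show "smooth (G 0 M)"
    by (rule smooth_chain[where F = "\<lambda>k. G k M", OF refl *])
  show "nderiv k (G 0 M) = G k M"
    by (rule nderiv_eq_chain[where F = "\<lambda>k. G k M", OF refl *])
qed

lemma uniform_limit_exp_series:
  fixes v :: complex
  assumes "bounded A"
  shows "uniform_limit A (\<lambda>M (x :: real). \<Sum>n<M. (v * of_real x) ^ n / fact n) (\<lambda>x. exp (v * of_real x)) sequentially"
proof -
  obtain B where B: "\<And>x. x \<in> A \<Longrightarrow> \<bar>x\<bar> \<le> B"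
    using assms by (auto simp: bounded_iff)
  have "uniform_limit A (\<lambda>M (x :: real). \<Sum>n<M. (v * of_real x) ^ n / fact n)
      (\<lambda>x. \<Sum>n. (v * of_real x) ^ n / fact n) sequentially"
  proof (rule Weierstrass_m_test)
    fix n x assume "x \<in> A"
    then have "norm (v * of_real x) \<le> norm v * \<bar>B\<bar>"
      unfolding norm_mult using B[of x] by (intro mult_left_mono) auto
    then show "norm ((v * of_real x) ^ n / fact n) \<le> (norm v * \<bar>B\<bar>) ^ n / fact n"
      by (simp add: norm_divide norm_power divide_right_mono power_mono)
  next
    show "summable (\<lambda>n. (norm v * \<bar>B\<bar>) ^ n / fact n)"
      using summable_exp[of "norm v * \<bar>B\<bar>"] by (simp add: divide_inverse mult.commute)
  qed
  moreover have "(\<Sum>n. (v * of_real x) ^ n / fact n) = exp (v * of_real x)" for x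
    by (simp add: exp_def scaleR_conv_of_real divide_inverse mult.commute)
  ultimately show ?thesis by simp
qed

text \<open>Up to the factor \<open>(- 2 \<pi> \<i>) ^ k\<close>, this is the \<open>k\<close>-th derivative of the Fourier transform; see
\<open>higher_deriv_fourier\<close>.\<close>

definition moment :: "functional \<Rightarrow> real \<Rightarrow> nat \<Rightarrow> complex \<Rightarrow> complex" where
  "moment T R k z = T (\<lambda>x. cutoff R x * (of_real x ^ k * wave z x))"

lemma smooth_of_real_power: "smooth (\<lambda>x. of_real x ^ k)"
  by (rule smooth_power[OF smooth_of_real])

text \<open>The kernel \<open>wave (z + u)\<close> is expanded in powers of \<open>u\<close>.  On a compact set the exponential series
converges uniformly together with all derivatives, so that \<open>T\<close> may be applied term by term.\<close>

lemma fourier_power_series: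
  assumes T: "carried_in T R"
  shows "(\<lambda>n. ((- 2 * of_real pi * \<i>) ^ n / fact n * moment T R n z) * u ^ n) sums fourier T (z + u)"
proof -
  define v where "v = - 2 * of_real pi * \<i> * u"
  define \<theta> where "\<theta> x = cutoff R x * wave z x" for x
  have R: "R > 0" and dT: "distribution T"
    using T by (auto simp: carried_in_def)
  have \<theta>: "\<theta> \<in> test_functions"
    unfolding \<theta>_def by (rule test_mult[OF cutoff_test smooth_wave]) (use R in simp)
  define E where "E M x = exp (v * of_real x) - (\<Sum>n<M. (v * of_real x) ^ n / fact n)" for M and x :: real
  have E: "smooth (E M)" "nderiv k (E M) =
      (\<lambda>x. v ^ k * (exp (v * of_real x) - (\<Sum>n<M - k. (v * of_real x) ^ n / fact n)))" for M k
    using nderiv_exp_tail[where v = v] by (simp_all add: E_def[abs_def])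
  have "bounded (supp \<theta>)"
    using \<theta> by (simp add: test_functions_def compact_imp_bounded)
  note unif = uniform_limit_exp_series[OF this, of v]
  have "(\<lambda>M. T (\<lambda>x. \<theta> x * E M x)) \<longlonglongrightarrow> 0"
  proof (rule distribution_tendsto_0[OF dT \<theta> E(1)])
    fix k
    have "uniform_limit (supp \<theta>) (\<lambda>M x. \<Sum>n<M - k. (v * of_real x) ^ n / fact n) (\<lambda>x. exp (v * of_real x)) sequentially"
      using filterlim_compose[OF unif filterlim_minus_const_nat_at_top[of k]] by simp
    then have "uniform_limit (supp \<theta>) (\<lambda>M x. v ^ k * (exp (v * of_real x) - (\<Sum>n<M - k. (v * of_real x) ^ n / fact n)))
        (\<lambda>x. v ^ k * (exp (v * of_real x) - exp (v * of_real x))) sequentially"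
      by (intro bounded_linear.uniform_limit[OF bounded_linear_mult_right] uniform_limit_intros)
    then show "uniform_limit (supp \<theta>) (\<lambda>m. nderiv k (E m)) (\<lambda>_. 0) sequentially"
      unfolding E by simp
  qed
  moreover have "T (\<lambda>x. \<theta> x * E M x) = fourier T (z + u) -
      (\<Sum>n<M. ((- 2 * of_real pi * \<i>) ^ n / fact n * moment T R n z) * u ^ n)" for M
  proof -
    have t1: "(\<lambda>x. cutoff R x * wave (z + u) x) \<in> test_functions"
      by (rule test_mult[OF cutoff_test smooth_wave]) (use R in simp)
    have t2: "(\<lambda>x. cutoff R x * (of_real x ^ n * wave z x)) \<in> test_functions" for n
      by (intro test_mult[OF cutoff_test] smooth_mult smooth_of_real_power smooth_wave) (use R in simp)
    have eq: "(\<lambda>x. \<theta> x * E M x) = (\<lambda>x. cutoff R x * wave (z + u) x -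
        (\<Sum>n<M. (v ^ n / fact n) * (cutoff R x * (of_real x ^ n * wave z x))))"
    proof
      fix x
      have "wave (z + u) x = wave z x * exp (v * of_real x)"
        by (simp add: wave_def v_def algebra_simps flip: exp_add)
      then show "\<theta> x * E M x = cutoff R x * wave (z + u) x -
          (\<Sum>n<M. (v ^ n / fact n) * (cutoff R x * (of_real x ^ n * wave z x)))"
        by (simp add: \<theta>_def E_def sum_distrib_left right_diff_distrib power_mult_distrib mult_ac)
    qed
    have "T (\<lambda>x. \<theta> x * E M x) = fourier T (z + u) - (\<Sum>n<M. (v ^ n / fact n) * moment T R n z)"
      unfolding eq moment_def fourier_eq[OF T]
        distribution_diff[OF dT t1 test_sum[OF finite_lessThan test_cmult[OF t2]]]
        distribution_sum[OF dT finite_lessThan test_cmult[OF t2]] distribution_cmult[OF dT t2] ..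
    moreover have "(v ^ n / fact n) * moment T R n z =
        ((- 2 * of_real pi * \<i>) ^ n / fact n * moment T R n z) * u ^ n" for n
      unfolding v_def power_mult_distrib[of _ u] by (simp only: divide_inverse mult_ac)
    ultimately show ?thesis by (simp only:)
  qed
  ultimately have "(\<lambda>M. fourier T (z + u) - (\<Sum>n<M. ((- 2 * of_real pi * \<i>) ^ n / fact n * moment T R n z) * u ^ n)) \<longlonglongrightarrow> 0"
    by simp
  from tendsto_diff[OF tendsto_const[of "fourier T (z + u)"] this] show ?thesis
    unfolding sums_def by simp
qed

lemma higher_deriv_fourier:
  assumes "carried_in T R"
  shows "(deriv ^^ k) (fourier T) z = (- 2 * of_real pi * \<i>) ^ k * moment T R k z"
proof -
  have "(\<lambda>u. fourier T (z + u)) has_fps_expansion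
      Abs_fps (\<lambda>n. (- 2 * of_real pi * \<i>) ^ n / fact n * moment T R n z)"
    by (rule has_fps_expansionI) (use fourier_power_series[OF assms] in simp)
  from fps_nth_fps_expansion[OF this, of k] show ?thesis
    by (subst higher_deriv_shift_0) (simp add: o_def field_simps)
qed

section \<open>Fourier series of test functions\<close>

text \<open>The harmonics of the interval \<open>[- P, P]\<close>, of period \<open>2 P\<close>.\<close>

definition harmonic :: "real \<Rightarrow> int \<Rightarrow> real \<Rightarrow> complex" where
  "harmonic P m = wave (of_real (of_int m / (2 * P)))"

definition fcoeff :: "real \<Rightarrow> (real \<Rightarrow> complex) \<Rightarrow> int \<Rightarrow> complex" where
  "fcoeff P g m = integral {-P..P} (\<lambda>x. g x * harmonic P (- m) x) / of_real (2 * P)"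

lemma harmonic_eq: "harmonic P m x = exp (of_real (- (pi * x / P) * of_int m) * \<i>)"
  by (simp add: harmonic_def wave_def mult_ac)

lemma harmonic_0 [simp]: "harmonic P 0 x = 1"
  by (simp add: harmonic_eq)

lemma harmonic_mult: "harmonic P m x * harmonic P k x = harmonic P (m + k) x"
  unfolding harmonic_eq exp_add[symmetric] of_int_add distrib_left of_real_add distrib_right ..

lemma cnj_harmonic: "cnj (harmonic P m x) = harmonic P (- m) x"
  by (simp add: harmonic_eq exp_cnj)

lemma norm_harmonic [simp]: "norm (harmonic P m x) = 1"
  by (simp add: harmonic_eq)

lemma harmonic_nonzero [simp]: "harmonic P m x \<noteq> 0"
  by (simp add: harmonic_eq)

lemma continuous_on_harmonic: "continuous_on A (harmonic P m)"
  unfolding harmonic_def by (rule continuous_on_smooth[OF smooth_wave])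

lemma harmonic_has_vector_derivative:
  "(harmonic P m has_vector_derivative (- of_real pi * \<i> * of_int m / of_real P) * harmonic P m x) (at x)"
  using smooth_has_vector_derivative[OF smooth_wave, of 0 "of_real (of_int m / (2 * P))" x]
  by (simp add: nderiv_wave harmonic_def mult.assoc)

lemma integral_harmonic:
  assumes "P > 0"
  shows "integral {-P..P} (harmonic P m) = (if m = 0 then of_real (2 * P) else 0)"
proof (cases "m = 0")
  case True
  have "harmonic P 0 = (\<lambda>_. 1)" by auto
  with True assms show ?thesis by (simp add: content_real scaleR_conv_of_real del: harmonic_0)
next
  case False
  define c where "c = - of_real pi * \<i> * of_int m / of_real P"
  have "c \<noteq> 0" using False assms by (simp add: c_def)
  have "((\<lambda>x. harmonic P m x / c) has_vector_derivative harmonic P m x) (at x)" for x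
    using has_vector_derivative_mult_right[OF harmonic_has_vector_derivative, of "inverse c" P m x] \<open>c \<noteq> 0\<close>
    by (simp add: c_def field_simps)
  then have "(harmonic P m has_integral (harmonic P m P / c - harmonic P m (-P) / c)) {-P..P}"
    by (intro fundamental_theorem_of_calculus) (use assms in \<open>auto intro: has_vector_derivative_at_within\<close>)
  moreover have "harmonic P m P = harmonic P m (-P)"
    unfolding harmonic_eq exp_eq by (rule exI[of _ "- m"]) (use assms in \<open>simp add: algebra_simps\<close>)
  ultimately show ?thesis
    using False by (simp add: integral_unique)
qed

lemma integrable_times_harmonic:
  "continuous_on {-P..P} g \<Longrightarrow> (\<lambda>x. g x * harmonic P m x) integrable_on {-P..P}"
  by (intro integrable_continuous_interval continuous_intros continuous_on_harmonic)

text \<open>The partial sum \<open>s\<close> is the orthogonal projection of \<open>g\<close>; the squared norm of \<open>g - s\<close> is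
non-negative and equals the difference of the two sides, up to a positive factor.\<close>

lemma bessel_inequality:
  assumes P: "P > 0" and g: "continuous_on {-P..P} g" and F: "finite F"
  shows "(\<Sum>m\<in>F. (norm (fcoeff P g m))\<^sup>2) \<le> integral {-P..P} (\<lambda>x. (norm (g x))\<^sup>2) / (2 * P)"
proof -
  let ?I = "{-P..P}"
  define s where "s x = (\<Sum>m\<in>F. fcoeff P g m * harmonic P m x)" for x
  have s: "continuous_on ?I s"
    unfolding s_def by (intro continuous_intros continuous_on_harmonic)
  have int: "f integrable_on ?I" if "continuous_on ?I f" for f :: "real \<Rightarrow> complex"
    using that by (rule integrable_continuous_interval)
  have coeff_s: "fcoeff P s m = fcoeff P g m" if "m \<in> F" for m
  proof -
    have "integral ?I (\<lambda>x. s x * harmonic P (- m) x) =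
        integral ?I (\<lambda>x. \<Sum>k\<in>F. fcoeff P g k * harmonic P (k - m) x)"
      by (simp add: s_def sum_distrib_right mult.assoc harmonic_mult)
    also have "\<dots> = (\<Sum>k\<in>F. fcoeff P g k * integral ?I (harmonic P (k - m)))"
      by (subst integral_sum) (auto intro!: F int continuous_on_mult continuous_on_diff continuous_on_cnj continuous_on_const continuous_on_harmonic)
    also have "\<dots> = (\<Sum>k\<in>F. if k = m then fcoeff P g k * of_real (2 * P) else 0)"
      by (intro sum.cong refl) (simp add: integral_harmonic[OF P])
    also have "\<dots> = fcoeff P g m * of_real (2 * P)"
      using F that by simp
    finally show ?thesis
      using P by (simp add: fcoeff_def[of P s])
  qed
  have ortho: "integral ?I (\<lambda>x. (g x - s x) * harmonic P (- m) x) = 0" if "m \<in> F" for m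
  proof -
    have "integral ?I (\<lambda>x. (g x - s x) * harmonic P (- m) x) = of_real (2 * P) * (fcoeff P g m - fcoeff P s m)"
      using P unfolding left_diff_distrib
      by (subst Henstock_Kurzweil_Integration.integral_diff)
        (auto simp: fcoeff_def right_diff_distrib intro!: integrable_times_harmonic g s)
    then show ?thesis using coeff_s[OF that] by simp
  qed
  have gs: "integral ?I (\<lambda>x. (g x - s x) * cnj (s x)) = 0"
  proof -
    have "cnj (s x) = (\<Sum>m\<in>F. cnj (fcoeff P g m) * harmonic P (- m) x)" for x
      by (simp add: s_def cnj_harmonic)
    then have "integral ?I (\<lambda>x. (g x - s x) * cnj (s x)) =
        integral ?I (\<lambda>x. \<Sum>m\<in>F. cnj (fcoeff P g m) * ((g x - s x) * harmonic P (- m) x))"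
      by (simp add: sum_distrib_left mult_ac)
    also have "\<dots> = (\<Sum>m\<in>F. cnj (fcoeff P g m) * integral ?I (\<lambda>x. (g x - s x) * harmonic P (- m) x))"
      by (subst integral_sum) (auto intro!: F int continuous_on_mult continuous_on_diff continuous_on_cnj continuous_on_const continuous_on_harmonic g s)
    finally show ?thesis using ortho by simp
  qed
  have sg: "integral ?I (\<lambda>x. s x * cnj (g x)) = of_real (2 * P * (\<Sum>m\<in>F. (norm (fcoeff P g m))\<^sup>2))"
  proof -
    have "integral ?I (\<lambda>x. s x * cnj (g x)) =
        integral ?I (\<lambda>x. \<Sum>m\<in>F. fcoeff P g m * cnj (g x * harmonic P (- m) x))"
      by (simp add: s_def sum_distrib_left cnj_harmonic mult_ac)
    also have "\<dots> = (\<Sum>m\<in>F. fcoeff P g m * integral ?I (\<lambda>x. cnj (g x * harmonic P (- m) x)))"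
      by (subst integral_sum) (auto intro!: F int continuous_on_mult continuous_on_diff continuous_on_cnj continuous_on_const continuous_on_harmonic g s)
    also have "\<dots> = (\<Sum>m\<in>F. fcoeff P g m * cnj (of_real (2 * P) * fcoeff P g m))"
      using P by (simp add: integral_cnj[symmetric] fcoeff_def del: complex_cnj_mult)
    also have "\<dots> = of_real (2 * P * (\<Sum>m\<in>F. (norm (fcoeff P g m))\<^sup>2))"
      by (simp add: sum_distrib_left mult_ac complex_norm_square del: of_real_power)
    finally show ?thesis .
  qed
  have gg: "integral ?I (\<lambda>x. g x * cnj (g x)) = of_real (integral ?I (\<lambda>x. (norm (g x))\<^sup>2))"
  proof (rule integral_unique)
    have "(\<lambda>x. (norm (g x))\<^sup>2) integrable_on ?I"
      by (intro integrable_continuous_interval continuous_intros g)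
    from has_integral_of_real[OF integrable_integral[OF this], where 'b = complex]
    show "((\<lambda>x. g x * cnj (g x)) has_integral of_real (integral ?I (\<lambda>x. (norm (g x))\<^sup>2))) ?I"
      by (simp only: complex_norm_square)
  qed
  have "integral ?I (\<lambda>x. (g x - s x) * cnj (g x - s x)) =
      integral ?I (\<lambda>x. g x * cnj (g x) - s x * cnj (g x) - (g x - s x) * cnj (s x))"
    by (simp add: algebra_simps)
  also have "\<dots> = of_real (integral ?I (\<lambda>x. (norm (g x))\<^sup>2)) - of_real (2 * P * (\<Sum>m\<in>F. (norm (fcoeff P g m))\<^sup>2)) - 0"
    by (subst Henstock_Kurzweil_Integration.integral_diff;
        (subst Henstock_Kurzweil_Integration.integral_diff)?)
      (auto simp: gg sg gs intro!: int continuous_intros g s)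
  finally have *: "integral ?I (\<lambda>x. (g x - s x) * cnj (g x - s x)) =
      of_real (integral ?I (\<lambda>x. (norm (g x))\<^sup>2) - 2 * P * (\<Sum>m\<in>F. (norm (fcoeff P g m))\<^sup>2))"
    by simp
  have "integral ?I (\<lambda>x. (g x - s x) * cnj (g x - s x)) = of_real (integral ?I (\<lambda>x. (norm (g x - s x))\<^sup>2))"
  proof (rule integral_unique)
    have "(\<lambda>x. (norm (g x - s x))\<^sup>2) integrable_on ?I"
      by (intro integrable_continuous_interval continuous_intros g s)
    from has_integral_of_real[OF integrable_integral[OF this], where 'b = complex]
    show "((\<lambda>x. (g x - s x) * cnj (g x - s x)) has_integral of_real (integral ?I (\<lambda>x. (norm (g x - s x))\<^sup>2))) ?I"
      by (simp only: complex_norm_square)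
  qed
  from trans[OF *[symmetric] this] have "integral ?I (\<lambda>x. (norm (g x))\<^sup>2) - 2 * P * (\<Sum>m\<in>F. (norm (fcoeff P g m))\<^sup>2) =
      integral ?I (\<lambda>x. (norm (g x - s x))\<^sup>2)"
    by (simp only: of_real_eq_iff)
  moreover have "integral ?I (\<lambda>x. (norm (g x - s x))\<^sup>2) \<ge> 0"
    by (intro Henstock_Kurzweil_Integration.integral_nonneg integrable_continuous_interval continuous_intros g s) auto
  ultimately show ?thesis
    using P by (simp add: field_simps)
qed

lemma riemann_lebesgue:
  assumes P: "P > 0" and g: "continuous_on {-P..P} g" and h: "inj h"
  shows "(\<lambda>n :: nat. fcoeff P g (h n)) \<longlonglongrightarrow> 0"
proof -
  have "summable (\<lambda>n. (norm (fcoeff P g (h n)))\<^sup>2)"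
  proof (rule bounded_imp_summable)
    fix n
    have "(\<Sum>k\<le>n. (norm (fcoeff P g (h k)))\<^sup>2) = (\<Sum>m\<in>h ` {..n}. (norm (fcoeff P g m))\<^sup>2)"
      using h by (subst sum.reindex) (auto intro: inj_on_subset)
    also have "\<dots> \<le> integral {-P..P} (\<lambda>x. (norm (g x))\<^sup>2) / (2 * P)"
      by (rule bessel_inequality[OF P g]) simp
    finally show "(\<Sum>k\<le>n. (norm (fcoeff P g (h k)))\<^sup>2) \<le> integral {-P..P} (\<lambda>x. (norm (g x))\<^sup>2) / (2 * P)" .
  qed simp
  then have "(\<lambda>n. sqrt ((norm (fcoeff P g (h n)))\<^sup>2)) \<longlonglongrightarrow> sqrt 0"
    by (intro tendsto_real_sqrt summable_LIMSEQ_zero)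
  then show ?thesis
    by (simp add: tendsto_norm_zero_iff)
qed

text \<open>Multiplication by the first harmonic shifts the coefficients by one; this makes the coefficients
of \<open>\<psi>\<close> in the next theorem telescope.\<close>

lemma fcoeff_tangent_quotient:
  assumes P: "P > 0" and g: "continuous_on {-P..P} g"
  shows "fcoeff P (\<lambda>x. c + (harmonic P 1 x - e) * g x) m =
    (if m = 0 then c else 0) + fcoeff P g (m - 1) - e * fcoeff P g m"
proof -
  let ?I = "{-P..P}"
  have "(c + (harmonic P 1 x - e) * g x) * harmonic P (- m) x =
      c * harmonic P (- m) x + g x * harmonic P (- (m - 1)) x - e * (g x * harmonic P (- m) x)" for x
    using harmonic_mult[of P 1 x "- m"] by (simp add: algebra_simps)
  then have "integral ?I (\<lambda>x. (c + (harmonic P 1 x - e) * g x) * harmonic P (- m) x) =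
      integral ?I (\<lambda>x. c * harmonic P (- m) x + g x * harmonic P (- (m - 1)) x - e * (g x * harmonic P (- m) x))"
    by simp
  also have "\<dots> = integral ?I (\<lambda>x. c * harmonic P (- m) x + g x * harmonic P (- (m - 1)) x)
      - integral ?I (\<lambda>x. e * (g x * harmonic P (- m) x))"
    by (rule Henstock_Kurzweil_Integration.integral_diff)
      (intro integrable_continuous_interval continuous_on_mult continuous_on_add continuous_on_const
        continuous_on_harmonic g)+
  also have "integral ?I (\<lambda>x. c * harmonic P (- m) x + g x * harmonic P (- (m - 1)) x) =
      integral ?I (\<lambda>x. c * harmonic P (- m) x) + integral ?I (\<lambda>x. g x * harmonic P (- (m - 1)) x)"
    by (rule Henstock_Kurzweil_Integration.integral_add)
      (intro integrable_continuous_interval continuous_on_mult continuous_on_add continuous_on_const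
        continuous_on_harmonic g)+
  finally show ?thesis
    using P integral_harmonic[OF P, of "- m"] unfolding fcoeff_def by (simp add: add_divide_distrib diff_divide_distrib)
qed

lemma harmonic_1_inj:
  assumes "P > 0" "-P < x0" "x0 < P" "-P \<le> x" "x \<le> P" "harmonic P 1 x = harmonic P 1 x0"
  shows "x = x0"
proof -
  obtain n :: int where "of_real (- (pi * x / P)) * \<i> = of_real (- (pi * x0 / P)) * \<i> + of_int (2 * n) * of_real pi * \<i>"
    using assms(6) unfolding harmonic_eq by (auto simp: exp_eq)
  then have "complex_of_real (- (pi * x / P)) * \<i> = complex_of_real (- (pi * x0 / P) + 2 * of_int n * pi) * \<i>"
    by (simp add: algebra_simps)
  then have "- (pi * x / P) = - (pi * x0 / P) + 2 * of_int n * pi"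
    by (metis complex_i_not_zero mult_right_cancel of_real_eq_iff)
  then have "pi * (x0 - x) = pi * (2 * of_int n * P)"
    using assms(1) by (simp add: field_simps)
  then have eq: "x0 - x = 2 * of_int n * P"
    by simp
  have "\<bar>2 * of_int n * P\<bar> < 2 * P"
    using assms(2-5) unfolding eq[symmetric] by linarith
  then have "\<bar>real_of_int n\<bar> < 1"
    using assms(1) by (simp add: abs_mult)
  then have "n = 0" by linarith
  with eq show ?thesis by simp
qed

text \<open>Groups the terms with indices \<open>n\<close> and \<open>- n\<close>, which turns symmetric sums over the integers into
series over the natural numbers.\<close>

definition two_sided :: "(int \<Rightarrow> 'a :: comm_monoid_add) \<Rightarrow> nat \<Rightarrow> 'a" where
  "two_sided g n = (if n = 0 then g 0 else g (int n) + g (- int n))"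

lemma sum_two_sided: "(\<Sum>n<Suc M. two_sided g n) = (\<Sum>m\<in>{- int M..int M}. g m)"
proof (induction M)
  case (Suc M)
  have "{- int (Suc M)..int (Suc M)} = insert (- int (Suc M)) (insert (int (Suc M)) {- int M..int M})"
    by auto
  with Suc show ?case
    by (simp add: two_sided_def algebra_simps)
qed (simp add: two_sided_def)

lemma has_vector_derivative_difference_quotient:
  assumes "(f has_vector_derivative D) (at x)"
  shows "((\<lambda>h. (f (x + h) - f x) /\<^sub>R h) \<longlongrightarrow> D) (at 0)"
proof -
  have "((\<lambda>h. norm (f (x + h) - f x - h *\<^sub>R D) / norm h) \<longlongrightarrow> 0) (at 0)"
    using assms by (simp add: has_vector_derivative_def has_derivative_at)
  moreover have "\<forall>\<^sub>F h in at 0. norm (f (x + h) - f x - h *\<^sub>R D) / norm h = norm ((f (x + h) - f x) /\<^sub>R h - D)"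
    unfolding eventually_at_filter
  proof (intro always_eventually allI impI)
    fix h :: real assume "h \<noteq> 0"
    then have "(f (x + h) - f x) /\<^sub>R h - D = (f (x + h) - f x - h *\<^sub>R D) /\<^sub>R h"
      by (simp add: scaleR_diff_right)
    then show "norm (f (x + h) - f x - h *\<^sub>R D) / norm h = norm ((f (x + h) - f x) /\<^sub>R h - D)"
      by (simp add: divide_inverse mult.commute)
  qed
  ultimately have "((\<lambda>h. norm ((f (x + h) - f x) /\<^sub>R h - D)) \<longlongrightarrow> 0) (at 0)"
    by (rule Lim_transform_eventually)
  then show ?thesis
    using LIM_zero_cancel tendsto_norm_zero_iff by blast
qed

text \<open>Write \<open>\<psi> x = \<psi> x0 + (E x - E x0) * g x\<close> with \<open>E\<close> the first harmonic.  Differentiability of \<open>\<psi>\<close> at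
\<open>x0\<close> makes \<open>g\<close> continuous, the symmetric partial sums of the Fourier series at \<open>x0\<close> telescope to
\<open>\<psi> x0\<close> plus two multiples of Fourier coefficients of \<open>g\<close>, and these tend to zero by the
Riemann-Lebesgue lemma.\<close>

lemma fourier_series_pointwise:
  assumes P: "P > 0" and \<psi>: "continuous_on {-P..P} \<psi>"
    and D: "(\<psi> has_vector_derivative D) (at x0)" and x0: "-P < x0" "x0 < P"
  shows "(\<lambda>n. two_sided (\<lambda>m. fcoeff P \<psi> m * harmonic P m x0) n) sums \<psi> x0"
proof -
  let ?E = "harmonic P 1"
  define E' where "E' = (- of_real pi * \<i> / of_real P) * ?E x0"
  have "E' \<noteq> 0" using P by (simp add: E'_def)
  have dE: "(?E has_vector_derivative E') (at x0)"
    using harmonic_has_vector_derivative[of P 1 x0] by (simp add: E'_def)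
  define q where "q x = (\<psi> x - \<psi> x0) / (?E x - ?E x0)" for x
  define g where "g x = (if x = x0 then D / E' else q x)" for x
  have inj: "?E x \<noteq> ?E x0" if "x \<in> {-P..P}" "x \<noteq> x0" for x
    using harmonic_1_inj[OF P x0, of x] that by auto
  have "(q \<longlongrightarrow> D / E') (at x0)"
  proof -
    have "((\<lambda>h. ((\<psi> (x0 + h) - \<psi> x0) /\<^sub>R h) / ((?E (x0 + h) - ?E x0) /\<^sub>R h)) \<longlongrightarrow> D / E') (at 0)"
      by (intro tendsto_divide has_vector_derivative_difference_quotient D dE \<open>E' \<noteq> 0\<close>)
    then have "((\<lambda>h. q (x0 + h)) \<longlongrightarrow> D / E') (at 0)"
      by (rule Lim_transform_eventually) (auto simp: eventually_at_filter q_def scaleR_conv_of_real)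
    then show ?thesis
      by (rule LIM_offset_zero_cancel)
  qed
  then have lim: "(g \<longlongrightarrow> D / E') (at x0)"
    by (rule Lim_transform_eventually) (auto simp: eventually_at_filter g_def)
  have g: "continuous_on {-P..P} g"
    unfolding continuous_on_eq_continuous_within
  proof
    fix x assume x: "x \<in> {-P..P}"
    show "continuous (at x within {-P..P}) g"
    proof (cases "x = x0")
      case True
      have "isCont g x0"
        using lim by (simp add: isCont_def g_def)
      with True show ?thesis
        by (simp add: continuous_at_imp_continuous_at_within)
    next
      case False
      have "continuous (at x within {-P..P}) q"
        unfolding q_def using x \<psi> continuous_on_harmonic[of "{-P..P}" P 1] inj[OF x False]
        by (intro continuous_intros) (auto simp: continuous_on_eq_continuous_within)
      then show ?thesis
        by (rule continuous_transform_within[of _ _ _ "\<bar>x - x0\<bar>"]) (use False x in \<open>auto simp: g_def dist_real_def\<close>)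
    qed
  qed
  have \<psi>_eq: "\<psi> x = \<psi> x0 + (?E x - ?E x0) * g x" if "x \<in> {-P..P}" for x
    using inj[OF that] by (auto simp: g_def q_def)
  have coeff: "fcoeff P \<psi> m = (if m = 0 then \<psi> x0 else 0) + fcoeff P g (m - 1) - ?E x0 * fcoeff P g m" for m
  proof -
    have "fcoeff P \<psi> m = fcoeff P (\<lambda>x. \<psi> x0 + (?E x - ?E x0) * g x) m"
      unfolding fcoeff_def by (rule arg_cong[of _ _ "\<lambda>v. v / _"], rule integral_cong) (simp only: \<psi>_eq)
    then show ?thesis
      by (simp only: fcoeff_tangent_quotient[OF P g])
  qed
  define G where "G m = fcoeff P g m * harmonic P (m + 1) x0" for m
  have term_eq: "fcoeff P \<psi> m * harmonic P m x0 = (if m = 0 then \<psi> x0 else 0) + G (m - 1) - G m" for m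
    using harmonic_mult[of P 1 x0 m] by (simp add: coeff G_def algebra_simps)
  have partial: "(\<Sum>m\<in>{- int M..int M}. fcoeff P \<psi> m * harmonic P m x0) = \<psi> x0 + G (- int (Suc M)) - G (int M)" for M
  proof (induction M)
    case (Suc M)
    have "{- int (Suc M)..int (Suc M)} = insert (- int (Suc M)) (insert (int (Suc M)) {- int M..int M})"
      by auto
    with Suc show ?case
      by (simp add: term_eq algebra_simps)
  qed (use term_eq[of 0] in simp)
  have norm_G: "norm (G m) = norm (fcoeff P g m)" for m
    by (simp add: G_def norm_mult)
  have "(\<lambda>M. fcoeff P g (- int (Suc M))) \<longlonglongrightarrow> 0" "(\<lambda>M. fcoeff P g (int M)) \<longlonglongrightarrow> 0"
    by (intro riemann_lebesgue P g, simp add: inj_def)+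
  then have "(\<lambda>M. norm (G (- int (Suc M)))) \<longlonglongrightarrow> 0" "(\<lambda>M. norm (G (int M))) \<longlonglongrightarrow> 0"
    unfolding norm_G by (simp_all only: tendsto_norm_zero)
  then have "(\<lambda>M. G (- int (Suc M))) \<longlonglongrightarrow> 0" "(\<lambda>M. G (int M)) \<longlonglongrightarrow> 0"
    by (simp_all only: tendsto_norm_zero_iff)
  then have "(\<lambda>M. \<psi> x0 + G (- int (Suc M)) - G (int M)) \<longlonglongrightarrow> \<psi> x0 + 0 - 0"
    by (intro tendsto_intros)
  then have "(\<lambda>M. \<Sum>n<Suc M. two_sided (\<lambda>m. fcoeff P \<psi> m * harmonic P m x0) n) \<longlonglongrightarrow> \<psi> x0"
    unfolding sum_two_sided partial by simp
  then show ?thesis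
    unfolding sums_def by (rule LIMSEQ_imp_Suc)
qed

lemma fcoeff_derivative:
  assumes P: "P > 0" and \<psi>: "smooth \<psi>" and zero: "\<And>x. P \<le> \<bar>x\<bar> \<Longrightarrow> \<psi> x = 0"
  shows "fcoeff P (nderiv 1 \<psi>) m = (- of_real pi * \<i> * of_int m / of_real P) * fcoeff P \<psi> m"
proof -
  let ?c = "of_real pi * \<i> * of_int m / of_real P :: complex"
  have "((\<lambda>x. \<psi> x * harmonic P (- m) x) has_vector_derivative
      (\<psi> x * (?c * harmonic P (- m) x) + nderiv 1 \<psi> x * harmonic P (- m) x)) (at x)" for x
    using has_vector_derivative_mult[OF smooth_has_vector_derivative[OF \<psi>, of 0] harmonic_has_vector_derivative[of P "- m"]]
    by simp
  then have "((\<lambda>x. \<psi> x * (?c * harmonic P (- m) x) + nderiv 1 \<psi> x * harmonic P (- m) x) has_integral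
      \<psi> P * harmonic P (- m) P - \<psi> (-P) * harmonic P (- m) (-P)) {-P..P}"
    by (intro fundamental_theorem_of_calculus) (use P in \<open>auto intro: has_vector_derivative_at_within\<close>)
  then have "integral {-P..P} (\<lambda>x. ?c * (\<psi> x * harmonic P (- m) x) + nderiv 1 \<psi> x * harmonic P (- m) x) = 0"
    using zero[of P] zero[of "-P"] P by (simp add: integral_unique mult_ac)
  moreover have "integral {-P..P} (\<lambda>x. ?c * (\<psi> x * harmonic P (- m) x) + nderiv 1 \<psi> x * harmonic P (- m) x) =
      integral {-P..P} (\<lambda>x. ?c * (\<psi> x * harmonic P (- m) x)) + integral {-P..P} (\<lambda>x. nderiv 1 \<psi> x * harmonic P (- m) x)"
    by (rule Henstock_Kurzweil_Integration.integral_add)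
      (intro integrable_continuous_interval continuous_on_mult continuous_on_const
        continuous_on_harmonic continuous_on_nderiv continuous_on_smooth \<psi>)+
  ultimately have "integral {-P..P} (\<lambda>x. nderiv 1 \<psi> x * harmonic P (- m) x) = - ?c * integral {-P..P} (\<lambda>x. \<psi> x * harmonic P (- m) x)"
    by (simp add: add_eq_0_iff2)
  note eq = this
  show ?thesis
    unfolding fcoeff_def eq by simp
qed

lemma fcoeff_nderiv:
  assumes P: "P > 0" and \<psi>: "\<psi> \<in> test_functions" and zero: "\<And>x. P \<le> \<bar>x\<bar> \<Longrightarrow> \<psi> x = 0"
  shows "fcoeff P (nderiv k \<psi>) m = (- of_real pi * \<i> * of_int m / of_real P) ^ k * fcoeff P \<psi> m"
    and "P \<le> \<bar>x\<bar> \<Longrightarrow> nderiv k \<psi> x = 0"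
proof -
  have nz: "nderiv k \<psi> x = 0" if "P \<le> \<bar>x\<bar>" for k x
  proof -
    \<comment> \<open>At the boundary points \<open>\<plusminus>P\<close> the derivatives vanish by continuity.\<close>
    have "continuous_on UNIV (nderiv k \<psi>)"
      by (rule continuous_on_nderiv[OF test_smooth[OF \<psi>]])
    then have closed: "closed {y. nderiv k \<psi> y = 0}"
      by (intro closed_Collect_eq continuous_on_const)
    have "nderiv k \<psi> y = 0" if "P < \<bar>y\<bar>" for y
      by (rule nderiv_eq_0_open[of "{y. P < \<bar>y\<bar>}"])
        (use that zero in \<open>auto intro!: open_Collect_less continuous_intros\<close>)
    then have "{y. P < \<bar>y\<bar>} \<subseteq> {y. nderiv k \<psi> y = 0}"
      by auto
    then have "closure {y. P < \<bar>y\<bar>} \<subseteq> {y. nderiv k \<psi> y = 0}"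
      using closed by (rule closure_minimal)
    moreover have "x \<in> closure {y. P < \<bar>y\<bar>}"
      unfolding closure_approachable
    proof (intro allI impI)
      fix e :: real assume "e > 0"
      then show "\<exists>y\<in>{y. P < \<bar>y\<bar>}. dist y x < e"
        using that P by (intro bexI[of _ "x + sgn x * (e / 2)"])
          (auto simp: dist_real_def sgn_if abs_mult)
    qed
    ultimately show ?thesis by auto
  qed
  then show "nderiv k \<psi> x = 0" if "P \<le> \<bar>x\<bar>"
    using that .
  show "fcoeff P (nderiv k \<psi>) m = (- of_real pi * \<i> * of_int m / of_real P) ^ k * fcoeff P \<psi> m"
  proof (induction k)
    case (Suc k)
    have "nderiv 1 (nderiv k \<psi>) = nderiv (Suc k) \<psi>"
      by (simp add: nderiv_def)
    then show ?case
      using fcoeff_derivative[OF P smooth_nderiv[OF test_smooth[OF \<psi>]] nz, of k m] Suc by simp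
  qed simp
qed

text \<open>Integrating by parts \<open>k\<close> times trades a factor \<open>m ^ k\<close> for a derivative of order \<open>k\<close>.\<close>

lemma fcoeff_rapid_decay:
  assumes P: "P > 0" and \<psi>: "\<psi> \<in> test_functions" and zero: "\<And>x. P \<le> \<bar>x\<bar> \<Longrightarrow> \<psi> x = 0"
  shows "\<exists>D\<ge>0. \<forall>m. norm (fcoeff P \<psi> m) * (1 + \<bar>of_int m\<bar>) ^ k \<le> D"
proof -
  have bound: "\<exists>B\<ge>0. \<forall>m. norm (fcoeff P (nderiv k \<psi>) m) \<le> B" for k
  proof -
    obtain B where B: "B > 0" "\<And>x. norm (nderiv k \<psi> x) \<le> B"
      using test_bounded[OF nderiv_test[OF \<psi>]] by blast
    have "norm (fcoeff P (nderiv k \<psi>) m) \<le> B" for m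
    proof -
      have "norm (integral {-P..P} (\<lambda>x. nderiv k \<psi> x * harmonic P (- m) x)) \<le> B * (P - (- P))"
        using P B by (intro integral_bound continuous_on_mult continuous_on_nderiv continuous_on_harmonic test_smooth[OF \<psi>])
          (auto simp: norm_mult)
      then show ?thesis
        using P by (simp add: fcoeff_def norm_divide norm_mult field_simps)
    qed
    then show ?thesis using B(1) by (intro exI[of _ B]) auto
  qed
  obtain B0 where B0: "B0 \<ge> 0" "\<And>m. norm (fcoeff P \<psi> m) \<le> B0"
    using bound[of 0] by auto
  obtain B where B: "B \<ge> 0" "\<And>m. norm (fcoeff P (nderiv k \<psi>) m) \<le> B"
    using bound[of k] by auto
  show ?thesis
  proof (intro exI[of _ "B0 + (2 * P / pi) ^ k * B"] conjI allI)
    show "0 \<le> B0 + (2 * P / pi) ^ k * B"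
      using B B0 P by simp
    fix m
    show "norm (fcoeff P \<psi> m) * (1 + \<bar>of_int m\<bar>) ^ k \<le> B0 + (2 * P / pi) ^ k * B"
    proof (cases "m = 0")
      case True
      have "0 \<le> (2 * P / pi) ^ k * B"
        using B(1) P by simp
      with True B0(2)[of 0] show ?thesis by simp
    next
      case False
      then have "1 + \<bar>of_int m\<bar> \<le> (2 * P / pi) * (pi * \<bar>real_of_int m\<bar> / P)"
        using P by (simp add: field_simps)
      then have "(1 + \<bar>of_int m\<bar>) ^ k \<le> ((2 * P / pi) * (pi * \<bar>real_of_int m\<bar> / P)) ^ k"
        by (intro power_mono) auto
      then have "norm (fcoeff P \<psi> m) * (1 + \<bar>of_int m\<bar>) ^ k \<le>
          norm (fcoeff P \<psi> m) * ((2 * P / pi) * (pi * \<bar>real_of_int m\<bar> / P)) ^ k"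
        by (intro mult_left_mono) auto
      also have "\<dots> = (2 * P / pi) ^ k * norm (fcoeff P (nderiv k \<psi>) m)"
      proof -
        have "fcoeff P (nderiv k \<psi>) m = (- of_real pi * \<i> * of_int m / of_real P) ^ k * fcoeff P \<psi> m"
          by (rule fcoeff_nderiv(1)[OF P \<psi>]) (rule zero)
        then have "norm (fcoeff P (nderiv k \<psi>) m) = (pi * \<bar>real_of_int m\<bar> / P) ^ k * norm (fcoeff P \<psi> m)"
          using P by (simp add: norm_mult norm_power norm_divide)
        then show ?thesis
          by (simp only: power_mult_distrib mult_ac)
      qed
      also have "\<dots> \<le> (2 * P / pi) ^ k * B"
        using B P by (intro mult_left_mono) auto
      finally show ?thesis using B0(1) by simp
    qed
  qed
qed

lemma summable_fcoeff:
  assumes P: "P > 0" and \<psi>: "\<psi> \<in> test_functions" and zero: "\<And>x. P \<le> \<bar>x\<bar> \<Longrightarrow> \<psi> x = 0"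
  shows "summable (\<lambda>n. two_sided (\<lambda>m. norm (fcoeff P \<psi> m) * (1 + \<bar>of_int m\<bar>) ^ k) n)"
proof -
  obtain D where D: "D \<ge> 0" "\<And>m. norm (fcoeff P \<psi> m) * (1 + \<bar>of_int m\<bar>) ^ (k + 2) \<le> D"
    using fcoeff_rapid_decay[OF assms] by blast
  have "summable (\<lambda>n. 2 * D * (1 / (real (Suc n))\<^sup>2))"
    using inverse_power_summable[of 2, where 'a = real] by (intro summable_mult, subst summable_Suc_iff) (simp add: field_simps)
  then show ?thesis
  proof (rule summable_comparison_test')
    fix n
    have *: "norm (fcoeff P \<psi> m) * (1 + \<bar>of_int m\<bar>) ^ k \<le> D * (1 / (real (Suc n))\<^sup>2)" if "\<bar>m\<bar> = int n" for m
    proof -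
      have "1 + \<bar>real_of_int m\<bar> = real (Suc n)"
        using that by (metis of_int_abs of_int_of_nat_eq of_nat_Suc)
      then show ?thesis
        using D(2)[of m] by (simp add: field_simps power_add power2_eq_square del: of_nat_Suc)
    qed
    have nn: "0 \<le> norm (fcoeff P \<psi> m) * (1 + \<bar>of_int m\<bar>) ^ k" for m
      by simp
    show "norm (two_sided (\<lambda>m. norm (fcoeff P \<psi> m) * (1 + \<bar>of_int m\<bar>) ^ k) n) \<le> 2 * D * (1 / (real (Suc n))\<^sup>2)"
      using D(1) *[of "int n"] *[of "- int n"] nn[of "int n"] nn[of "- int n"]
      by (auto simp: two_sided_def abs_of_nonneg add_nonneg_nonneg) 
  qed
qed

lemma norm_two_sided: "norm (two_sided g n :: 'a :: real_normed_vector) \<le> two_sided (\<lambda>m. norm (g m)) n"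
  by (simp add: two_sided_def norm_triangle_ineq)

lemma two_sided_mono: "(\<And>m. g m \<le> h m) \<Longrightarrow> two_sided g n \<le> (two_sided h n :: real)"
  by (simp add: two_sided_def add_mono)

text \<open>The Fourier series converges uniformly with all derivatives on the support of the cutoff, since
the coefficients decay rapidly.  Continuity of \<open>T\<close> allows termwise application, and \<open>T\<close> maps each
harmonic to a value of its Fourier transform on the real line.\<close>

lemma distribution_fourier_series:
  assumes T: "carried_in T R" and P: "R + 1 < P"
    and \<psi>: "\<psi> \<in> test_functions" and zero: "\<And>x. P \<le> \<bar>x\<bar> \<Longrightarrow> \<psi> x = 0"
  shows "(\<lambda>n. two_sided (\<lambda>m. fcoeff P \<psi> m * fourier T (of_real (of_int m / (2 * P)))) n) sums T \<psi>"
proof -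
  have R: "R > 0" and dT: "distribution T"
    using T by (auto simp: carried_in_def)
  have P0: "P > 0" using R P by simp
  define S where "S M x = (\<Sum>n<M. two_sided (\<lambda>m. fcoeff P \<psi> m * harmonic P m x) n)" for M x
  have S_eq: "S M = (\<lambda>x. \<Sum>n<M. two_sided (\<lambda>m. fcoeff P \<psi> m * harmonic P m x) n)" for M
    by (simp add: S_def[abs_def])
  have sm_h: "smooth (\<lambda>x. two_sided (\<lambda>m. fcoeff P \<psi> m * harmonic P m x) n)" for n
    by (cases "n = 0") (auto simp: two_sided_def harmonic_def intro!: smooth_add smooth_cmult smooth_wave)
  have nd_h: "nderiv k (\<lambda>x. two_sided (\<lambda>m. fcoeff P \<psi> m * harmonic P m x) n) x =
      two_sided (\<lambda>m. fcoeff P (nderiv k \<psi>) m * harmonic P m x) n" for k n x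
  proof -
    have h: "nderiv k (\<lambda>x. fcoeff P \<psi> m * harmonic P m x) x = fcoeff P (nderiv k \<psi>) m * harmonic P m x" for m
    proof -
      have "fcoeff P (nderiv k \<psi>) m = (- of_real pi * \<i> * of_int m / of_real P) ^ k * fcoeff P \<psi> m"
        by (rule fcoeff_nderiv(1)[OF P0 \<psi>]) (rule zero)
      then show ?thesis
        unfolding harmonic_def nderiv_cmult[OF smooth_wave] nderiv_wave by (simp add: mult.assoc)
    qed
    have sh: "smooth (\<lambda>x. fcoeff P \<psi> m * harmonic P m x)" for m
      unfolding harmonic_def by (intro smooth_cmult smooth_wave)
    show ?thesis
    proof (cases "n = 0")
      case False
      then show ?thesis
        by (simp only: two_sided_def if_False nderiv_add[OF sh sh] h)
    qed (simp only: two_sided_def simp_thms if_True h)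
  qed
  have smS: "smooth (S M)" for M
    unfolding S_eq by (rule smooth_sum[OF sm_h])
  have ndS: "nderiv k (S M) = (\<lambda>x. \<Sum>n<M. two_sided (\<lambda>m. fcoeff P (nderiv k \<psi>) m * harmonic P m x) n)" for k M
    unfolding S_eq nderiv_sum[OF sm_h] nd_h ..
  have \<rho>: "cutoff R \<in> test_functions"
    using R by (intro cutoff_test) simp
  have supp: "supp (cutoff R) \<subseteq> {-P<..<P}"
  proof -
    have "supp (cutoff R) \<subseteq> {- (R + 1)..R + 1}"
      by (rule supp_subset_closed) (use R in \<open>auto intro!: cutoff_eq_0 simp: abs_if\<close>)
    then show ?thesis using P by auto
  qed
  have "(\<lambda>M. T (\<lambda>x. cutoff R x * (\<psi> x - S M x))) \<longlonglongrightarrow> 0"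
  proof (rule distribution_tendsto_0[OF dT \<rho>])
    show "smooth (\<lambda>x. \<psi> x - S M x)" for M
      by (intro smooth_diff test_smooth \<psi> smS)
    fix k
    have \<psi>k: "nderiv k \<psi> \<in> test_functions"
      by (rule nderiv_test[OF \<psi>])
    have "uniform_limit {-P<..<P} (nderiv k \<circ> S)
        (\<lambda>x. \<Sum>n. two_sided (\<lambda>m. fcoeff P (nderiv k \<psi>) m * harmonic P m x) n) sequentially"
      unfolding o_def ndS
    proof (rule Weierstrass_m_test)
      show "summable (\<lambda>n. two_sided (\<lambda>m. norm (fcoeff P (nderiv k \<psi>) m) * (1 + \<bar>of_int m\<bar>) ^ 0) n)"
        by (rule summable_fcoeff[OF P0 \<psi>k fcoeff_nderiv(2)[OF P0 \<psi> zero]])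
      show "norm (two_sided (\<lambda>m. fcoeff P (nderiv k \<psi>) m * harmonic P m x) n) \<le>
          two_sided (\<lambda>m. norm (fcoeff P (nderiv k \<psi>) m) * (1 + \<bar>of_int m\<bar>) ^ 0) n" for n x
        using norm_two_sided[of "\<lambda>m. fcoeff P (nderiv k \<psi>) m * harmonic P m x" n] by (simp add: norm_mult)
    qed
    moreover have "(\<Sum>n. two_sided (\<lambda>m. fcoeff P (nderiv k \<psi>) m * harmonic P m x) n) = nderiv k \<psi> x"
      if "x \<in> {-P<..<P}" for x
      by (rule sums_unique[symmetric], rule fourier_series_pointwise[OF P0 _ smooth_has_vector_derivative[OF test_smooth[OF \<psi>]]])
        (use that in \<open>auto intro: continuous_on_nderiv test_smooth[OF \<psi>]\<close>)
    ultimately have "uniform_limit {-P<..<P} (\<lambda>M. nderiv k (S M)) (nderiv k \<psi>) sequentially"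
      by (subst (asm) uniform_limit_cong'[where g = "\<lambda>M. nderiv k (S M)" and i = "nderiv k \<psi>"]) (auto simp: o_def)
    then have "uniform_limit (supp (cutoff R)) (\<lambda>M. nderiv k (S M)) (nderiv k \<psi>) sequentially"
      by (rule uniform_limit_on_subset[OF _ supp])
    then have "uniform_limit (supp (cutoff R)) (\<lambda>M x. nderiv k \<psi> x - nderiv k (S M) x) (\<lambda>x. nderiv k \<psi> x - nderiv k \<psi> x) sequentially"
      by (intro uniform_limit_intros)
    then show "uniform_limit (supp (cutoff R)) (\<lambda>M. nderiv k (\<lambda>x. \<psi> x - S M x)) (\<lambda>_. 0) sequentially"
      by (simp add: nderiv_diff[OF test_smooth[OF \<psi>] smS])
  qed
  moreover have "T (\<lambda>x. cutoff R x * (\<psi> x - S M x)) =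
      T \<psi> - (\<Sum>n<M. two_sided (\<lambda>m. fcoeff P \<psi> m * fourier T (of_real (of_int m / (2 * P)))) n)" for M
  proof -
    have t: "(\<lambda>x. cutoff R x * f x) \<in> test_functions" if "smooth f" for f
      by (rule test_mult[OF \<rho> that])
    have h: "T (\<lambda>x. cutoff R x * two_sided (\<lambda>m. fcoeff P \<psi> m * harmonic P m x) n) =
        two_sided (\<lambda>m. fcoeff P \<psi> m * fourier T (of_real (of_int m / (2 * P)))) n" for n
    proof -
      have eq: "T (\<lambda>x. fcoeff P \<psi> m * (cutoff R x * harmonic P m x)) =
          fcoeff P \<psi> m * fourier T (of_real (of_int m / (2 * P)))" for m
        unfolding fourier_eq[OF T] harmonic_def by (rule distribution_cmult[OF dT t[OF smooth_wave]])
      have tt: "(\<lambda>x. fcoeff P \<psi> m * (cutoff R x * harmonic P m x)) \<in> test_functions" for m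
        unfolding harmonic_def by (rule test_cmult[OF t[OF smooth_wave]])
      show ?thesis
      proof (cases "n = 0")
        case True
        then show ?thesis using eq[of 0] by (simp add: two_sided_def mult_ac)
      next
        case False
        have "(\<lambda>x. cutoff R x * two_sided (\<lambda>m. fcoeff P \<psi> m * harmonic P m x) n) =
            (\<lambda>x. fcoeff P \<psi> (int n) * (cutoff R x * harmonic P (int n) x) +
              fcoeff P \<psi> (- int n) * (cutoff R x * harmonic P (- int n) x))"
          using False by (simp add: two_sided_def distrib_left mult_ac)
        then show ?thesis
          using False by (simp only: distribution_add[OF dT tt tt] eq two_sided_def if_False)
      qed
    qed
    have "(\<lambda>x. cutoff R x * (\<psi> x - S M x)) = (\<lambda>x. cutoff R x * \<psi> x -
        (\<Sum>n<M. cutoff R x * two_sided (\<lambda>m. fcoeff P \<psi> m * harmonic P m x) n))"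
      by (simp add: S_def right_diff_distrib sum_distrib_left)
    then have "T (\<lambda>x. cutoff R x * (\<psi> x - S M x)) = T (\<lambda>x. cutoff R x * \<psi> x) -
        (\<Sum>n<M. two_sided (\<lambda>m. fcoeff P \<psi> m * fourier T (of_real (of_int m / (2 * P)))) n)"
      by (simp only: distribution_diff[OF dT t[OF test_smooth[OF \<psi>]] test_sum[OF finite_lessThan t[OF sm_h]]]
          distribution_sum[OF dT finite_lessThan t[OF sm_h]] h)
    moreover have "T (\<lambda>x. cutoff R x * \<psi> x) = T \<psi>"
      by (rule carried_in_local[OF T t[OF test_smooth[OF \<psi>]] \<psi>]) (simp add: cutoff_eq_1)
    ultimately show ?thesis by simp
  qed
  ultimately have "(\<lambda>M. T \<psi> - (\<Sum>n<M. two_sided (\<lambda>m. fcoeff P \<psi> m * fourier T (of_real (of_int m / (2 * P)))) n)) \<longlonglongrightarrow> 0"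
    by simp
  from tendsto_diff[OF tendsto_const[of "T \<psi>"] this] show ?thesis
    unfolding sums_def by simp
qed

section \<open>Infinite products of bounded trigonometric polynomials\<close>

text \<open>A chord is shorter than its arc.\<close>

lemma norm_wave_minus_1_le: "norm (wave (of_nat m) y - 1) \<le> 2 * pi * m * \<bar>y\<bar>"
proof -
  have "wave (of_nat m) y = exp (\<i> * of_real (- 2 * pi * m * y))"
    by (simp add: wave_def mult_ac)
  then have "norm (wave (of_nat m) y - 1) = 2 * \<bar>sin (pi * m * y)\<bar>"
    using dist_exp_i_1[of "- 2 * pi * m * y"] by (simp add: dist_norm mult_ac)
  also have "\<dots> \<le> 2 * \<bar>pi * m * y\<bar>"
    using abs_sin_x_le_abs_x[of "pi * m * y"] by simp
  finally show ?thesis by (simp add: abs_mult)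
qed

text \<open>The coefficients of a trigonometric polynomial are its Fourier coefficients over one period.\<close>

lemma trig_poly_coeff_bound:
  fixes c :: "nat \<Rightarrow> complex"
  assumes "\<And>y. norm (\<Sum>m\<le>N. c m * wave (of_nat m) y) \<le> C" and "k \<le> N"
  shows "norm (c k) \<le> C"
proof -
  let ?f = "\<lambda>y. \<Sum>m\<le>N. c m * wave (of_nat m) y" and ?I = "{-(1/2)..1/2 :: real}"
  have h: "harmonic (1/2) (int m) = wave (of_nat m)" for m
    by (simp add: harmonic_def)
  have int: "(\<lambda>y. c m * wave (of_nat m) y * harmonic (1/2) (- int k) y) integrable_on ?I" for m
    by (intro integrable_continuous_interval continuous_on_mult continuous_on_const continuous_on_harmonic
        continuous_on_smooth smooth_wave)
  have "integral ?I (\<lambda>y. ?f y * harmonic (1/2) (- int k) y) =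
      (\<Sum>m\<le>N. integral ?I (\<lambda>y. c m * wave (of_nat m) y * harmonic (1/2) (- int k) y))"
    unfolding sum_distrib_right by (rule integral_sum) (use int in auto)
  also have "\<dots> = (\<Sum>m\<le>N. if m = k then c m else 0)"
  proof (rule sum.cong[OF refl])
    fix m
    have "integral ?I (\<lambda>y. c m * wave (of_nat m) y * harmonic (1/2) (- int k) y) =
        c m * integral ?I (harmonic (1/2) (int m + - int k))"
      unfolding h[symmetric] mult.assoc harmonic_mult by simp
    also have "\<dots> = (if m = k then c m else 0)"
      using integral_harmonic[of "1/2" "int m + - int k"] by auto
    finally show "integral ?I (\<lambda>y. c m * wave (of_nat m) y * harmonic (1/2) (- int k) y) = (if m = k then c m else 0)" .
  qed
  also have "\<dots> = c k"
    using \<open>k \<le> N\<close> by simp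
  finally have "c k = integral ?I (\<lambda>y. ?f y * harmonic (1/2) (- int k) y)" ..
  also have "norm \<dots> \<le> C * (1/2 - (- (1/2)))"
  proof (rule integral_bound)
    show "continuous_on ?I (\<lambda>y. ?f y * harmonic (1/2) (- int k) y)"
      by (intro continuous_on_mult continuous_on_sum continuous_on_const continuous_on_harmonic
          continuous_on_smooth[OF smooth_wave])
  qed (use assms in \<open>simp_all add: norm_mult\<close>)
  finally show ?thesis by simp
qed

text \<open>The factors of the infinite product, given by their coefficients; index 0 is left free because the
product starts with the factor of number 1.\<close>

locale bounded_masks =
  fixes N :: nat and b :: "nat \<Rightarrow> nat \<Rightarrow> complex" and C :: real
  assumes bounded: "\<And>j y. j \<ge> 1 \<Longrightarrow> norm (\<Sum>m\<le>N. b j m * wave (of_nat m) y) \<le> C"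
    and normalised: "\<And>j. j \<ge> 1 \<Longrightarrow> (\<Sum>m\<le>N. b j m) = 1"
begin

definition mask :: "nat \<Rightarrow> real \<Rightarrow> complex" where
  "mask j y = (\<Sum>m\<le>N. b j m * wave (of_nat m) y)"

definition mask_prod :: "nat \<Rightarrow> nat \<Rightarrow> real \<Rightarrow> complex" where
  "mask_prod n k y = (\<Prod>j<k. mask (n + j + 1) (y / 2 ^ (n + j + 1)))"

lemma C_ge_1: "C \<ge> 1"
  using bounded[of 1 0] normalised[of 1] by (simp add: wave_def)

lemma mask_lipschitz: "\<exists>L\<ge>0. \<forall>j\<ge>1. \<forall>y. norm (mask j y) \<le> 1 + L * \<bar>y\<bar>"
proof (intro exI conjI allI impI)
  let ?L = "(\<Sum>m\<le>N. C * (2 * pi * m))"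
  show "0 \<le> ?L"
    using C_ge_1 by (intro sum_nonneg) auto
  fix j y assume j: "j \<ge> (1 :: nat)"
  have "mask j y - 1 = (\<Sum>m\<le>N. b j m * (wave (of_nat m) y - 1))"
    by (simp add: mask_def sum_subtractf right_diff_distrib normalised[OF j])
  also have "norm \<dots> \<le> (\<Sum>m\<le>N. C * (2 * pi * m * \<bar>y\<bar>))"
    unfolding norm_mult
  proof (intro sum_norm_le, unfold norm_mult, intro mult_mono norm_wave_minus_1_le)
    show "norm (b j m) \<le> C" if "m \<in> {..N}" for m
      using trig_poly_coeff_bound[where N = N and c = "b j", OF bounded[OF j]] that by simp
  qed (use C_ge_1 in auto)
  also have "\<dots> = ?L * \<bar>y\<bar>"
    unfolding sum_distrib_right by (simp only: mult.assoc)
  finally show "norm (mask j y) \<le> 1 + ?L * \<bar>y\<bar>"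
    using norm_triangle_ineq[of "mask j y - 1" 1] by simp
qed

text \<open>Let \<open>2 ^ q\<close> be the least power of two not below \<open>1 + \<bar>y\<bar>\<close>.  The first \<open>q\<close> factors are bounded by
\<open>C\<close>, which contributes at most a fixed power of \<open>2 ^ q\<close>; the later factors are evaluated close to
the origin and their product stays bounded by the uniform Lipschitz condition.\<close>

lemma mask_prod_bound: "\<exists>A s. A \<ge> 0 \<and> (\<forall>n k y. norm (mask_prod n k y) \<le> A * (1 + \<bar>y\<bar>) ^ s)"
proof -
  obtain L where L: "L \<ge> 0" "\<And>j y. j \<ge> 1 \<Longrightarrow> norm (mask j y) \<le> 1 + L * \<bar>y\<bar>"
    using mask_lipschitz by blast
  obtain s where s: "C \<le> 2 ^ s"
    using real_arch_pow[of 2 C] by (auto intro: less_imp_le)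
  have "norm (mask_prod n k y) \<le> (exp L * 2 ^ s) * (1 + \<bar>y\<bar>) ^ s" for n k y
  proof -
    obtain q where q: "1 + \<bar>y\<bar> \<le> 2 ^ q" "2 ^ q \<le> 2 * (1 + \<bar>y\<bar>)"
    proof -
      define q where "q = (LEAST q. 1 + \<bar>y\<bar> \<le> 2 ^ q)"
      obtain q0 where "1 + \<bar>y\<bar> < 2 ^ q0"
        using real_arch_pow[of 2 "1 + \<bar>y\<bar>"] by auto
      then have 1: "1 + \<bar>y\<bar> \<le> 2 ^ q"
        unfolding q_def by (intro LeastI[of "\<lambda>q. 1 + \<bar>y\<bar> \<le> 2 ^ q" q0] less_imp_le)
      have "2 ^ q \<le> 2 * (1 + \<bar>y\<bar>)"
      proof (cases q)
        case (Suc p)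
        then have "\<not> 1 + \<bar>y\<bar> \<le> 2 ^ p"
          unfolding q_def using not_less_Least lessI by metis
        then show ?thesis by (simp add: Suc)
      qed simp
      with 1 that show thesis by blast
    qed
    define D where "D i = (if i \<le> q then C else exp (L * 2 ^ q / 2 ^ i))" for i :: nat
    have D1: "1 \<le> D i" for i
      using C_ge_1 L(1) by (simp add: D_def)
    have fac: "norm (mask i (y / 2 ^ i)) \<le> D i" if "i \<ge> 1" for i
    proof (cases "i \<le> q")
      case True
      then show ?thesis using bounded[OF that, of "y / 2 ^ i"] by (simp add: D_def mask_def)
    next
      case False
      have "norm (mask i (y / 2 ^ i)) \<le> 1 + L * (\<bar>y\<bar> / 2 ^ i)"
        using L(2)[OF that, of "y / 2 ^ i"] by simp
      also have "\<dots> \<le> 1 + L * (2 ^ q / 2 ^ i)"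
        using L(1) q(1) by (intro add_mono mult_left_mono divide_right_mono) auto
      also have "\<dots> \<le> exp (L * (2 ^ q / 2 ^ i))"
        by (rule exp_ge_add_one_self)
      finally show ?thesis using False by (simp add: D_def)
    qed
    have "norm (mask_prod n k y) \<le> (\<Prod>j<k. D (n + j + 1))"
      unfolding mask_prod_def prod_norm[symmetric] by (intro prod_mono conjI norm_ge_zero fac) simp
    also have "\<dots> = prod D ((\<lambda>j. n + j + 1) ` {..<k})"
      by (subst prod.reindex) (auto simp: inj_on_def)
    also have "\<dots> \<le> prod D {1..q + (n + k)}"
      by (rule prod_mono2) (use D1 in \<open>auto intro: order_trans[OF zero_le_one]\<close>)
    also have "\<dots> \<le> C ^ q * exp (L * (1 - 1 / 2 ^ (n + k)))"
    proof (induction "n + k" arbitrary: n k)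
      case 0
      have "prod D {1..q} = prod (\<lambda>_. C) {1..q}"
        by (rule prod.cong) (auto simp: D_def)
      with 0 show ?case by simp
    next
      case (Suc t)
      have "prod D {1..q + t} \<le> C ^ q * exp (L * (1 - 1 / 2 ^ t))"
        using Suc(1)[of t 0] by simp
      moreover have "D (Suc (q + t)) = exp (L * (1 / 2 ^ Suc t))"
        by (simp add: D_def power_add field_simps)
      moreover have "prod D {1..q + Suc t} = prod D {1..q + t} * D (Suc (q + t))"
        by simp
      ultimately have "prod D {1..q + Suc t} \<le> C ^ q * exp (L * (1 - 1 / 2 ^ t)) * exp (L * (1 / 2 ^ Suc t))"
        by (simp add: mult_right_mono)
      also have "\<dots> = C ^ q * exp (L * (1 - 1 / 2 ^ Suc t))"
        unfolding mult.assoc exp_add[symmetric] distrib_left[symmetric] by (simp add: field_simps)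
      finally show ?case using Suc(2) by simp
    qed
    also have "\<dots> \<le> (2 ^ q) ^ s * exp L"
    proof (intro mult_mono)
      have "C ^ q \<le> (2 ^ s) ^ q"
        using s C_ge_1 by (intro power_mono) auto
      then show "C ^ q \<le> (2 ^ q) ^ s"
        by (simp add: power_mult[symmetric] mult.commute)
      show "exp (L * (1 - 1 / 2 ^ (n + k))) \<le> exp L"
        using mult_left_mono[OF _ L(1), of "1 - 1 / 2 ^ (n + k)" 1] by simp
    qed auto
    also have "\<dots> \<le> (2 * (1 + \<bar>y\<bar>)) ^ s * exp L"
      using q(2) by (intro mult_right_mono power_mono) auto
    finally show ?thesis
      by (simp only: power_mult_distrib mult_ac)
  qed
  then show ?thesis
    by (intro exI[of _ "exp L * 2 ^ s"] exI[of _ s]) auto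
qed

end

section \<open>The cascade of discrete measures\<close>

context bounded_masks
begin

definition apply_mask :: "nat \<Rightarrow> (real \<Rightarrow> complex) \<Rightarrow> real \<Rightarrow> complex" where
  "apply_mask j \<psi> x = (\<Sum>m\<le>N. b j m * \<psi> (x + real m / 2 ^ j))"

text \<open>The value at \<open>x\<close> is the pairing of \<open>\<lambda>t. \<psi> (t + x)\<close> with the convolution of the discrete measures of
the masks with numbers \<open>n + 1\<close> to \<open>n + k\<close>, that is, with the measure whose Fourier transform is
\<open>mask_prod n k\<close>.\<close>

primrec cascade :: "nat \<Rightarrow> nat \<Rightarrow> (real \<Rightarrow> complex) \<Rightarrow> real \<Rightarrow> complex" where
  "cascade n 0 \<psi> = \<psi>"
| "cascade n (Suc k) \<psi> = cascade n k (apply_mask (n + k + 1) \<psi>)"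

lemma cascade_append: "cascade 0 (n + k) \<psi> = cascade 0 n (cascade n k \<psi>)"
  by (induction k arbitrary: \<psi>) simp_all

lemma sum_double_index:
  fixes w v :: "nat \<Rightarrow> complex"
  shows "(\<Sum>r\<le>R. w r * (\<Sum>m\<le>N. v m * g (2 * r + m))) =
    (\<Sum>s\<le>2 * R + N. (\<Sum>(r, m) \<in> {x \<in> {..R} \<times> {..N}. 2 * fst x + snd x = s}. w r * v m) * g s)"
proof -
  have "(\<Sum>r\<le>R. w r * (\<Sum>m\<le>N. v m * g (2 * r + m))) =
      (\<Sum>x\<in>{..R} \<times> {..N}. w (fst x) * v (snd x) * g (2 * fst x + snd x))"
    by (simp add: sum_distrib_left sum.cartesian_product case_prod_beta mult_ac)
  also have "\<dots> = (\<Sum>s\<le>2 * R + N. \<Sum>x\<in>{x \<in> {..R} \<times> {..N}. 2 * fst x + snd x = s}.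
      w (fst x) * v (snd x) * g (2 * fst x + snd x))"
    by (rule sum.group[symmetric]) (auto intro: add_mono)
  also have "\<dots> = (\<Sum>s\<le>2 * R + N. (\<Sum>(r, m) \<in> {x \<in> {..R} \<times> {..N}. 2 * fst x + snd x = s}. w r * v m) * g s)"
    by (intro sum.cong refl) (auto simp: sum_distrib_right case_prod_beta intro!: sum.cong)
  finally show ?thesis .
qed

text \<open>The measure is supported on the points \<open>r / 2 ^ (n + k)\<close> with \<open>r \<le> N * (2 ^ k - 1)\<close>.  None of these points
exceeds \<open>N / 2 ^ n\<close>, whatever \<open>k\<close> is.\<close>

lemma cascade_weights:
  "\<exists>w. \<forall>\<psi> x. cascade n k \<psi> x = (\<Sum>r\<le>N * (2 ^ k - 1). w r * \<psi> (x + real r / 2 ^ (n + k)))"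
proof (induction k)
  case 0
  show ?case by (intro exI[of _ "\<lambda>_. 1"]) simp
next
  case (Suc k)
  let ?R = "N * (2 ^ k - 1)"
  obtain w where w: "\<And>\<psi> x. cascade n k \<psi> x = (\<Sum>r\<le>?R. w r * \<psi> (x + real r / 2 ^ (n + k)))"
    using Suc by blast
  let ?w' = "\<lambda>s. \<Sum>(r, m) \<in> {x \<in> {..?R} \<times> {..N}. 2 * fst x + snd x = s}. w r * b (n + k + 1) m"
  have "cascade n (Suc k) \<psi> x = (\<Sum>s\<le>2 * ?R + N. ?w' s * \<psi> (x + real s / 2 ^ (n + Suc k)))" for \<psi> x
  proof -
    have pos: "x + real r / 2 ^ (n + k) + real m / 2 ^ (n + k + 1) = x + real (2 * r + m) / 2 ^ (n + Suc k)" for r m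
      by (simp add: field_simps)
    have "cascade n (Suc k) \<psi> x =
        (\<Sum>r\<le>?R. w r * (\<Sum>m\<le>N. b (n + k + 1) m * \<psi> (x + real (2 * r + m) / 2 ^ (n + Suc k))))"
      unfolding cascade.simps w apply_mask_def pos ..
    also have "\<dots> = (\<Sum>s\<le>2 * ?R + N. ?w' s * \<psi> (x + real s / 2 ^ (n + Suc k)))"
      by (rule sum_double_index[where g = "\<lambda>s. \<psi> (x + real s / 2 ^ (n + Suc k))"])
    finally show ?thesis .
  qed
  moreover have "2 * ?R + N = N * (2 ^ Suc k - 1)"
  proof -
    have "(2 :: nat) ^ k \<ge> 1" by simp
    then obtain t where "(2 :: nat) ^ k = Suc t" by (metis Suc_le_D One_nat_def)
    then show ?thesis by simp
  qed
  ultimately show ?case by (intro exI[of _ ?w']) simp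
qed

lemma cascade_cong_shift: "cascade n k (\<lambda>t. \<psi> (t + s)) x = cascade n k \<psi> (x + s)"
proof -
  obtain w where "\<And>\<psi> x. cascade n k \<psi> x = (\<Sum>r\<le>N * (2 ^ k - 1). w r * \<psi> (x + real r / 2 ^ (n + k)))"
    using cascade_weights by metis
  then show ?thesis by (simp add: add_ac)
qed

lemma cascade_support:
  assumes zero: "\<And>x. x \<notin> {u<..<v} \<Longrightarrow> \<psi> x = 0" and x: "x \<le> u - N / 2 ^ n \<or> v \<le> x"
  shows "cascade n k \<psi> x = 0"
proof -
  obtain w where w: "\<And>\<psi> x. cascade n k \<psi> x = (\<Sum>r\<le>N * (2 ^ k - 1). w r * \<psi> (x + real r / 2 ^ (n + k)))"
    using cascade_weights by metis
  have "\<psi> (x + real r / 2 ^ (n + k)) = 0" if "r \<le> N * (2 ^ k - 1)" for r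
  proof (rule zero)
    have "r \<le> N * 2 ^ k"
      using that by (rule order_trans) simp
    then have "real r \<le> N * 2 ^ k"
      by (metis of_nat_le_iff of_nat_mult of_nat_numeral of_nat_power)
    then have "real r / 2 ^ (n + k) \<le> N / 2 ^ n"
      by (simp add: power_add field_simps)
    moreover have "real r / 2 ^ (n + k) \<ge> 0" by simp
    ultimately show "x + real r / 2 ^ (n + k) \<notin> {u<..<v}"
      using x unfolding greaterThanLessThan_iff by linarith
  qed
  then show ?thesis by (simp add: w)
qed

lemma cascade_cmult: "cascade n k (\<lambda>t. c * \<psi> t) x = c * cascade n k \<psi> x"
proof -
  obtain w where "\<And>\<psi> x. cascade n k \<psi> x = (\<Sum>r\<le>N * (2 ^ k - 1). w r * \<psi> (x + real r / 2 ^ (n + k)))"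
    using cascade_weights by metis
  then show ?thesis by (simp add: sum_distrib_left mult_ac)
qed

lemma cascade_wave: "cascade n k (wave (of_real y)) x = mask_prod n k y * wave (of_real y) x"
proof (induction k arbitrary: x)
  case (Suc k)
  have "apply_mask (n + k + 1) (wave (of_real y)) = (\<lambda>x. mask (n + k + 1) (y / 2 ^ (n + k + 1)) * wave (of_real y) x)"
  proof
    fix x
    have "wave (of_real y) (real m / 2 ^ (n + k + 1)) = wave (of_nat m) (y / 2 ^ (n + k + 1))" for m
      by (simp add: wave_def mult_ac)
    then show "apply_mask (n + k + 1) (wave (of_real y)) x =
        mask (n + k + 1) (y / 2 ^ (n + k + 1)) * wave (of_real y) x"
      by (simp only: apply_mask_def mask_def wave_add sum_distrib_right mult.assoc mult.commute[of "wave (of_real y) x"])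
  qed
  note eq = this
  show ?case
    unfolding cascade.simps eq cascade_cmult Suc.IH mask_prod_def prod.lessThan_Suc by (simp only: mult_ac)
qed (simp add: mask_prod_def)

lemma cascade_fourier_series:
  assumes P: "real N < P" and \<psi>: "\<psi> \<in> test_functions"
  shows "(\<lambda>i. two_sided (\<lambda>m. fcoeff P \<psi> m * mask_prod n k (of_int m / (2 * P))) i) sums cascade n k \<psi> 0"
proof -
  have P0: "P > 0" using P by linarith
  let ?R = "N * (2 ^ k - 1)"
  obtain w where w: "\<And>\<psi> x. cascade n k \<psi> x = (\<Sum>r\<le>?R. w r * \<psi> (x + real r / 2 ^ (n + k)))"
    using cascade_weights by metis
  have "(\<lambda>i. \<Sum>r\<le>?R. w r * two_sided (\<lambda>m. fcoeff P \<psi> m * harmonic P m (real r / 2 ^ (n + k))) i) sums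
      (\<Sum>r\<le>?R. w r * \<psi> (real r / 2 ^ (n + k)))"
  proof (intro sums_sum sums_mult fourier_series_pointwise[OF P0])
    fix r assume "r \<in> {..?R}"
    then have "r \<le> N * 2 ^ k"
      by (auto intro: order_trans)
    then have "real r \<le> N * 2 ^ k"
      by (metis of_nat_le_iff of_nat_mult of_nat_numeral of_nat_power)
    then have "real r / 2 ^ (n + k) \<le> N / 2 ^ n"
      by (simp add: power_add field_simps)
    also have "\<dots> \<le> N"
      by (simp add: divide_le_eq mult_le_cancel_left1)
    finally show "real r / 2 ^ (n + k) < P" using P by linarith
    have "0 \<le> real r / 2 ^ (n + k)" by simp
    then show "- P < real r / 2 ^ (n + k)" using P0 by linarith
    show "(\<psi> has_vector_derivative nderiv 1 \<psi> (real r / 2 ^ (n + k))) (at (real r / 2 ^ (n + k)))"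
      using smooth_has_vector_derivative[OF test_smooth[OF \<psi>], of 0] by simp
  qed (rule continuous_on_smooth[OF test_smooth[OF \<psi>]])
  moreover have "(\<Sum>r\<le>?R. w r * two_sided (\<lambda>m. fcoeff P \<psi> m * harmonic P m (real r / 2 ^ (n + k))) i) =
      two_sided (\<lambda>m. fcoeff P \<psi> m * mask_prod n k (of_int m / (2 * P))) i" for i
  proof -
    have "mask_prod n k (of_int m / (2 * P)) = (\<Sum>r\<le>?R. w r * harmonic P m (real r / 2 ^ (n + k)))" for m
      using cascade_wave[of n k "of_int m / (2 * P)" 0] by (simp only: w harmonic_def) (simp add: wave_def)
    then show ?thesis
      by (simp add: two_sided_def sum_distrib_left distrib_left sum.distrib mult_ac)
  qed
  ultimately show ?thesis
    using w by simp
qed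

text \<open>Both sides are evaluated through the Fourier series of \<open>\<psi>\<close>.  The partial products converge
pointwise and grow at most polynomially, uniformly in \<open>k\<close>, whereas the Fourier coefficients of \<open>\<psi>\<close>
decay rapidly, so that the limit may be taken inside the series.\<close>

lemma cascade_tendsto:
  assumes P: "real N < P" "P \<ge> 1" and \<psi>: "\<psi> \<in> test_functions" and zero: "\<And>x. P \<le> \<bar>x\<bar> \<Longrightarrow> \<psi> x = 0"
    and lim: "\<And>y. (\<lambda>k. mask_prod n k y) \<longlonglongrightarrow> F y"
  shows "(\<lambda>k. cascade n k \<psi> 0) \<longlonglongrightarrow> (\<Sum>i. two_sided (\<lambda>m. fcoeff P \<psi> m * F (of_int m / (2 * P))) i)"
proof -
  obtain A s where A: "A \<ge> 0" "\<And>n k y. norm (mask_prod n k y) \<le> A * (1 + \<bar>y\<bar>) ^ s"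
    using mask_prod_bound by metis
  have P0: "P > 0" using P by simp
  define a where "a i k = two_sided (\<lambda>m. fcoeff P \<psi> m * mask_prod n k (of_int m / (2 * P))) i" for i k
  define B where "B i = A * two_sided (\<lambda>m. norm (fcoeff P \<psi> m) * (1 + \<bar>of_int m\<bar>) ^ s) i" for i
  have "summable (\<lambda>i. two_sided (\<lambda>m. norm (fcoeff P \<psi> m) * (1 + \<bar>of_int m\<bar>) ^ s) i)"
    by (rule summable_fcoeff[OF P0 \<psi>]) (rule zero)
  then have sumB: "summable B"
    unfolding B_def by (rule summable_mult)
  have bound: "norm (a i k) \<le> B i" for i k
  proof -
    have "norm (a i k) \<le> two_sided (\<lambda>m. norm (fcoeff P \<psi> m * mask_prod n k (of_int m / (2 * P)))) i"
      unfolding a_def by (rule norm_two_sided)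
    also have "\<dots> \<le> two_sided (\<lambda>m. A * (norm (fcoeff P \<psi> m) * (1 + \<bar>of_int m\<bar>) ^ s)) i"
    proof (rule two_sided_mono)
      fix m
      have "\<bar>of_int m / (2 * P)\<bar> \<le> \<bar>real_of_int m\<bar> / 1"
        unfolding abs_divide using P by (intro divide_left_mono) auto
      then have "norm (mask_prod n k (of_int m / (2 * P))) \<le> A * (1 + \<bar>of_int m\<bar>) ^ s"
        by (intro order_trans[OF A(2)] mult_left_mono power_mono A(1)) auto
      then have "norm (fcoeff P \<psi> m) * norm (mask_prod n k (of_int m / (2 * P))) \<le>
          norm (fcoeff P \<psi> m) * (A * (1 + \<bar>of_int m\<bar>) ^ s)"
        by (rule mult_left_mono) simp
      then show "norm (fcoeff P \<psi> m * mask_prod n k (of_int m / (2 * P))) \<le> A * (norm (fcoeff P \<psi> m) * (1 + \<bar>of_int m\<bar>) ^ s)"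
        unfolding norm_mult by (simp only: mult_ac)
    qed
    also have "\<dots> = B i"
      by (simp add: B_def two_sided_def distrib_left)
    finally show ?thesis .
  qed
  have "(\<lambda>k. \<Sum>i. a i k) \<longlonglongrightarrow> (\<Sum>i. two_sided (\<lambda>m. fcoeff P \<psi> m * F (of_int m / (2 * P))) i)"
  proof (rule tannerys_theorem[THEN conjunct2, THEN conjunct2, OF _ _ sumB])
    show "(\<lambda>k. a i k) \<longlonglongrightarrow> two_sided (\<lambda>m. fcoeff P \<psi> m * F (of_int m / (2 * P))) i" for i
      unfolding a_def two_sided_def by (cases "i = 0") (auto intro!: tendsto_intros lim)
    show "\<forall>\<^sub>F (i, k) in at_top \<times>\<^sub>F sequentially. norm (a i k) \<le> B i"
      using bound by (intro always_eventually) auto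
  qed simp
  moreover have "(\<Sum>i. a i k) = cascade n k \<psi> 0" for k
    unfolding a_def by (rule sums_unique[symmetric, OF cascade_fourier_series[OF P(1) \<psi>]])
  ultimately show ?thesis by simp
qed

lemma cascade_convergent:
  assumes \<psi>: "\<psi> \<in> test_functions" and conv: "\<And>y. convergent (\<lambda>k. mask_prod n k y)"
  shows "convergent (\<lambda>k. cascade n k \<psi> x)"
proof -
  have t: "(\<lambda>t. \<psi> (t + x)) \<in> test_functions"
    by (rule test_shift[OF \<psi>])
  then obtain R where R: "\<And>t. R \<le> \<bar>t\<bar> \<Longrightarrow> \<psi> (t + x) = 0"
    by (rule test_functionsE) blast
  have "(\<lambda>k. cascade n k (\<lambda>t. \<psi> (t + x)) 0) \<longlonglongrightarrow>
    (\<Sum>i. two_sided (\<lambda>m. fcoeff (max R (real N + 1)) (\<lambda>t. \<psi> (t + x)) m * lim (\<lambda>k. mask_prod n k (of_int m / (2 * max R (real N + 1))))) i)"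
    by (rule cascade_tendsto[OF _ _ t]) (use R conv in \<open>auto simp: convergent_LIMSEQ_iff\<close>)
  then show ?thesis
    unfolding cascade_cong_shift by (auto simp: convergent_def)
qed

lemma cascade_tendsto_distribution:
  assumes T: "carried_in T R" and \<psi>: "\<psi> \<in> test_functions"
    and lim: "\<And>y. (\<lambda>k. mask_prod 0 k y) \<longlonglongrightarrow> fourier T (of_real y)"
  shows "(\<lambda>k. cascade 0 k \<psi> x) \<longlonglongrightarrow> T (\<lambda>t. \<psi> (t + x))"
proof -
  have t: "(\<lambda>t. \<psi> (t + x)) \<in> test_functions"
    by (rule test_shift[OF \<psi>])
  then obtain R' where R': "\<And>t. R' \<le> \<bar>t\<bar> \<Longrightarrow> \<psi> (t + x) = 0"
    by (rule test_functionsE) blast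
  define P where "P = Max {R', real N + 1, R + 2}"
  have P: "R' \<le> P" "real N + 1 \<le> P" "R + 2 \<le> P"
    by (simp_all add: P_def)
  have "(\<lambda>k. cascade 0 k (\<lambda>t. \<psi> (t + x)) 0) \<longlonglongrightarrow>
    (\<Sum>i. two_sided (\<lambda>m. fcoeff P (\<lambda>t. \<psi> (t + x)) m * fourier T (of_real (of_int m / (2 * P)))) i)"
    by (rule cascade_tendsto[where F = "\<lambda>y. fourier T (of_real y)", OF _ _ t _ lim]) (use R' P in auto)
  also have "(\<Sum>i. two_sided (\<lambda>m. fcoeff P (\<lambda>t. \<psi> (t + x)) m * fourier T (of_real (of_int m / (2 * P)))) i) = T (\<lambda>t. \<psi> (t + x))"
    by (rule sums_unique[symmetric, OF distribution_fourier_series[OF T _ t]]) (use R' P in auto)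
  finally show ?thesis
    unfolding cascade_cong_shift by simp
qed

end

section \<open>Few analytic functions in a shift-invariant space\<close>

text \<open>Gaussian elimination, one equation at a time.\<close>

lemma underdetermined_system:
  fixes e :: "'k \<Rightarrow> 's \<Rightarrow> complex"
  assumes "finite S" "finite K" "card S < card K"
  shows "\<exists>\<alpha>. (\<exists>k\<in>K. \<alpha> k \<noteq> 0) \<and> (\<forall>s\<in>S. (\<Sum>k\<in>K. \<alpha> k * e k s) = 0)"
  using assms
proof (induction S arbitrary: K e)
  case empty
  then obtain k where "k \<in> K" by (metis card.empty card_gt_0_iff ex_in_conv)
  then show ?case by (intro exI[of _ "\<lambda>_. 1"]) auto
next
  case (insert s0 S)
  show ?case
  proof (cases "\<exists>p\<in>K. e p s0 \<noteq> 0")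
    case False
    have "card S < card K" using insert.hyps insert.prems by simp
    from insert.IH[OF insert.prems(1) this, of e] obtain \<alpha> where
      "\<exists>k\<in>K. \<alpha> k \<noteq> 0" "\<forall>s\<in>S. (\<Sum>k\<in>K. \<alpha> k * e k s) = 0"
      by blast
    with False show ?thesis by (intro exI[of _ \<alpha>]) auto
  next
    case True
    then obtain p where p: "p \<in> K" "e p s0 \<noteq> 0" by blast
    define e' where "e' k s = e k s - e k s0 / e p s0 * e p s" for k s
    have "card S < card (K - {p})"
      using insert.hyps insert.prems p by simp
    from insert.IH[OF _ this, of e'] insert.prems obtain \<alpha> where
      \<alpha>: "\<exists>k\<in>K - {p}. \<alpha> k \<noteq> 0" "\<And>s. s \<in> S \<Longrightarrow> (\<Sum>k\<in>K - {p}. \<alpha> k * e' k s) = 0"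
      by (meson finite_Diff)
    define c where "c = - (\<Sum>k\<in>K - {p}. \<alpha> k * (e k s0 / e p s0))"
    define \<beta> where "\<beta> = \<alpha>(p := c)"
    have sum: "(\<Sum>k\<in>K. \<beta> k * e k s) = (\<Sum>k\<in>K - {p}. \<alpha> k * e' k s)" for s
    proof -
      have "(\<Sum>k\<in>K. \<beta> k * e k s) = c * e p s + (\<Sum>k\<in>K - {p}. \<alpha> k * e k s)"
        using insert.prems(1) p(1) by (subst sum.remove[of K p]) (auto simp: \<beta>_def intro!: sum.cong)
      then show ?thesis
        by (simp add: c_def e'_def right_diff_distrib sum_subtractf sum_distrib_right mult.assoc)
    qed
    have "e' k s0 = 0" for k using p by (simp add: e'_def)
    then have "\<forall>s\<in>insert s0 S. (\<Sum>k\<in>K. \<beta> k * e k s) = 0"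
      using \<alpha>(2) by (simp add: sum)
    moreover have "\<exists>k\<in>K. \<beta> k \<noteq> 0"
      using \<alpha>(1) by (auto simp: \<beta>_def)
    ultimately show ?thesis by blast
  qed
qed

lemma shift_sum_eq_finite:
  assumes T: "carried_in T R" and \<psi>: "\<psi> \<in> test_functions" and zero: "\<And>x. R' \<le> \<bar>x\<bar> \<Longrightarrow> \<psi> x = 0"
    and L: "finite L" "\<And>l :: int. \<bar>of_int l\<bar> < R + R' \<Longrightarrow> l \<in> L"
  shows "shift_sum T c \<psi> = (\<Sum>l\<in>L. c l * T (\<lambda>x. \<psi> (x + of_int l)))"
proof -
  have "T (\<lambda>x. \<psi> (x + of_int l)) = 0" if "l \<notin> L" for l
  proof (rule carried_in_zero[OF T test_shift[OF \<psi>]])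
    fix x :: real assume "\<bar>x\<bar> < R"
    have "R + R' \<le> \<bar>of_int l\<bar>"
      using L(2)[of l] that by force
    with \<open>\<bar>x\<bar> < R\<close> have "R' \<le> \<bar>x + of_int l\<bar>" by linarith
    then show "\<psi> (x + of_int l) = 0" by (rule zero)
  qed
  then have "(\<Sum>\<^sub>\<infinity>l\<in>UNIV. c l * T (\<lambda>x. \<psi> (x + of_int l))) = (\<Sum>\<^sub>\<infinity>l\<in>L. c l * T (\<lambda>x. \<psi> (x + of_int l)))"
    by (intro infsum_cong_neutral) auto
  then show ?thesis
    using L(1) by (simp add: shift_sum_def shift_def)
qed

text \<open>For a fixed test function all but finitely many shifts of \<open>T\<close> vanish, uniformly in the
coefficients.\<close>

lemma shift_sum_window:
  assumes T: "carried_in T R" and \<psi>: "\<psi> \<in> test_functions"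
  obtains L where "\<And>c. shift_sum T c \<psi> = (\<Sum>l\<in>{-L..L}. c l * T (\<lambda>x. \<psi> (x + of_int l)))"
proof -
  obtain R' where R': "\<And>x. R' \<le> \<bar>x\<bar> \<Longrightarrow> \<psi> x = 0"
    using \<psi> by (rule test_functionsE) blast
  have "l \<in> {- \<lceil>R + R'\<rceil>..\<lceil>R + R'\<rceil>}" if "\<bar>of_int l\<bar> < R + R'" for l
    using that by (auto simp: abs_less_iff) linarith+
  then show ?thesis
    using that shift_sum_eq_finite[OF T \<psi> R' finite_atLeastAtMost_int] by blast
qed

lemma shift_sum_linear:
  assumes T: "carried_in T R" and \<psi>: "\<psi> \<in> test_functions"
  shows "shift_sum T (\<lambda>l. u * c l + v * c' l) \<psi> = u * shift_sum T c \<psi> + v * shift_sum T c' \<psi>"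
proof -
  obtain L where "\<And>c. shift_sum T c \<psi> = (\<Sum>l\<in>{-L..L}. c l * T (\<lambda>x. \<psi> (x + of_int l)))"
    using shift_sum_window[OF T \<psi>] by blast
  then show ?thesis
    by (simp add: sum_distrib_left sum.distrib algebra_simps)
qed

lemma shift_sum_translate:
  "shift_sum T (\<lambda>l. c (l + 1)) \<psi> = shift_sum T c (\<lambda>x. \<psi> (x - 1))"
proof -
  have "(\<Sum>\<^sub>\<infinity>l\<in>UNIV. c l * T (\<lambda>x. \<psi> (x + of_int l - 1))) =
      (\<Sum>\<^sub>\<infinity>l\<in>UNIV. c (l + 1) * T (\<lambda>x. \<psi> (x + of_int (l + 1) - 1)))"
    by (rule infsum_reindex_bij_betw[symmetric, where g = "\<lambda>l. l + 1"])
      (auto intro!: bij_betwI[where g = "\<lambda>l. l - 1"])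
  then show ?thesis
    by (simp add: shift_sum_def shift_def algebra_simps)
qed

lemma lborel_integral_translate:
  fixes f \<psi> :: "real \<Rightarrow> complex"
  shows "(LINT x|lborel. f (x + s) * \<psi> x) = (LINT x|lborel. f x * \<psi> (x - s))"
  using lborel_integral_real_affine[of 1 "\<lambda>x. f x * \<psi> (x - s)" s] by (simp add: add.commute)

context bounded_masks
begin

text \<open>Let \<open>h = 1 / 2 ^ n\<close> and let \<open>\<psi>\<close> vanish outside \<open>(0, h)\<close>.  With
\<open>V s = lim (\<lambda>k. cascade n k \<psi> (s h))\<close>, which plays the role of the value at \<open>\<psi>\<close> of the generator at
scale \<open>h\<close> shifted by \<open>s h\<close>, the refinement \<open>cascade 0 (n + k) = cascade 0 n \<circ> cascade n k\<close> expresses the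
pairing of \<open>f(\<cdot> + k h)\<close> with \<open>\<psi>\<close> as \<open>\<Sum>\<^sub>s E k s * V s\<close>, where the matrix \<open>E\<close> does not depend on \<open>\<psi>\<close>.
Since the cascade beyond stage \<open>n\<close> is supported in \<open>[0, N h]\<close>, only the \<open>N\<close> indices
\<open>- N < s \<le> 0\<close> matter, and \<open>N + 1\<close> rows of length \<open>N\<close> are linearly dependent.\<close>

lemma shift_relation:
  assumes T: "carried_in T R"
    and lim: "\<And>y. (\<lambda>k. mask_prod 0 k y) \<longlonglongrightarrow> fourier T (of_real y)"
    and conv: "\<And>y. convergent (\<lambda>k. mask_prod n k y)"
    and f: "continuous_on UNIV f" "local_power_series f"
    and rep: "\<And>\<psi>. \<psi> \<in> test_functions \<Longrightarrow> dist_of_fun f \<psi> = shift_sum T c \<psi>"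
  shows "\<exists>\<alpha>. (\<exists>k\<le>N. \<alpha> k \<noteq> 0) \<and> (\<forall>t. (\<Sum>k\<le>N. \<alpha> k * f (t + real k / 2 ^ n)) = 0)"
proof -
  define h :: real where "h = 1 / 2 ^ n"
  have h: "h > 0" "h \<le> 1" by (simp_all add: h_def)
  obtain w where w: "\<And>\<psi> x. cascade 0 n \<psi> x = (\<Sum>r\<le>N * (2 ^ n - 1). w r * \<psi> (x + real r / 2 ^ n))"
    using cascade_weights[of 0 n] by auto
  \<comment> \<open>The shifted test functions below vanish outside \<open>(- (N + 1), N + 1)\<close>, so that the shifts of \<open>T\<close> by integers
beyond \<open>B\<close> do not see them.\<close>
  define B where "B = \<lceil>R + (real N + 1)\<rceil>"
  \<comment> \<open>Index pairs \<open>(l, r)\<close>: a shift of \<open>T\<close> by \<open>l\<close> and a point \<open>r h\<close> of the measure at stage \<open>n\<close>.\<close>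
  define X where "X = {-B..B} \<times> {..N * (2 ^ n - 1)}"
  define \<sigma> where "\<sigma> k x = fst x * 2 ^ n - int k + int (snd x)" for k :: nat and x :: "int \<times> nat"
  define g where "g x = c (fst x) * w (snd x)" for x
  define S where "S = {- int N + 1..0}"
  define E where "E k s = (\<Sum>x\<in>X. if \<sigma> k x = s then g x else 0)" for k s
  have finX: "finite X" by (simp add: X_def)
  have "card S < card {..N}" by (simp add: S_def)
  moreover have "finite S" by (simp add: S_def)
  ultimately obtain \<alpha> where
    \<alpha>: "\<exists>k\<in>{..N}. \<alpha> k \<noteq> 0" "\<And>s. s \<in> S \<Longrightarrow> (\<Sum>k\<le>N. \<alpha> k * E k s) = 0"
    using underdetermined_system[of S "{..N}" E] by blast
  define F where "F t = (\<Sum>k\<le>N. \<alpha> k * f (t + real k * h))" for t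
  have F_cont: "continuous_on UNIV F"
    unfolding F_def
    by (intro continuous_intros continuous_on_compose2[OF f(1)]) auto
  have F_lps: "local_power_series F"
    unfolding F_def by (intro local_power_series_sum local_power_series_cmult local_power_series_shift f(2)) simp
  have "F x = 0" if "0 < x" "x < h" for x
  proof (rule continuous_eq_0_if_test_integrals_0[OF F_cont _ that])
    fix \<psi> assume \<psi>: "\<psi> \<in> test_functions" and zero: "\<And>x. x \<notin> {0<..<h} \<Longrightarrow> \<psi> x = 0"
    define V where "V s = lim (\<lambda>k. cascade n k \<psi> (of_int s * h))" for s :: int
    have V: "(\<lambda>k. cascade n k \<psi> (of_int s * h)) \<longlonglongrightarrow> V s" for s
      using cascade_convergent[OF \<psi> conv] by (simp add: V_def convergent_LIMSEQ_iff)
    have V0: "V s = 0" if "s \<notin> S" for s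
    proof -
      have "cascade n k \<psi> (of_int s * h) = 0" for k
      proof (rule cascade_support[OF zero])
        have "s \<le> - int N \<or> s \<ge> 1" using that by (auto simp: S_def)
        then show "of_int s * h \<le> 0 - real N / 2 ^ n \<or> h \<le> of_int s * h"
        proof
          assume "s \<le> - int N"
          then have "real_of_int s \<le> - real N" by linarith
          then have "of_int s * h \<le> - real N * h" using h by (intro mult_right_mono) auto
          then show ?thesis by (simp add: h_def)
        next
          assume "s \<ge> 1"
          then show ?thesis using h by simp
        qed
      qed
      then show ?thesis by (simp add: V_def)
    qed
    have T_eq: "T (\<lambda>x. \<psi> (x + of_int s * h)) = (\<Sum>r\<le>N * (2 ^ n - 1). w r * V (s + int r))" for s
    proof (rule LIMSEQ_unique)
      have "(\<lambda>k. cascade 0 k \<psi> (of_int s * h)) \<longlonglongrightarrow> T (\<lambda>x. \<psi> (x + of_int s * h))"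
        by (rule cascade_tendsto_distribution[OF T \<psi> lim])
      then have "(\<lambda>k. cascade 0 (k + n) \<psi> (of_int s * h)) \<longlonglongrightarrow> T (\<lambda>x. \<psi> (x + of_int s * h))"
        by (rule LIMSEQ_ignore_initial_segment)
      then show "(\<lambda>k. cascade 0 (n + k) \<psi> (of_int s * h)) \<longlonglongrightarrow> T (\<lambda>x. \<psi> (x + of_int s * h))"
        by (simp only: add.commute)
      have "cascade 0 (n + k) \<psi> (of_int s * h) = (\<Sum>r\<le>N * (2 ^ n - 1). w r * cascade n k \<psi> (of_int (s + int r) * h))" for k
        unfolding cascade_append w by (simp add: h_def add_divide_distrib)
      then show "(\<lambda>k. cascade 0 (n + k) \<psi> (of_int s * h)) \<longlonglongrightarrow> (\<Sum>r\<le>N * (2 ^ n - 1). w r * V (s + int r))"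
        by (simp only:) (intro tendsto_intros V)
    qed
    have pair: "(LINT t|lborel. f (t + real k * h) * \<psi> t) = (\<Sum>s\<in>S. E k s * V s)" if k: "k \<le> N" for k
    proof -
      have "(LINT t|lborel. f (t + real k * h) * \<psi> t) = dist_of_fun f (\<lambda>t. \<psi> (t - real k * h))"
        unfolding dist_of_fun_def by (rule lborel_integral_translate)
      also have "\<dots> = shift_sum T c (\<lambda>t. \<psi> (t - real k * h))"
        using test_shift[OF \<psi>, of "- real k * h"] by (intro rep) simp
      also have "\<dots> = (\<Sum>l\<in>{-B..B}. c l * T (\<lambda>x. \<psi> (x + of_int l - real k * h)))"
      proof (rule shift_sum_eq_finite[OF T])
        show "(\<lambda>t. \<psi> (t - real k * h)) \<in> test_functions"
          using test_shift[OF \<psi>, of "- real k * h"] by simp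
        show "\<psi> (x - real k * h) = 0" if "real N + 1 \<le> \<bar>x\<bar>" for x
        proof (rule zero)
          have "real k * h \<le> real N * 1"
            using h k by (intro mult_mono) auto
          moreover have "0 \<le> real k * h"
            using h by simp
          ultimately show "x - real k * h \<notin> {0<..<h}"
            using that h unfolding greaterThanLessThan_iff by linarith
        qed
        show "l \<in> {-B..B}" if "\<bar>of_int l\<bar> < R + (real N + 1)" for l
          using that unfolding B_def atLeastAtMost_iff by linarith
      qed simp
      also have "\<dots> = (\<Sum>l\<in>{-B..B}. c l * (\<Sum>r\<le>N * (2 ^ n - 1). w r * V (l * 2 ^ n - int k + int r)))"
      proof (rule sum.cong[OF refl])
        fix l :: int
        have "of_int l - real k * h = of_int (l * 2 ^ n - int k) * h"
          by (simp add: h_def field_simps)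
        then have "T (\<lambda>x. \<psi> (x + of_int l - real k * h)) = T (\<lambda>x. \<psi> (x + of_int (l * 2 ^ n - int k) * h))"
          by (simp only: add_diff_eq[symmetric])
        then show "c l * T (\<lambda>x. \<psi> (x + of_int l - real k * h)) =
            c l * (\<Sum>r\<le>N * (2 ^ n - 1). w r * V (l * 2 ^ n - int k + int r))"
          by (simp only: T_eq)
      qed
      also have "\<dots> = (\<Sum>x\<in>X. g x * V (\<sigma> k x))"
        by (simp add: X_def g_def \<sigma>_def sum_distrib_left sum.cartesian_product case_prod_beta mult.assoc)
      also have "\<dots> = (\<Sum>x\<in>X. \<Sum>s\<in>S. (if \<sigma> k x = s then g x else 0) * V s)"
      proof (rule sum.cong[OF refl])
        fix x
        have "(\<Sum>s\<in>S. (if \<sigma> k x = s then g x else 0) * V s) = (\<Sum>s\<in>S. if \<sigma> k x = s then g x * V s else 0)"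
          by (intro sum.cong) auto
        also have "\<dots> = (if \<sigma> k x \<in> S then g x * V (\<sigma> k x) else 0)"
          by (simp add: S_def)
        finally show "g x * V (\<sigma> k x) = (\<Sum>s\<in>S. (if \<sigma> k x = s then g x else 0) * V s)"
          using V0 by simp
      qed
      also have "\<dots> = (\<Sum>s\<in>S. E k s * V s)"
        unfolding E_def sum_distrib_right by (rule sum.swap)
      finally show ?thesis .
    qed
    have int: "integrable lborel (\<lambda>t. \<alpha> k * (f (t + real k * h) * \<psi> t))" for k
      by (intro integrable_mult_right integrable_continuous_times_test \<psi> continuous_on_compose2[OF f(1)]
          continuous_intros) auto
    have "(LINT t|lborel. F t * \<psi> t) = (LINT t|lborel. (\<Sum>k\<le>N. \<alpha> k * (f (t + real k * h) * \<psi> t)))"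
      by (simp add: F_def sum_distrib_right mult.assoc)
    also have "\<dots> = (\<Sum>k\<le>N. \<alpha> k * (LINT t|lborel. f (t + real k * h) * \<psi> t))"
      by (subst Bochner_Integration.integral_sum) (use int in auto)
    also have "\<dots> = (\<Sum>k\<le>N. \<Sum>s\<in>S. \<alpha> k * E k s * V s)"
      by (intro sum.cong refl) (simp add: pair sum_distrib_left mult.assoc)
    also have "\<dots> = (\<Sum>s\<in>S. (\<Sum>k\<le>N. \<alpha> k * E k s) * V s)"
      unfolding sum_distrib_right by (rule sum.swap)
    also have "\<dots> = 0"
      using \<alpha>(2) by simp
    finally show "(LINT t|lborel. F t * \<psi> t) = 0" .
  qed
  then have "F t = 0" for t
    by (rule local_power_series_identity[OF F_lps h(1)])
  then show ?thesis
    using \<alpha>(1) by (intro exI[of _ \<alpha>]) (auto simp: F_def h_def)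
qed

end

section \<open>Finite differences\<close>

text \<open>The forward difference of a polynomial.  It lowers a positive degree by exactly one, with an
explicit leading coefficient.\<close>

definition poly_diff :: "complex poly \<Rightarrow> complex poly" where
  "poly_diff p = pcompose p [:1, 1:] - p"

lemma poly_poly_diff: "poly (poly_diff p) x = poly p (x + 1) - poly p x"
  by (simp add: poly_diff_def poly_pcompose add.commute)

lemma poly_diff_pCons: "poly_diff (pCons a q) = pCons 0 (poly_diff q) + pcompose q [:1, 1:]"
  by (simp add: poly_diff_def pcompose_pCons algebra_simps)

lemma coeff_pcompose_shift_top:
  assumes "degree q \<le> n"
  shows "coeff (pcompose q [:1, 1 :: complex:]) n = coeff q n"
proof (cases "degree q = n")
  case True
  have "degree (pcompose q [:1, 1 :: complex:]) = n"
    using True by (simp add: degree_pcompose)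
  with True show ?thesis
    using lead_coeff_comp[of "[:1, 1 :: complex:]" q] by simp
next
  case False
  then have "degree q < n" using assms by simp
  then show ?thesis by (simp add: coeff_eq_0 degree_pcompose)
qed

lemma
  assumes "degree p \<le> Suc n"
  shows degree_poly_diff: "degree (poly_diff p) \<le> n"
    and coeff_poly_diff_top: "coeff (poly_diff p) n = of_nat (Suc n) * coeff p (Suc n)"
proof -
  have "degree (poly_diff p) \<le> n \<and> coeff (poly_diff p) n = of_nat (Suc n) * coeff p (Suc n)"
    using assms
  proof (induction p arbitrary: n)
    case 0
    show ?case by (simp add: poly_diff_def)
  next
    case (pCons a q)
    have q: "degree q \<le> n"
      using pCons.prems by (cases "q = 0") auto
    show ?case
    proof (cases n)
      case 0
      then obtain v where "q = [:v:]"
        using q degree_eq_zeroE by auto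
      then show ?thesis
        using 0 by (simp add: poly_diff_pCons) (simp add: poly_diff_def)
    next
      case (Suc m)
      have IH: "degree (poly_diff q) \<le> m" "coeff (poly_diff q) m = of_nat (Suc m) * coeff q (Suc m)"
        using pCons.IH[of m] q Suc by auto
      have "degree (pCons 0 (poly_diff q)) \<le> Suc m"
        using IH(1) by (intro order_trans[OF degree_pCons_le]) simp
      moreover have "degree (pcompose q [:1, 1:]) \<le> Suc m"
        using q Suc by (simp add: degree_pcompose)
      ultimately have "degree (poly_diff (pCons a q)) \<le> Suc m"
        unfolding poly_diff_pCons by (rule degree_add_le)
      moreover have "coeff (poly_diff (pCons a q)) (Suc m) = of_nat (Suc (Suc m)) * coeff q (Suc m)"
        unfolding poly_diff_pCons coeff_add coeff_pCons_Suc IH(2)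
        using coeff_pcompose_shift_top[of q "Suc m"] q Suc by (simp add: algebra_simps)
      ultimately show ?thesis by (simp add: Suc)
    qed
  qed
  then show "degree (poly_diff p) \<le> n" "coeff (poly_diff p) n = of_nat (Suc n) * coeff p (Suc n)"
    by auto
qed

lemma poly_diff_const: "degree p = 0 \<Longrightarrow> poly_diff p = 0"
  by (elim degree_eq_zeroE) (simp add: poly_diff_def)

lemma poly_diff_funpow_eq_0: "degree p < n \<Longrightarrow> (poly_diff ^^ n) p = 0"
proof (induction n arbitrary: p)
  case (Suc n)
  show ?case
  proof (cases "degree p")
    case 0
    have "(poly_diff ^^ n) 0 = 0"
      by (induction n) (auto simp: poly_diff_def)
    with 0 show ?thesis
      by (simp add: funpow_Suc_right poly_diff_const del: funpow.simps)
  next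
    case (Suc m)
    then have "degree (poly_diff p) < n"
      using degree_poly_diff[of p m] Suc.prems by simp
    then show ?thesis
      using Suc.IH by (simp add: funpow_Suc_right del: funpow.simps)
  qed
qed simp

lemma poly_diff_funpow_degree:
  assumes "degree p \<le> n"
  shows "(poly_diff ^^ n) p = [:fact n * coeff p n:]"
  using assms
proof (induction n arbitrary: p)
  case 0
  then obtain v where "p = [:v:]"
    using degree_eq_zeroE by auto
  then show ?case by simp
next
  case (Suc n)
  have "(poly_diff ^^ Suc n) p = (poly_diff ^^ n) (poly_diff p)"
    by (simp add: funpow_Suc_right del: funpow.simps)
  also have "\<dots> = [:fact n * coeff (poly_diff p) n:]"
    by (rule Suc.IH[OF degree_poly_diff[OF Suc.prems]])
  finally show ?case
    by (simp add: coeff_poly_diff_top[OF Suc.prems] mult_ac)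
qed

definition seq_diff :: "(int \<Rightarrow> complex) \<Rightarrow> int \<Rightarrow> complex" where
  "seq_diff g l = g (l + 1) - g l"

definition fun_diff :: "(real \<Rightarrow> complex) \<Rightarrow> real \<Rightarrow> complex" where
  "fun_diff u t = u (t + 1) - u t"

lemma seq_diff_funpow_poly:
  "(seq_diff ^^ n) (\<lambda>l. poly p (of_int l)) = (\<lambda>l. poly ((poly_diff ^^ n) p) (of_int l))"
  by (induction n) (auto simp: seq_diff_def poly_poly_diff fun_eq_iff)

lemma fun_diff_funpow_poly_periodic:
  assumes "\<And>k t. k \<le> d \<Longrightarrow> \<omega> k (t + 1) = \<omega> k t"
  shows "(fun_diff ^^ n) (\<lambda>t. \<Sum>k\<le>d. poly (p k) (of_real t) * \<omega> k t) =
    (\<lambda>t. \<Sum>k\<le>d. poly ((poly_diff ^^ n) (p k)) (of_real t) * \<omega> k t)"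
  by (induction n) (auto simp: fun_diff_def poly_poly_diff fun_eq_iff assms left_diff_distrib
      simp flip: sum_subtractf intro!: sum.cong)

lemma seq_diff_linear:
  "(seq_diff ^^ n) (\<lambda>l. g l - c * g' l) = (\<lambda>l. (seq_diff ^^ n) g l - c * (seq_diff ^^ n) g' l)"
  by (induction n) (auto simp: seq_diff_def fun_eq_iff algebra_simps)

lemma seq_diff_eq_0_const:
  assumes "seq_diff g = (\<lambda>_. 0)"
  shows "g l = g 0"
proof -
  have step: "g (m + 1) = g m" for m
    using fun_cong[OF assms, of m] by (simp add: seq_diff_def)
  show ?thesis
  proof (induction l rule: int_induct[of _ 0])
    case (step2 i)
    then show ?case using step[of "i - 1"] by simp
  qed (use step in auto)
qed

text \<open>A sequence killed by \<open>j + 1\<close> differences has a constant \<open>j\<close>-th difference, as has a suitable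
difference of \<open>g0\<close>, with a non-zero constant.  Subtracting a multiple lowers \<open>j\<close>.\<close>

lemma seq_diff_span:
  assumes lin: "\<And>g g' c. Z g \<Longrightarrow> Z g' \<Longrightarrow> Z (\<lambda>l. g l + c * g' l)" and zero: "Z (\<lambda>_. 0)"
    and diff: "\<And>g. Z g \<Longrightarrow> Z (seq_diff g)"
    and g0: "Z g0" "(seq_diff ^^ Suc d) g0 = (\<lambda>_. 0)" "(seq_diff ^^ d) g0 \<noteq> (\<lambda>_. 0)"
    and g: "(seq_diff ^^ j) g = (\<lambda>_. 0)" "j \<le> Suc d"
  shows "Z g"
  using g
proof (induction j arbitrary: g)
  case 0
  then show ?case using zero by simp
next
  case (Suc j)
  define e where "e = (seq_diff ^^ (d - j)) g0"
  have "Z ((seq_diff ^^ i) g0)" for i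
    by (induction i) (use g0(1) diff in auto)
  then have Ze: "Z e" by (simp add: e_def)
  have e_top: "(seq_diff ^^ j) e = (seq_diff ^^ d) g0"
    using Suc.prems(2) by (simp add: e_def funpow_add[symmetric, THEN fun_cong, unfolded o_def])
  define \<kappa> where "\<kappa> = (seq_diff ^^ d) g0 0"
  have e_const: "(seq_diff ^^ d) g0 l = \<kappa>" for l
    unfolding \<kappa>_def by (rule seq_diff_eq_0_const) (use g0(2) in simp)
  then have "\<kappa> \<noteq> 0" using g0(3) by auto
  define \<gamma> where "\<gamma> = (seq_diff ^^ j) g 0"
  have g_const: "(seq_diff ^^ j) g l = \<gamma>" for l
    unfolding \<gamma>_def by (rule seq_diff_eq_0_const) (use Suc.prems(1) in simp)
  have "Z (\<lambda>l. g l - \<gamma> / \<kappa> * e l)"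
  proof (rule Suc.IH)
    show "(seq_diff ^^ j) (\<lambda>l. g l - \<gamma> / \<kappa> * e l) = (\<lambda>_. 0)"
      unfolding seq_diff_linear g_const e_top e_const using \<open>\<kappa> \<noteq> 0\<close> by simp
  qed (use Suc.prems in simp)
  from lin[OF this Ze, of "\<gamma> / \<kappa>"] show ?case by simp
qed

definition modulate :: "complex \<Rightarrow> (int \<Rightarrow> complex) \<Rightarrow> int \<Rightarrow> complex" where
  "modulate \<mu> g l = exp (\<mu> * of_int l) * g l"

lemma modulate_seq_diff:
  "modulate \<mu> (seq_diff g) = (\<lambda>l. exp (- \<mu>) * modulate \<mu> g (l + 1) + (-1) * modulate \<mu> g l)"
proof
  fix l
  have "exp (- \<mu>) * exp (\<mu> * of_int (l + 1)) = exp (\<mu> * of_int l)"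
    by (simp add: algebra_simps flip: exp_add)
  then show "modulate \<mu> (seq_diff g) l = exp (- \<mu>) * modulate \<mu> g (l + 1) + (-1) * modulate \<mu> g l"
    by (simp add: modulate_def seq_diff_def right_diff_distrib mult.assoc[symmetric])
qed

text \<open>Shifting a function by one shifts its coefficient sequence by one.  After removal of the
exponential factors, forward differences of the function and of its coefficients correspond.\<close>

lemma representation_diff:
  assumes T: "carried_in T R" and u: "continuous_on UNIV u"
    and rep: "\<And>\<psi>. \<psi> \<in> test_functions \<Longrightarrow>
      dist_of_fun (\<lambda>t. exp (\<mu> * of_real t) * u t) \<psi> = shift_sum T (modulate \<mu> g) \<psi>"
    and \<psi>: "\<psi> \<in> test_functions"
  shows "dist_of_fun (\<lambda>t. exp (\<mu> * of_real t) * fun_diff u t) \<psi> = shift_sum T (modulate \<mu> (seq_diff g)) \<psi>"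
proof -
  let ?f = "\<lambda>t. exp (\<mu> * of_real t) * u t"
  have cont: "continuous_on UNIV ?f"
    by (intro continuous_intros u)
  have \<psi>1: "(\<lambda>x. \<psi> (x - 1)) \<in> test_functions"
    using test_shift[OF \<psi>, of "-1"] by simp
  have eq: "exp (\<mu> * of_real t) * fun_diff u t = exp (- \<mu>) * ?f (t + 1) + (-1) * ?f t" for t
  proof -
    have "exp (- \<mu>) * exp (\<mu> * of_real (t + 1)) = exp (\<mu> * of_real t)"
      by (simp add: algebra_simps flip: exp_add)
    then show ?thesis
      by (simp add: fun_diff_def right_diff_distrib mult.assoc[symmetric])
  qed
  have cont1: "continuous_on UNIV (\<lambda>t. ?f (t + 1))"
    by (rule continuous_on_compose2[OF cont]) (auto intro!: continuous_intros)
  have "dist_of_fun (\<lambda>t. exp (\<mu> * of_real t) * fun_diff u t) \<psi> =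
      (LINT t|lborel. exp (- \<mu>) * (?f (t + 1) * \<psi> t) + (-1) * (?f t * \<psi> t))"
    unfolding dist_of_fun_def eq by (simp only: distrib_right mult.assoc)
  also have "\<dots> = exp (- \<mu>) * (LINT t|lborel. ?f (t + 1) * \<psi> t) + (-1) * (LINT t|lborel. ?f t * \<psi> t)"
    by (subst Bochner_Integration.integral_add)
      (intro integrable_mult_right integrable_continuous_times_test \<psi> cont cont1 | simp)+
  also have "(LINT t|lborel. ?f (t + 1) * \<psi> t) = dist_of_fun ?f (\<lambda>t. \<psi> (t - 1))"
    unfolding dist_of_fun_def by (rule lborel_integral_translate)
  also have "(LINT t|lborel. ?f t * \<psi> t) = dist_of_fun ?f \<psi>"
    by (simp add: dist_of_fun_def)
  also have "exp (- \<mu>) * dist_of_fun ?f (\<lambda>t. \<psi> (t - 1)) + (-1) * dist_of_fun ?f \<psi> =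
      shift_sum T (modulate \<mu> (seq_diff g)) \<psi>"
    unfolding rep[OF \<psi>] rep[OF \<psi>1] modulate_seq_diff shift_sum_linear[OF T \<psi>] shift_sum_translate ..
  finally show ?thesis .
qed

lemma continuous_on_fun_diff: "continuous_on UNIV u \<Longrightarrow> continuous_on UNIV (fun_diff u)"
  unfolding fun_diff_def
  by (intro continuous_intros continuous_on_compose2[of UNIV u UNIV "\<lambda>t. t + 1"]) auto

lemma representation_diff_funpow:
  assumes T: "carried_in T R" and u: "continuous_on UNIV u"
    and rep: "\<And>\<psi>. \<psi> \<in> test_functions \<Longrightarrow>
      dist_of_fun (\<lambda>t. exp (\<mu> * of_real t) * u t) \<psi> = shift_sum T (modulate \<mu> g) \<psi>"
  shows "continuous_on UNIV ((fun_diff ^^ n) u) \<and> (\<forall>\<psi>\<in>test_functions.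
    dist_of_fun (\<lambda>t. exp (\<mu> * of_real t) * (fun_diff ^^ n) u t) \<psi> = shift_sum T (modulate \<mu> ((seq_diff ^^ n) g)) \<psi>)"
proof (induction n)
  case (Suc n)
  then show ?case
    using representation_diff[OF T, of "(fun_diff ^^ n) u" \<mu> "(seq_diff ^^ n) g"] continuous_on_fun_diff by simp
qed (use u rep in simp)

text \<open>The differences of \<open>u\<close> are represented by the corresponding differences of \<open>g\<close>.  If the function
vanishes, so do the coefficients, by linear independence; if the coefficients vanish, so does the
continuous function.\<close>

lemma coefficients_exponential_polynomial:
  assumes T: "carried_in T R" and indep: "shifts_linearly_independent T"
    and u: "continuous_on UNIV u"
    and rep: "\<And>\<psi>. \<psi> \<in> test_functions \<Longrightarrow>
      dist_of_fun (\<lambda>t. exp (\<mu> * of_real t) * u t) \<psi> = shift_sum T (modulate \<mu> g) \<psi>"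
    and u_top: "(fun_diff ^^ Suc d) u = (\<lambda>_. 0)" "(fun_diff ^^ d) u \<noteq> (\<lambda>_. 0)"
  shows "(seq_diff ^^ Suc d) g = (\<lambda>_. 0)" and "(seq_diff ^^ d) g \<noteq> (\<lambda>_. 0)"
proof -
  note R = representation_diff_funpow[OF T u, of \<mu> g]
  have "shift_sum T (modulate \<mu> ((seq_diff ^^ Suc d) g)) \<psi> = 0" if "\<psi> \<in> test_functions" for \<psi>
    using R[of "Suc d"] rep that unfolding u_top(1) by (simp add: dist_of_fun_def)
  then have "modulate \<mu> ((seq_diff ^^ Suc d) g) l = 0" for l
    using indep unfolding shifts_linearly_independent_def by blast
  then show "(seq_diff ^^ Suc d) g = (\<lambda>_. 0)"
    by (auto simp: modulate_def fun_eq_iff)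
  show "(seq_diff ^^ d) g \<noteq> (\<lambda>_. 0)"
  proof
    assume "(seq_diff ^^ d) g = (\<lambda>_. 0)"
    then have "modulate \<mu> ((seq_diff ^^ d) g) = (\<lambda>_. 0)"
      by (simp add: modulate_def fun_eq_iff)
    then have zero: "(LINT t|lborel. exp (\<mu> * of_real t) * (fun_diff ^^ d) u t * \<psi> t) = 0" if "\<psi> \<in> test_functions" for \<psi>
      using R[of d] rep that by (simp add: dist_of_fun_def shift_sum_def)
    have cont: "continuous_on UNIV (\<lambda>t. exp (\<mu> * of_real t) * (fun_diff ^^ d) u t)"
      using R[of d] rep by (intro continuous_intros) auto
    have "exp (\<mu> * of_real t) * (fun_diff ^^ d) u t = 0" for t
      by (rule continuous_eq_0_if_test_integrals_0[OF cont zero, of "t - 1" "t + 1"]) auto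
    then have "(fun_diff ^^ d) u = (\<lambda>_. 0)"
      by (auto simp: fun_eq_iff)
    with u_top(2) show False by simp
  qed
qed

section \<open>Moments and the Poisson summation argument\<close>

lemma tile_eq_0: "1 \<le> \<bar>x\<bar> \<Longrightarrow> tile x = 0"
  by (cases "x \<ge> 0") (auto simp: tile_def step_eq_0 step_eq_1)

lemma wave_minus_mult: "wave z (x - s) = wave z x * wave z (- s)"
  using wave_add[of z x "- s"] by simp

text \<open>With \<open>u = wave z\<close>, the functions \<open>x ^ i * u x\<close> are cut into tiles by the partition of unity.  As \<open>u\<close> is
periodic up to the factor \<open>exp (- \<mu> l)\<close>, the shifted tiles are, by the binomial theorem, combinations
of shifts of the test functions \<open>tile x * x ^ i * u x\<close> with coefficients \<open>exp (\<mu> l)\<close> times a power of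
\<open>- l\<close>, and the sum over all \<open>l\<close> is annihilated by assumption.  Hence the functional
\<open>\<Sum>\<^sub>k \<alpha>\<^sub>k T(\<cdot> + k h)\<close> gives zero on \<open>x ^ j * u x\<close>.  Expanding \<open>(x - k h) ^ j\<close> instead leads to the moments.\<close>

lemma poisson_moments:
  fixes \<alpha> :: "nat \<Rightarrow> complex" and h :: real
  assumes T: "carried_in T R"
    and per: "\<And>l :: int. wave z (of_int l) = exp (- \<mu> * of_int l)"
    and ann: "\<And>q \<eta>. degree q \<le> d \<Longrightarrow> \<eta> \<in> test_functions \<Longrightarrow>
      (\<Sum>k\<le>N. \<alpha> k * shift_sum T (modulate \<mu> (\<lambda>l. poly q (of_int l))) (\<lambda>t. \<eta> (t - real k * h))) = 0"
    and "j \<le> d"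
  shows "(\<Sum>i\<le>j. of_nat (j choose i) * moment T R i z *
    (\<Sum>k\<le>N. \<alpha> k * of_real (- (real k * h)) ^ (j - i) * wave z (- (real k * h)))) = 0"
proof -
  have R: "R > 0" and dT: "distribution T"
    using T by (auto simp: carried_in_def)
  have cut: "cutoff R \<in> test_functions"
    using R by (intro cutoff_test) simp
  define X where "X i x = of_real x ^ i * wave z x" for i and x :: real
  have X: "smooth (X i)" for i
    unfolding X_def by (intro smooth_mult smooth_of_real_power smooth_wave)
  have X_shift: "X j (x - s) = (\<Sum>i\<le>j. (of_nat (j choose i) * of_real (- s) ^ (j - i) * wave z (- s)) * X i x)" for x s
  proof -
    have "of_real (x - s) ^ j = (\<Sum>i\<le>j. of_nat (j choose i) * of_real x ^ i * of_real (- s) ^ (j - i) :: complex)"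
      using binomial_ring[of "of_real x :: complex" "of_real (- s)" j] by simp
    then show ?thesis
      by (simp add: X_def wave_minus_mult sum_distrib_left mult_ac)
  qed
  define \<eta> where "\<eta> i x = tile x * X i x" for i x
  have \<eta>: "\<eta> i \<in> test_functions" for i
    unfolding \<eta>_def by (rule test_mult[OF tile_test X])
  define q :: "nat \<Rightarrow> complex poly" where "q i = [:0, -1:] ^ (j - i)" for i
  have q: "degree (q i) \<le> d" "poly (q i) x = (- x) ^ (j - i)" for i x
    using \<open>j \<le> d\<close> degree_power_le[of "[:0, -1 :: complex:]" "j - i"] by (auto simp: q_def poly_power)
  define Y where "Y s = T (\<lambda>x. cutoff R x * X j (x - s))" for s
  have Y1: "Y s = (\<Sum>i\<le>j. of_nat (j choose i) * of_real (- s) ^ (j - i) * wave z (- s) * moment T R i z)" for s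
  proof -
    have t: "(\<lambda>x. cutoff R x * X i x) \<in> test_functions" for i
      by (rule test_mult[OF cut X])
    have "(\<lambda>x. cutoff R x * X j (x - s)) =
        (\<lambda>x. \<Sum>i\<le>j. (of_nat (j choose i) * of_real (- s) ^ (j - i) * wave z (- s)) * (cutoff R x * X i x))"
      unfolding X_shift sum_distrib_left by (simp only: mult.left_commute)
    then show ?thesis
      unfolding Y_def moment_def X_def[symmetric]
      by (simp only: distribution_sum[OF dT finite_atMost test_cmult[OF t]] distribution_cmult[OF dT t])
  qed
  have Y2: "Y s = (\<Sum>i\<le>j. of_nat (j choose i) *
      shift_sum T (modulate \<mu> (\<lambda>l. poly (q i) (of_int l))) (\<lambda>t. \<eta> i (t - s)))" for s
  proof -
    define m where "m = nat \<lceil>R + (1 + \<bar>s\<bar>)\<rceil>"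
    have m: "R + (1 + \<bar>s\<bar>) \<le> real m"
      unfolding m_def by linarith
    let ?L = "{- int m..int m}"
    have win: "shift_sum T c (\<lambda>t. \<eta> i (t - s)) = (\<Sum>l\<in>?L. c l * T (\<lambda>x. \<eta> i (x + of_int l - s)))" for c i
    proof (rule shift_sum_eq_finite[OF T])
      show "(\<lambda>t. \<eta> i (t - s)) \<in> test_functions"
        using test_shift[OF \<eta>, where s = "- s"] by simp
      show "\<eta> i (x - s) = 0" if "1 + \<bar>s\<bar> \<le> \<bar>x\<bar>" for x
        unfolding \<eta>_def using that by (simp add: tile_eq_0)
      show "l \<in> ?L" if "\<bar>of_int l\<bar> < R + (1 + \<bar>s\<bar>)" for l
        using that m unfolding atLeastAtMost_iff by linarith
    qed simp
    have t: "(\<lambda>x. tile (x + of_int l - s) * X j (x - s)) \<in> test_functions" for l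
      using test_mult[OF test_shift[OF tile_test, of "of_int l - s"] smooth_shift[OF X, where s = "- s"]]
      by (simp add: add_diff_eq)
    have t2: "(\<lambda>x. \<eta> i (x + of_int l - s)) \<in> test_functions" for i l
      using test_shift[OF \<eta>, where s = "of_int l - s"] by (simp add: add_diff_eq)
    have "Y s = T (\<lambda>x. \<Sum>l\<in>?L. tile (x + of_int l - s) * X j (x - s))"
      unfolding Y_def
    proof (rule carried_in_local[OF T])
      show "(\<lambda>x. cutoff R x * X j (x - s)) \<in> test_functions"
        using test_mult[OF cut smooth_shift[OF X, where s = "- s"]] by simp
      show "(\<lambda>x. \<Sum>l\<in>?L. tile (x + of_int l - s) * X j (x - s)) \<in> test_functions"
        by (intro test_sum t) simp
      fix x :: real assume x: "\<bar>x\<bar> < R"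
      have "(\<Sum>l\<in>?L. tile (x + of_int l - s)) = (\<Sum>l\<in>?L. tile ((x - s) + of_int l))"
        by (simp add: algebra_simps)
      also have "\<dots> = 1"
        unfolding sum_tile by (rule cutoff_eq_1) (use x m in linarith)
      finally show "cutoff R x * X j (x - s) = (\<Sum>l\<in>?L. tile (x + of_int l - s) * X j (x - s))"
        using x by (simp add: cutoff_eq_1 sum_distrib_right[symmetric])
    qed
    also have "\<dots> = (\<Sum>l\<in>?L. T (\<lambda>x. tile (x + of_int l - s) * X j (x - s)))"
      by (rule distribution_sum[OF dT _ t]) simp
    also have "\<dots> = (\<Sum>l\<in>?L. \<Sum>i\<le>j. of_nat (j choose i) *
        (modulate \<mu> (\<lambda>l. poly (q i) (of_int l)) l * T (\<lambda>x. \<eta> i (x + of_int l - s))))"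
    proof (rule sum.cong[OF refl])
      fix l :: int
      have "tile (x + of_int l - s) * X j (x - s) =
          (\<Sum>i\<le>j. (of_nat (j choose i) * modulate \<mu> (\<lambda>l. poly (q i) (of_int l)) l) * \<eta> i (x + of_int l - s))" for x
      proof -
        have "wave z (- of_int l) = exp (\<mu> * of_int l)"
          using per[of "- l"] by simp
        then show ?thesis
          using X_shift[of "x + of_int l - s" "of_int l"]
          by (simp add: \<eta>_def modulate_def q sum_distrib_left mult_ac)
      qed
      then have "T (\<lambda>x. tile (x + of_int l - s) * X j (x - s)) =
          (\<Sum>i\<le>j. (of_nat (j choose i) * modulate \<mu> (\<lambda>l. poly (q i) (of_int l)) l) * T (\<lambda>x. \<eta> i (x + of_int l - s)))"
        by (simp only: distribution_sum[OF dT finite_atMost test_cmult[OF t2]] distribution_cmult[OF dT t2])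
      then show "T (\<lambda>x. tile (x + of_int l - s) * X j (x - s)) = (\<Sum>i\<le>j. of_nat (j choose i) *
          (modulate \<mu> (\<lambda>l. poly (q i) (of_int l)) l * T (\<lambda>x. \<eta> i (x + of_int l - s))))"
        by (simp only: mult.assoc)
    qed
    also have "\<dots> = (\<Sum>i\<le>j. \<Sum>l\<in>?L. of_nat (j choose i) *
        (modulate \<mu> (\<lambda>l. poly (q i) (of_int l)) l * T (\<lambda>x. \<eta> i (x + of_int l - s))))"
      by (rule sum.swap)
    finally show ?thesis
      by (simp only: win sum_distrib_left)
  qed
  have "(\<Sum>k\<le>N. \<alpha> k * Y (real k * h)) =
      (\<Sum>i\<le>j. of_nat (j choose i) * (\<Sum>k\<le>N. \<alpha> k *
        shift_sum T (modulate \<mu> (\<lambda>l. poly (q i) (of_int l))) (\<lambda>t. \<eta> i (t - real k * h))))"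
    unfolding Y2 sum_distrib_left by (subst sum.swap) (simp only: mult.left_commute)
  also have "\<dots> = 0"
    using ann[OF q(1) \<eta>] by simp
  finally have "(\<Sum>k\<le>N. \<Sum>i\<le>j. \<alpha> k * (of_nat (j choose i) * of_real (- (real k * h)) ^ (j - i) *
      wave z (- (real k * h)) * moment T R i z)) = 0"
    unfolding Y1 sum_distrib_left .
  then have "(\<Sum>i\<le>j. \<Sum>k\<le>N. \<alpha> k * (of_nat (j choose i) * of_real (- (real k * h)) ^ (j - i) *
      wave z (- (real k * h)) * moment T R i z)) = 0"
    by (subst (asm) sum.swap)
  then show ?thesis
    unfolding sum_distrib_left by (simp only: mult_ac)
qed

section \<open>Counting zeros with multiplicity\<close>

text \<open>The operator \<open>x d/dx\<close>, which multiplies the coefficient of \<open>x ^ k\<close> by \<open>k\<close>.\<close>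

definition euler_op :: "complex poly \<Rightarrow> complex poly" where
  "euler_op A = pCons 0 (pderiv A)"

lemma coeff_euler_op: "coeff (euler_op A) k = of_nat k * coeff A k"
  by (cases k) (simp_all add: euler_op_def coeff_pderiv)

lemma coeff_euler_op_funpow: "coeff ((euler_op ^^ r) A) k = of_nat k ^ r * coeff A k"
  by (induction r) (simp_all add: coeff_euler_op)

text \<open>Away from the origin the iterates of \<open>x d/dx\<close> detect the order of a zero just as ordinary derivatives
do.\<close>

lemma order_ge_if_euler_op_zeros:
  assumes "\<zeta> \<noteq> 0" "A \<noteq> 0" and "\<And>r. r < D \<Longrightarrow> poly ((euler_op ^^ r) A) \<zeta> = 0"
  shows "D \<le> order \<zeta> A"
  using assms(2,3)
proof (induction D arbitrary: A)
  case (Suc D)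
  have root: "poly A \<zeta> = 0"
    using Suc.prems(2)[of 0] by simp
  have nz: "pderiv A \<noteq> 0"
  proof
    assume "pderiv A = 0"
    then obtain v where "A = [:v:]"
      using pderiv_eq_0_iff degree_eq_zeroE by metis
    with root Suc.prems(1) show False by simp
  qed
  have E: "euler_op A = [:0, 1:] * pderiv A"
    by (simp add: euler_op_def)
  have Enz: "euler_op A \<noteq> 0"
    using nz by (simp add: euler_op_def)
  have "D \<le> order \<zeta> (euler_op A)"
  proof (rule Suc.IH[OF Enz])
    fix r assume "r < D"
    then show "poly ((euler_op ^^ r) (euler_op A)) \<zeta> = 0"
      using Suc.prems(2)[of "Suc r"] by (simp add: funpow_swap1)
  qed
  also have "\<dots> = order \<zeta> [:0, 1:] + order \<zeta> (pderiv A)"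
    unfolding E by (rule order_mult) (use Enz E in simp)
  also have "order \<zeta> [:0, 1:] = 0"
    using \<open>\<zeta> \<noteq> 0\<close> by (intro order_0I) simp
  finally have "Suc D \<le> Suc (order \<zeta> (pderiv A))" by simp
  also have "\<dots> = order \<zeta> A"
    using order_pderiv[OF Suc.prems(1), of \<zeta>] root Suc.prems(1) by (simp add: order_root)
  finally show ?case .
qed simp

text \<open>The relations say that the product of two power series, with coefficients \<open>m i / fact i\<close> and
\<open>\<beta> r / fact r\<close>, vanishes up to degree \<open>d\<close>.  If \<open>m\<close> starts at index \<open>i0\<close>, then \<open>\<beta>\<close> vanishes up to
index \<open>d - i0\<close>, which says that \<open>A\<close> has at \<open>\<zeta>\<close> a zero of order at least \<open>d - i0 + 1\<close>.\<close>

lemma order_ge_card_moments: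
  fixes \<alpha> m :: "nat \<Rightarrow> complex" and h :: real
  assumes "\<zeta> \<noteq> 0" "h \<noteq> 0"
    and A: "A = (\<Sum>k\<le>N. monom (\<alpha> k) k)" "A \<noteq> 0"
    and rel: "\<And>j. j \<le> d \<Longrightarrow> (\<Sum>i\<le>j. of_nat (j choose i) * m i *
      (\<Sum>k\<le>N. \<alpha> k * of_real (- (real k * h)) ^ (j - i) * \<zeta> ^ k)) = 0"
  shows "card {k. k \<le> d \<and> m k \<noteq> 0} \<le> order \<zeta> A"
proof (cases "\<exists>i\<le>d. m i \<noteq> 0")
  case False
  then have "{k. k \<le> d \<and> m k \<noteq> 0} = {}" by auto
  then show ?thesis by (simp only: card.empty zero_le)
next
  case True
  define i0 where "i0 = (LEAST i. m i \<noteq> 0)"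
  have i0: "m i0 \<noteq> 0" "\<And>i. i < i0 \<Longrightarrow> m i = 0" "i0 \<le> d"
    using True LeastI[of "\<lambda>i. m i \<noteq> 0"] not_less_Least[of _ "\<lambda>i. m i \<noteq> 0"] Least_le[of "\<lambda>i. m i \<noteq> 0"]
    unfolding i0_def by (blast, blast, meson order_trans)
  define \<beta> where "\<beta> r = (\<Sum>k\<le>N. \<alpha> k * of_real (- (real k * h)) ^ r * \<zeta> ^ k)" for r
  have \<beta>: "\<beta> r = 0" if "r \<le> d - i0" for r
    using that
  proof (induction r rule: less_induct)
    case (less r)
    have "(\<Sum>i\<le>i0 + r. of_nat ((i0 + r) choose i) * m i * \<beta> (i0 + r - i)) = 0"
      unfolding \<beta>_def by (rule rel) (use less.prems i0(3) in simp)
    moreover have "of_nat ((i0 + r) choose i) * m i * \<beta> (i0 + r - i) = 0" if "i \<in> {..i0 + r} - {i0}" for i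
    proof (cases "i < i0")
      case False
      then have "i0 + r - i < r" using that by auto
      then show ?thesis using less.IH[of "i0 + r - i"] less.prems by simp
    qed (simp add: i0(2))
    ultimately have "of_nat ((i0 + r) choose i0) * m i0 * \<beta> (i0 + r - i0) = 0"
      by (subst (asm) sum.remove[of _ i0]) auto
    then show ?case using i0(1) by simp
  qed
  have "poly ((euler_op ^^ r) A) \<zeta> = 0" if "r < d - i0 + 1" for r
  proof -
    have coeffA: "coeff A k = (if k \<le> N then \<alpha> k else 0)" for k
      unfolding A(1) coeff_sum coeff_monom by simp
    have "degree ((euler_op ^^ r) A) \<le> N"
      by (rule degree_le) (simp add: coeff_euler_op_funpow coeffA)
    then have "poly ((euler_op ^^ r) A) \<zeta> = (\<Sum>k\<le>N. coeff ((euler_op ^^ r) A) k * \<zeta> ^ k)"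
      unfolding poly_altdef by (intro sum.mono_neutral_left) (auto simp: coeff_eq_0)
    then have "poly ((euler_op ^^ r) A) \<zeta> = (\<Sum>k\<le>N. of_nat k ^ r * \<alpha> k * \<zeta> ^ k)"
      by (simp add: coeff_euler_op_funpow coeffA)
    moreover have "of_real (- h) ^ r * (\<Sum>k\<le>N. of_nat k ^ r * \<alpha> k * \<zeta> ^ k) = \<beta> r"
    proof -
      have "complex_of_real (- (real k * h)) ^ r = of_real (- h) ^ r * of_nat k ^ r" for k
        by (simp add: mult.commute flip: power_mult_distrib)
      then show ?thesis
        unfolding \<beta>_def sum_distrib_left by (simp only: mult_ac)
    qed
    ultimately show ?thesis
      using \<beta>[of r] that \<open>h \<noteq> 0\<close> by simp
  qed
  then have "d - i0 + 1 \<le> order \<zeta> A"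
    by (intro order_ge_if_euler_op_zeros assms)
  moreover have "card {k. k \<le> d \<and> m k \<noteq> 0} \<le> card {i0..d}"
    using i0(2) by (intro card_mono) (auto simp: not_less[symmetric])
  ultimately show ?thesis by simp
qed

lemma sum_order_le:
  fixes A :: "complex poly"
  assumes "A \<noteq> 0" "finite X"
  shows "(\<Sum>x\<in>X. order x A) \<le> degree A"
proof -
  have "(\<Sum>x\<in>X. order x A) = (\<Sum>x\<in>X \<inter> {x. poly A x = 0}. order x A)"
    by (rule sum.mono_neutral_right) (use assms in \<open>auto simp: order_root\<close>)
  also have "\<dots> \<le> (\<Sum>x | poly A x = 0. order x A)"
    by (rule sum_mono2) (use assms poly_roots_finite in auto)
  also have "\<dots> \<le> degree A"
    by (rule sum_order_le_degree[OF assms(1)])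
  finally show ?thesis .
qed

section \<open>The number of non-zero derivatives of the Fourier transform\<close>

text \<open>The annihilated sequences form a space that is invariant under differences, because shifting a
sequence amounts to translating the test function.  One member of exact degree \<open>d\<close> therefore yields
all polynomial sequences of degree at most \<open>d\<close>.\<close>

lemma annihilated_polynomial_sequences:
  fixes \<alpha> :: "nat \<Rightarrow> complex" and h :: real
  assumes T: "carried_in T R"
    and g0: "\<And>\<eta>. \<eta> \<in> test_functions \<Longrightarrow>
      (\<Sum>k\<le>N. \<alpha> k * shift_sum T (modulate \<mu> g0) (\<lambda>t. \<eta> (t - real k * h))) = 0"
    and top: "(seq_diff ^^ Suc d) g0 = (\<lambda>_. 0)" "(seq_diff ^^ d) g0 \<noteq> (\<lambda>_. 0)"
    and q: "degree q \<le> d" and \<eta>: "\<eta> \<in> test_functions"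
  shows "(\<Sum>k\<le>N. \<alpha> k * shift_sum T (modulate \<mu> (\<lambda>l. poly q (of_int l))) (\<lambda>t. \<eta> (t - real k * h))) = 0"
proof -
  define Z where "Z g \<longleftrightarrow> (\<forall>\<eta>\<in>test_functions.
    (\<Sum>k\<le>N. \<alpha> k * shift_sum T (modulate \<mu> g) (\<lambda>t. \<eta> (t - real k * h))) = 0)" for g
  have t: "(\<lambda>t. \<eta> (t - s)) \<in> test_functions" if "\<eta> \<in> test_functions" for \<eta> s
    using test_shift[OF that, of "- s"] by simp
  have combine: "(\<Sum>k\<le>N. \<alpha> k * shift_sum T (\<lambda>l. u * c l + v * c' l) (\<lambda>t. \<eta> (t - real k * h))) =
      u * (\<Sum>k\<le>N. \<alpha> k * shift_sum T c (\<lambda>t. \<eta> (t - real k * h))) +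
      v * (\<Sum>k\<le>N. \<alpha> k * shift_sum T c' (\<lambda>t. \<eta> (t - real k * h)))"
    if "\<eta> \<in> test_functions" for u v c c' \<eta>
    unfolding shift_sum_linear[OF T t[OF that]]
    by (simp add: distrib_left sum.distrib sum_distrib_left mult.left_commute)
  have "Z (\<lambda>l. poly q (of_int l))"
  proof (rule seq_diff_span[where Z = Z and ?g0.0 = g0 and d = d and j = "Suc d"])
    show "Z (\<lambda>l. g l + c * g' l)" if "Z g" "Z g'" for g g' c
    proof -
      have "modulate \<mu> (\<lambda>l. g l + c * g' l) = (\<lambda>l. 1 * modulate \<mu> g l + c * modulate \<mu> g' l)"
        by (simp add: modulate_def fun_eq_iff distrib_left mult.left_commute)
      note eq = this
      show ?thesis
        unfolding Z_def
      proof
        fix \<eta> assume "\<eta> \<in> test_functions"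
        with that show "(\<Sum>k\<le>N. \<alpha> k * shift_sum T (modulate \<mu> (\<lambda>l. g l + c * g' l)) (\<lambda>t. \<eta> (t - real k * h))) = 0"
          unfolding eq Z_def by (simp only: combine mult_zero_right add_0_right)
      qed
    qed
    show "Z (\<lambda>_. 0)"
      by (simp add: Z_def modulate_def shift_sum_def)
    show "Z (seq_diff g)" if "Z g" for g
      unfolding Z_def
    proof
      fix \<eta> assume \<eta>: "\<eta> \<in> test_functions"
      have "(\<Sum>k\<le>N. \<alpha> k * shift_sum T (\<lambda>l. modulate \<mu> g (l + 1)) (\<lambda>t. \<eta> (t - real k * h))) =
          (\<Sum>k\<le>N. \<alpha> k * shift_sum T (modulate \<mu> g) (\<lambda>t. \<eta> (t - real k * h - 1)))"
        unfolding shift_sum_translate by (simp only: diff_diff_eq add.commute)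
      also have "\<dots> = 0"
        using that t[OF \<eta>, of 1] unfolding Z_def by fastforce
      finally show "(\<Sum>k\<le>N. \<alpha> k * shift_sum T (modulate \<mu> (seq_diff g)) (\<lambda>t. \<eta> (t - real k * h))) = 0"
        using that \<eta> unfolding modulate_seq_diff combine[OF \<eta>] Z_def by simp
    qed
    show "Z g0"
      using g0 by (simp add: Z_def)
    show "(seq_diff ^^ Suc d) (\<lambda>l. poly q (of_int l)) = (\<lambda>_. 0)"
      unfolding seq_diff_funpow_poly using poly_diff_funpow_eq_0[of q "Suc d"] q by simp
  qed (use top in simp_all)
  then show ?thesis
    using \<eta> by (simp add: Z_def)
qed

text \<open>The two exponents differ by \<open>2 \<pi> \<i> (l - l') / 2 ^ n\<close>, which is a multiple of \<open>2 \<pi> \<i>\<close> only if \<open>2 ^ n\<close> divides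
\<open>l - l'\<close>.\<close>

lemma exp_dyadic_inj:
  fixes \<mu> :: complex
  assumes eq: "exp ((\<mu> + 2 * of_real pi * \<i> * of_int l) / 2 ^ n) = exp ((\<mu> + 2 * of_real pi * \<i> * of_int l') / 2 ^ n)"
    and small: "\<bar>l - l'\<bar> < 2 ^ n"
  shows "l = l'"
proof -
  obtain m :: int where "(\<mu> + 2 * of_real pi * \<i> * of_int l) / 2 ^ n =
      (\<mu> + 2 * of_real pi * \<i> * of_int l') / 2 ^ n + of_int (2 * m) * of_real pi * \<i>"
    using eq by (auto simp: exp_eq)
  then have "2 * of_real pi * \<i> * of_int l = 2 * of_real pi * \<i> * (of_int l' + of_int m * 2 ^ n)"
    by (simp add: field_simps)
  then have "(of_int l :: complex) = of_int l' + of_int m * 2 ^ n"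
    by simp
  then have "(of_int l :: complex) = of_int (l' + m * 2 ^ n)"
    by simp
  then have "l - l' = m * 2 ^ n"
    by (simp only: of_int_eq_iff)
  then have "2 ^ n dvd l - l'" by simp
  then show ?thesis
    using small zdvd_not_zless[of "\<bar>l - l'\<bar>" "2 ^ n"] by (cases "l = l'") auto
qed

theorem theorem4p1:
  fixes N d :: nat
    and a :: "nat \<Rightarrow> real \<Rightarrow> complex"
    and C :: real
    and \<phi> :: functional
    and lam :: complex
    and p :: "nat \<Rightarrow> complex poly"
    and \<omega> :: "nat \<Rightarrow> real \<Rightarrow> complex"
    and f :: "real \<Rightarrow> complex"
  assumes "N \<ge> 1"
    and "\<And>j. j \<ge> 1 \<Longrightarrow> trig_poly N (a j)"
    and "\<And>j. j \<ge> 1 \<Longrightarrow> a j 0 = 1"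
    and "\<And>j. j \<ge> 1 \<Longrightarrow> (SUP y. norm (a j y)) \<le> C"
    and "compactly_supported_distribution \<phi>"
    and "\<And>y :: real. (\<lambda>j. a (Suc j) (y / 2 ^ Suc j)) has_prod fourier \<phi> (of_real y)"
    and "shifts_linearly_independent \<phi>"
    and "d \<le> N"
    and "\<And>k. k \<le> d \<Longrightarrow> p k \<noteq> 0 \<and> degree (p k) = k"
    and "\<And>k. k \<le> d \<Longrightarrow> real_analytic (\<omega> k)"
    and "\<And>k t. k \<le> d \<Longrightarrow> \<omega> k (t + 1) = \<omega> k t"
    and "\<exists>t. \<omega> d t \<noteq> 0"
    and "\<And>t. f t = exp (lam * of_real t) * (\<Sum>k\<le>d. poly (p k) (of_real t) * \<omega> k t)"
    and "real_analytic f"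
    and "dist_of_fun f \<in> shift_invariant_space \<phi>"
  shows "finite {(k, l :: int). k \<le> d \<and>
           (deriv ^^ k) (fourier \<phi>) (- \<i> * lam / (2 * of_real pi) + of_int l) \<noteq> 0} \<and>
         card {(k, l :: int). k \<le> d \<and>
           (deriv ^^ k) (fourier \<phi>) (- \<i> * lam / (2 * of_real pi) + of_int l) \<noteq> 0} \<le> N"
proof -
  obtain R where T: "carried_in \<phi> R"
    using carried_in_ex[OF assms(5)] by blast
  have "\<forall>j. \<exists>c :: nat \<Rightarrow> real. j \<ge> 1 \<longrightarrow> (\<forall>y. a j y = (\<Sum>m\<le>N. of_real (c m) * wave (of_nat m) y))"
  proof
    fix j
    show "\<exists>c :: nat \<Rightarrow> real. j \<ge> 1 \<longrightarrow> (\<forall>y. a j y = (\<Sum>m\<le>N. of_real (c m) * wave (of_nat m) y))"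
      using assms(2)[of j] unfolding trig_poly_def wave_def by (auto simp: mult_ac)
  qed
  then obtain c where c: "\<And>j y. j \<ge> 1 \<Longrightarrow> a j y = (\<Sum>m\<le>N. of_real (c j m :: real) * wave (of_nat m) y)"
    by metis
  interpret bounded_masks N "\<lambda>j m. of_real (c j m)" C
  proof
    fix j :: nat assume j: "j \<ge> 1"
    show "(\<Sum>m\<le>N. complex_of_real (c j m)) = 1"
      using assms(3)[OF j] c[OF j, of 0] by (simp add: wave_def)
    fix y
    have "norm (a j y) \<le> (\<Sum>m\<le>N. \<bar>c j m\<bar>)" for y
    proof -
      have "norm (wave (of_nat m) y) = 1" for m
        by (simp add: wave_def)
      then show ?thesis
        unfolding c[OF j] by (intro sum_norm_le) (simp add: norm_mult)
    qed
    then have "bdd_above (range (\<lambda>y. norm (a j y)))"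
      by (auto simp: bdd_above_def)
    then have "norm (a j y) \<le> (SUP y. norm (a j y))"
      by (rule cSUP_upper[OF UNIV_I])
    then show "norm (\<Sum>m\<le>N. complex_of_real (c j m) * wave (of_nat m) y) \<le> C"
      using assms(4)[OF j] unfolding c[OF j] by linarith
  qed
  have prod_eq: "mask_prod n k y = (\<Prod>j<k. a (Suc (j + n)) (y / 2 ^ Suc (j + n)))" for n k y
    unfolding mask_prod_def mask_def by (simp add: c add.commute)
  have lim: "(\<lambda>k. mask_prod 0 k y) \<longlonglongrightarrow> fourier \<phi> (of_real y)" for y
    using has_prod_imp_tendsto'[OF assms(6)[of y]] by (simp add: prod_eq)
  have conv: "convergent (\<lambda>k. mask_prod n k y)" for n y
  proof -
    have "convergent_prod (\<lambda>j. a (Suc j) (y / 2 ^ Suc j))"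
      using assms(6)[of y] by (auto simp: convergent_prod_def has_prod_def)
    then have "convergent_prod (\<lambda>j. a (Suc (j + n)) (y / 2 ^ Suc (j + n)))"
      by (rule convergent_prod_ignore_initial_segment)
    then show ?thesis
      unfolding prod_eq convergent_def
      using has_prod_imp_tendsto'[OF convergent_prod_has_prod] by blast
  qed
  \<comment> \<open>Up to the exponential factor, differences of \<open>f\<close> act on the polynomials alone, because the
\<open>\<omega> k\<close> are periodic.\<close>
  define u where "u t = (\<Sum>k\<le>d. poly (p k) (of_real t) * \<omega> k t)" for t
  have f_eq: "f = (\<lambda>t. exp (lam * of_real t) * u t)"
    using assms(13) by (simp add: u_def fun_eq_iff)
  have f_cont: "continuous_on UNIV f"
    using assms(14) by (intro continuous_on_smooth) (simp add: real_analytic_def)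
  have "u = (\<lambda>t. exp (- (lam * of_real t)) * f t)"
    by (simp add: f_eq fun_eq_iff exp_minus)
  then have u_cont: "continuous_on UNIV u"
    using f_cont by (auto intro!: continuous_intros)
  obtain cc where cc: "\<And>\<psi>. \<psi> \<in> test_functions \<Longrightarrow> dist_of_fun f \<psi> = shift_sum \<phi> cc \<psi>"
    using assms(15) by (auto simp: shift_invariant_space_def)
  define g0 where "g0 l = exp (- (lam * of_int l)) * cc l" for l
  have cc_eq: "cc = modulate lam g0"
    by (simp add: modulate_def g0_def fun_eq_iff exp_minus)
  have rep: "dist_of_fun (\<lambda>t. exp (lam * of_real t) * u t) \<psi> = shift_sum \<phi> (modulate lam g0) \<psi>"
    if "\<psi> \<in> test_functions" for \<psi>
    using cc[OF that] unfolding f_eq cc_eq .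
  have u_Suc: "(fun_diff ^^ Suc d) u = (\<lambda>_. 0)"
    using fun_diff_funpow_poly_periodic[of d \<omega> "Suc d" p, OF assms(11)] assms(9)
    unfolding u_def[abs_def] by (simp add: poly_diff_funpow_eq_0 del: funpow.simps)
  have "(fun_diff ^^ d) u = (\<lambda>t. \<Sum>k\<le>d. poly ((poly_diff ^^ d) (p k)) (of_real t) * \<omega> k t)"
    unfolding u_def[abs_def] by (rule fun_diff_funpow_poly_periodic) (rule assms(11))
  also have "\<dots> = (\<lambda>t. fact d * lead_coeff (p d) * \<omega> d t)"
  proof
    fix t
    have "poly ((poly_diff ^^ d) (p k)) (of_real t) = (if k = d then fact d * lead_coeff (p d) else 0)" if "k \<le> d" for k
    proof (cases "k = d")
      case True
      then show ?thesis
        using assms(9)[of d] poly_diff_funpow_degree[of "p d" d] by simp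
    next
      case False
      then show ?thesis
        using that assms(9)[of k] poly_diff_funpow_eq_0[of "p k" d] by simp
    qed
    then have "(\<Sum>k\<le>d. poly ((poly_diff ^^ d) (p k)) (of_real t) * \<omega> k t) =
        (\<Sum>k\<le>d. if k = d then fact d * lead_coeff (p d) * \<omega> d t else 0)"
      by (intro sum.cong) auto
    then show "(\<Sum>k\<le>d. poly ((poly_diff ^^ d) (p k)) (of_real t) * \<omega> k t) = fact d * lead_coeff (p d) * \<omega> d t"
      by simp
  qed
  finally have u_d: "(fun_diff ^^ d) u \<noteq> (\<lambda>_. 0)"
    using assms(12) assms(9)[of d] leading_coeff_0_iff[of "p d"] by (auto simp: fun_eq_iff)
  note g0_top = coefficients_exponential_polynomial[OF T assms(7) u_cont rep u_Suc u_d]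
  define z where "z l = - \<i> * lam / (2 * of_real pi) + of_int l" for l :: int
  have wave_z: "wave (z l) x = exp (- (lam + 2 * of_real pi * \<i> * of_int l) * of_real x)" for l x
  proof -
    have "- 2 * of_real pi * \<i> * of_real x * z l = - (lam + 2 * of_real pi * \<i> * of_int l) * of_real x"
      by (simp add: z_def field_simps)
    then show ?thesis by (simp only: wave_def)
  qed
  have per: "wave (z l) (of_int m) = exp (- lam * of_int m)" for l m
  proof -
    have "exp (- (lam + 2 * of_real pi * \<i> * of_int l) * of_int m) =
        exp (- lam * of_int m) * exp ((2 * of_int (- (l * m)) * of_real pi) * \<i>)"
      by (simp add: algebra_simps flip: exp_add)
    also have "exp ((2 * of_int (- (l * m)) * of_real pi) * \<i>) = 1"
      unfolding exp_eq_1 by (auto intro!: exI[of _ "- (l * m)"])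
    finally show ?thesis by (simp add: wave_z)
  qed
  let ?S = "{(k, l :: int). k \<le> d \<and> (deriv ^^ k) (fourier \<phi>) (- \<i> * lam / (2 * of_real pi) + of_int l) \<noteq> 0}"
  have S_eq: "?S = {(k, l). k \<le> d \<and> moment \<phi> R k (z l) \<noteq> 0}"
    by (simp add: higher_deriv_fourier[OF T] z_def)
  have "card F \<le> N" if F: "F \<subseteq> ?S" "finite F" for F
  proof -
    define \<Lambda> where "\<Lambda> = snd ` F"
    have fin\<Lambda>: "finite \<Lambda>" using F by (simp add: \<Lambda>_def)
    define B where "B = (\<Sum>l\<in>\<Lambda>. \<bar>l\<bar>)"
    have B: "\<bar>l\<bar> \<le> B" if "l \<in> \<Lambda>" for l
      unfolding B_def using that fin\<Lambda> by (intro member_le_sum) auto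
    \<comment> \<open>At this scale the points \<open>\<zeta> l\<close> with \<open>l \<in> \<Lambda>\<close> are distinct.\<close>
    obtain n where n: "2 * B < 2 ^ n"
      using real_arch_pow[of 2 "real_of_int (2 * B)"]
      by (metis of_int_less_iff of_int_numeral of_int_power one_less_numeral_iff semiring_norm(76))
    define h :: real where "h = 1 / 2 ^ n"
    have h: "h \<noteq> 0" by (simp add: h_def)
    obtain \<alpha> where \<alpha>: "\<exists>k\<le>N. \<alpha> k \<noteq> 0" "\<And>t. (\<Sum>k\<le>N. \<alpha> k * f (t + real k * h)) = 0"
      using shift_relation[OF T lim conv f_cont real_analytic_local_power_series[OF assms(14)] cc, of n]
      by (auto simp: h_def)
    define A where "A = (\<Sum>k\<le>N. monom (\<alpha> k) k)"
    have coeffA: "coeff A k = (if k \<le> N then \<alpha> k else 0)" for k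
      unfolding A_def coeff_sum coeff_monom by simp
    have "A \<noteq> 0"
      using \<alpha>(1) coeffA by (metis coeff_0)
    have degA: "degree A \<le> N"
      by (rule degree_le) (simp add: coeffA)
    have base: "(\<Sum>k\<le>N. \<alpha> k * shift_sum \<phi> (modulate lam g0) (\<lambda>t. \<eta> (t - real k * h))) = 0"
      if \<eta>: "\<eta> \<in> test_functions" for \<eta>
    proof -
      have t: "(\<lambda>t. \<eta> (t - real k * h)) \<in> test_functions" for k
        using test_shift[OF \<eta>, of "- (real k * h)"] by simp
      have int: "integrable lborel (\<lambda>t. \<alpha> k * (f (t + real k * h) * \<eta> t))" for k
        by (intro integrable_mult_right integrable_continuous_times_test \<eta> continuous_on_compose2[OF f_cont]
            continuous_intros) auto
      have "(\<Sum>k\<le>N. \<alpha> k * shift_sum \<phi> (modulate lam g0) (\<lambda>t. \<eta> (t - real k * h))) =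
          (\<Sum>k\<le>N. \<alpha> k * (LINT t|lborel. f (t + real k * h) * \<eta> t))"
        unfolding cc_eq[symmetric] cc[OF t, symmetric] dist_of_fun_def lborel_integral_translate ..
      also have "\<dots> = (LINT t|lborel. (\<Sum>k\<le>N. \<alpha> k * (f (t + real k * h) * \<eta> t)))"
        by (subst Bochner_Integration.integral_sum) (use int in auto)
      also have "\<dots> = (LINT t|lborel. (\<Sum>k\<le>N. \<alpha> k * f (t + real k * h)) * \<eta> t)"
        by (simp only: sum_distrib_right mult.assoc)
      finally show ?thesis by (simp add: \<alpha>(2))
    qed
    define \<zeta> where "\<zeta> l = exp ((lam + 2 * of_real pi * \<i> * of_int l) / 2 ^ n)" for l :: int
    have wave_\<zeta>: "wave (z l) (- (real k * h)) = \<zeta> l ^ k" for l k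
      unfolding wave_z \<zeta>_def h_def exp_of_nat_mult[symmetric]
      by (rule arg_cong[where f = exp]) (simp add: field_simps)
    have order: "card {k. k \<le> d \<and> moment \<phi> R k (z l) \<noteq> 0} \<le> order (\<zeta> l) A" for l
    proof (rule order_ge_card_moments[OF _ h A_def \<open>A \<noteq> 0\<close>])
      fix j assume "j \<le> d"
      show "(\<Sum>i\<le>j. of_nat (j choose i) * moment \<phi> R i (z l) *
          (\<Sum>k\<le>N. \<alpha> k * of_real (- (real k * h)) ^ (j - i) * \<zeta> l ^ k)) = 0"
        unfolding wave_\<zeta>[symmetric]
        by (rule poisson_moments[OF T per annihilated_polynomial_sequences[OF T base g0_top] \<open>j \<le> d\<close>])
    qed (simp add: \<zeta>_def)
    have inj: "inj_on \<zeta> \<Lambda>"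
    proof (rule inj_onI)
      fix l l' assume l: "l \<in> \<Lambda>" "l' \<in> \<Lambda>" and "\<zeta> l = \<zeta> l'"
      then show "l = l'"
        unfolding \<zeta>_def using B[OF l(1)] B[OF l(2)] n by (elim exp_dyadic_inj) linarith
    qed
    have "F \<subseteq> (\<lambda>(l, k). (k, l)) ` (SIGMA l:\<Lambda>. {k. k \<le> d \<and> moment \<phi> R k (z l) \<noteq> 0})"
      using F(1) unfolding S_eq \<Lambda>_def by force
    moreover have fin: "finite (SIGMA l:\<Lambda>. {k. k \<le> d \<and> moment \<phi> R k (z l) \<noteq> 0})"
      using fin\<Lambda> by (intro finite_SigmaI) auto
    ultimately have "card F \<le> card (SIGMA l:\<Lambda>. {k. k \<le> d \<and> moment \<phi> R k (z l) \<noteq> 0})"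
      by (rule surj_card_le[rotated])
    also have "\<dots> = (\<Sum>l\<in>\<Lambda>. card {k. k \<le> d \<and> moment \<phi> R k (z l) \<noteq> 0})"
      using fin\<Lambda> by (intro card_SigmaI) auto
    also have "\<dots> \<le> (\<Sum>l\<in>\<Lambda>. order (\<zeta> l) A)"
      by (intro sum_mono order)
    also have "\<dots> = (\<Sum>x\<in>\<zeta> ` \<Lambda>. order x A)"
      using inj by (simp add: sum.reindex)
    also have "\<dots> \<le> degree A"
      by (rule sum_order_le) (use \<open>A \<noteq> 0\<close> fin\<Lambda> in auto)
    finally show ?thesis using degA by simp
  qed
  then show ?thesis
    by (rule finite_if_finite_subsets_card_bdd)
qed

end
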